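(* Let $(V,\omega)$ be a real symplectic vector space of dimension $2n>0$. Then $\mathcal{U}^+(V)$ is an open semialgebraic subset of the space of complex-valued primitive forms $(\Lambda^n_{\mathrm{pr}}V^\vee)\otimes_{\mathbb R}\mathbb{C}$, it has the homotopy type of $S^1$, and $\mathrm{Sp}(V)$ acts properly on it (by pullback of forms).
   Context: Let $(V,\omega)$ be a real symplectic vector space of dimension $2n$. An $n$-form $\Omega$ on $V$ is primitive if $\Omega\wedge\omega=0$; $\Lambda^n_{\mathrm{pr}}V^\vee\subset\Lambda^nV^\vee$ is the real vector space of primitive $n$-forms. $\mathcal{U}(V)\subset(\Lambda^n_{\mathrm{pr}}V^\vee)\otimes_{\mathbb R}\mathbb{C}$ is the set of those $\Omega$ whose restriction $\Omega|_L\in(\Lambda^nL^\vee)\otimes\mathbb{C}$ is non-zero for every Lagrangian subspace $L\subset V$. Let $\mathrm{LGr}(V)$ be the Lagrangian Grassmannian. For $\Omega\in\mathcal{U}(V)$ define $\phi_\Omega:\mathrm{LGr}(V)\to\mathbb{R}/\pi\mathbb{Z}$, $L\mapsto\mathrm{Arg}(\Omega|_L)$ (well defined modulo $\pi$, since $\Lambda^nL^\vee\otimes\mathbb{C}\cong\mathbb{C}$ up to a non-zero real scalar). For $n\geq 1$ there is a canonical isomorphism $\pi_1(\mathrm{LGr}(V))\cong\mathbb{Z}$: for $V=\mathbb{C}^n$ with coordinates $z_k=x_k+iy_k$ and $\omega=\sum_k dx_k\wedge dy_k$, the canonical generator is the class of the loop $\mathbb{R}/\pi\mathbb{Z}\ni\theta\mapsto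 e^{i\theta}\mathbb{R}\times\mathbb{R}^{n-1}$; for general $V$ it is transported by any linear symplectomorphism $V\cong\mathbb{C}^n$. Then $\mathcal{U}^+(V)$ (resp. $\mathcal{U}^-(V)$) is the set of $\Omega\in\mathcal{U}(V)$ such that $\phi_\Omega$ sends the canonical generator to the positive (resp. negative) generator of $\pi_1(\mathbb{R}/\pi\mathbb{Z})$. *)

theory Defs
  imports "HOL-Analysis.Analysis" "HOL-Library.Real_Mod" "HOL-Algebra.Group_Action"
begin

text \<open>
  The symplectic vector space is a type \<open>'a::euclidean_space\<close> (every finite-dimensional real
  vector space is isomorphic to one) with a form \<open>\<omega>\<close>. The inner product of the class is never
  used; its norm only provides the unique Hausdorff vector space topology.
\<close>

definition symplectic_form :: "('a::real_vector \<Rightarrow> 'a \<Rightarrow> real) \<Rightarrow> bool" where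
  "symplectic_form \<omega> \<longleftrightarrow>
     bilinear \<omega> \<and> (\<forall>x. \<omega> x x = 0) \<and> (\<forall>x. (\<forall>y. \<omega> x y = 0) \<longrightarrow> x = 0)"

text \<open>
  A \<open>p\<close>-form takes its arguments as a sequence \<open>v :: nat \<Rightarrow> 'a\<close> of which it sees only
  \<open>v 0, \<dots>, v (p - 1)\<close>. In this way every alternating multilinear map of \<open>p\<close> arguments is
  represented by exactly one function.
\<close>

definition alternating_forms :: "nat \<Rightarrow> ((nat \<Rightarrow> 'a::real_vector) \<Rightarrow> real) set" where
  "alternating_forms p =
     {\<alpha>. (\<forall>v w. (\<forall>i<p. v i = w i) \<longrightarrow> \<alpha> v = \<alpha> w) \<and>
         (\<forall>v. \<forall>i<p. linear (\<lambda>x. \<alpha> (v(i := x)))) \<and>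
         (\<forall>v. \<forall>i<p. \<forall>j<p. i \<noteq> j \<and> v i = v j \<longrightarrow> \<alpha> v = 0)}"

definition wedge ::
  "nat \<Rightarrow> nat \<Rightarrow> ((nat \<Rightarrow> 'a) \<Rightarrow> real) \<Rightarrow> ((nat \<Rightarrow> 'a) \<Rightarrow> real) \<Rightarrow> (nat \<Rightarrow> 'a) \<Rightarrow> real" where
  "wedge p q \<alpha> \<beta> v =
     (\<Sum>\<sigma> | \<sigma> permutes {..<p + q}.
        of_int (sign \<sigma>) * \<alpha> (\<lambda>i. v (\<sigma> i)) * \<beta> (\<lambda>i. v (\<sigma> (p + i)))) / (fact p * fact q)"

definition primitive_forms ::
  "nat \<Rightarrow> ('a::real_vector \<Rightarrow> 'a \<Rightarrow> real) \<Rightarrow> ((nat \<Rightarrow> 'a) \<Rightarrow> real) set" where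
  "primitive_forms n \<omega> =
     {\<alpha> \<in> alternating_forms n. wedge n 2 \<alpha> (\<lambda>v. \<omega> (v 0) (v 1)) = (\<lambda>v. 0)}"

text \<open>
  The complexification of the space of primitive forms, inside the complex-valued functions.
  As a subset of a function type it carries the topology of pointwise convergence, which on
  this finite-dimensional space is the vector space topology.
\<close>

definition complex_primitive_forms ::
  "nat \<Rightarrow> ('a::real_vector \<Rightarrow> 'a \<Rightarrow> real) \<Rightarrow> ((nat \<Rightarrow> 'a) \<Rightarrow> complex) set" where
  "complex_primitive_forms n \<omega> =
     {\<lambda>v. complex_of_real (\<alpha> v) + \<i> * complex_of_real (\<beta> v) | \<alpha> \<beta>.
        \<alpha> \<in> primitive_forms n \<omega> \<and> \<beta> \<in> primitive_forms n \<omega>}"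

definition pullback :: "('a \<Rightarrow> 'a) \<Rightarrow> ((nat \<Rightarrow> 'a) \<Rightarrow> complex) \<Rightarrow> (nat \<Rightarrow> 'a) \<Rightarrow> complex" where
  "pullback g \<Omega> = (\<lambda>v. \<Omega> (\<lambda>i. g (v i)))"

definition lagrangian_grassmannian ::
  "nat \<Rightarrow> ('a::euclidean_space \<Rightarrow> 'a \<Rightarrow> real) \<Rightarrow> 'a set set" where
  "lagrangian_grassmannian n \<omega> =
     {L. subspace L \<and> dim L = n \<and> (\<forall>x\<in>L. \<forall>y\<in>L. \<omega> x y = 0)}"

definition U_set ::
  "nat \<Rightarrow> ('a::euclidean_space \<Rightarrow> 'a \<Rightarrow> real) \<Rightarrow> ((nat \<Rightarrow> 'a) \<Rightarrow> complex) set" where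
  "U_set n \<omega> =
     {\<Omega> \<in> complex_primitive_forms n \<omega>.
        \<forall>L \<in> lagrangian_grassmannian n \<omega>. \<exists>v. (\<forall>i. v i \<in> L) \<and> \<Omega> v \<noteq> 0}"

quotient_type real_mod_pi = real / "\<lambda>x y. [x = y] (rmod pi)"
  by (intro equivpI reflpI sympI transpI) (auto intro: rcong_sym rcong_trans)

instantiation real_mod_pi :: topological_space
begin

definition open_real_mod_pi :: "real_mod_pi set \<Rightarrow> bool" where
  "open_real_mod_pi U \<longleftrightarrow> open (abs_real_mod_pi -` U)"

instance
  by standard (auto simp: open_real_mod_pi_def vimage_Union)

end

text \<open>
  \<open>\<Omega>\<close> restricted to an \<open>n\<close>-dimensional \<open>L\<close> is identified with its value on a basis of \<open>L\<close>.
  Another basis multiplies that value by a non-zero real, so the choice does not affect the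
  argument modulo \<open>\<pi>\<close>.
\<close>

definition phase ::
  "nat \<Rightarrow> ((nat \<Rightarrow> 'a::euclidean_space) \<Rightarrow> complex) \<Rightarrow> 'a set \<Rightarrow> real_mod_pi" where
  "phase n \<Omega> L = abs_real_mod_pi (Arg (\<Omega> (SOME v. span (v ` {..<n}) = L)))"

text \<open>\<open>\<complex>\<^sup>n\<close> consists of the sequences supported on the indices \<open>0, \<dots>, n - 1\<close>.\<close>

definition complex_space :: "nat \<Rightarrow> (nat \<Rightarrow> complex) set" where
  "complex_space n = {z. \<forall>k\<ge>n. z k = 0}"

definition standard_form :: "nat \<Rightarrow> (nat \<Rightarrow> complex) \<Rightarrow> (nat \<Rightarrow> complex) \<Rightarrow> real" where
  "standard_form n z w = (\<Sum>k<n. Re (z k) * Im (w k) - Im (z k) * Re (w k))"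

definition linear_symplectomorphism ::
  "nat \<Rightarrow> ('a::real_vector \<Rightarrow> 'a \<Rightarrow> real) \<Rightarrow> ((nat \<Rightarrow> complex) \<Rightarrow> 'a) \<Rightarrow> bool" where
  "linear_symplectomorphism n \<omega> T \<longleftrightarrow>
     bij_betw T (complex_space n) UNIV \<and>
     (\<forall>z\<in>complex_space n. \<forall>w\<in>complex_space n. \<forall>a b :: real.
        T (\<lambda>k. of_real a * z k + of_real b * w k) = a *\<^sub>R T z + b *\<^sub>R T w) \<and>
     (\<forall>z\<in>complex_space n. \<forall>w\<in>complex_space n. \<omega> (T z) (T w) = standard_form n z w)"

text \<open>The Lagrangian subspace \<open>e\<^bsup>i\<theta>\<^esup>\<real> \<times> \<real>\<^bsup>n-1\<^esup>\<close> of \<open>\<complex>\<^sup>n\<close>.\<close>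

definition standard_lagrangian :: "nat \<Rightarrow> real \<Rightarrow> (nat \<Rightarrow> complex) set" where
  "standard_lagrangian n \<theta> =
     {z \<in> complex_space n. z 0 \<in> range (\<lambda>t. cis \<theta> * complex_of_real t) \<and> (\<forall>k>0. z k \<in> \<real>)}"

text \<open>
  The image of the canonical generator under \<open>\<phi>\<^sub>\<Omega>\<close> is the class of the loop
  \<open>\<theta> \<mapsto> \<phi>\<^sub>\<Omega> (T (e\<^bsup>i\<theta>\<^esup>\<real> \<times> \<real>\<^bsup>n-1\<^esup>))\<close>, where \<open>\<theta> = \<pi> t\<close>, and the positive generator is the class of
  the identity loop of \<open>\<real>/\<pi>\<int>\<close>. Since \<open>\<real>/\<pi>\<int>\<close> is a topological group, its fundamental group is
  abelian and independent of the base point, and equality of classes is free homotopy of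
  loops. The loops for different symplectomorphisms \<open>T\<close> are homotopic in the Lagrangian
  Grassmannian, because the symplectic group is connected.
\<close>

definition U_plus ::
  "nat \<Rightarrow> ('a::euclidean_space \<Rightarrow> 'a \<Rightarrow> real) \<Rightarrow> ((nat \<Rightarrow> 'a) \<Rightarrow> complex) set" where
  "U_plus n \<omega> =
     {\<Omega> \<in> U_set n \<omega>. \<exists>T. linear_symplectomorphism n \<omega> T \<and>
        homotopic_loops UNIV (\<lambda>t. phase n \<Omega> (T ` standard_lagrangian n (pi * t)))
                             (\<lambda>t. abs_real_mod_pi (pi * t))}"

text \<open>
  Below, \<open>W\<close> is a finite-dimensional real vector space of complex-valued functions. Polynomial
  functions on \<open>W\<close> are the polynomials in real linear functionals on \<open>W\<close>, that is, in linear
  coordinates; semialgebraic sets are the finite Boolean combinations of polynomial equations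
  and inequalities.
\<close>

definition linear_functional_on ::
  "('b \<Rightarrow> complex) set \<Rightarrow> (('b \<Rightarrow> complex) \<Rightarrow> real) \<Rightarrow> bool" where
  "linear_functional_on W f \<longleftrightarrow>
     (\<forall>x\<in>W. \<forall>y\<in>W. \<forall>a b :: real.
        f (\<lambda>v. of_real a * x v + of_real b * y v) = a * f x + b * f y)"

inductive polynomial_function_on ::
  "('b \<Rightarrow> complex) set \<Rightarrow> (('b \<Rightarrow> complex) \<Rightarrow> real) \<Rightarrow> bool" for W where
  linear: "linear_functional_on W f \<Longrightarrow> polynomial_function_on W f"
| const: "polynomial_function_on W (\<lambda>x. c)"
| add: "polynomial_function_on W f \<Longrightarrow> polynomial_function_on W g \<Longrightarrow>
        polynomial_function_on W (\<lambda>x. f x + g x)"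
| mult: "polynomial_function_on W f \<Longrightarrow> polynomial_function_on W g \<Longrightarrow>
         polynomial_function_on W (\<lambda>x. f x * g x)"

inductive semialgebraic_in ::
  "('b \<Rightarrow> complex) set \<Rightarrow> ('b \<Rightarrow> complex) set \<Rightarrow> bool" for W where
  zero: "polynomial_function_on W f \<Longrightarrow> semialgebraic_in W {x \<in> W. f x = 0}"
| pos: "polynomial_function_on W f \<Longrightarrow> semialgebraic_in W {x \<in> W. f x > 0}"
| union: "semialgebraic_in W A \<Longrightarrow> semialgebraic_in W B \<Longrightarrow> semialgebraic_in W (A \<union> B)"
| inter: "semialgebraic_in W A \<Longrightarrow> semialgebraic_in W B \<Longrightarrow> semialgebraic_in W (A \<inter> B)"
| compl: "semialgebraic_in W A \<Longrightarrow> semialgebraic_in W (W - A)"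

definition Sp ::
  "('a::euclidean_space \<Rightarrow> 'a \<Rightarrow> real) \<Rightarrow> ('a \<Rightarrow>\<^sub>L 'a) monoid" where
  "Sp \<omega> =
     \<lparr>carrier = {g. \<forall>x y. \<omega> (blinfun_apply g x) (blinfun_apply g y) = \<omega> x y},
      monoid.mult = (o\<^sub>L), one = id_blinfun\<rparr>"

text \<open>
  The action on forms is by pullback; to make it a left action, \<open>g\<close> acts by pullback along its
  inverse. It is a function extensional on \<open>U_plus n \<omega>\<close>, as \<open>group_action\<close> requires.
\<close>

definition Sp_action ::
  "nat \<Rightarrow> ('a::euclidean_space \<Rightarrow> 'a \<Rightarrow> real) \<Rightarrow>
   ('a \<Rightarrow>\<^sub>L 'a) \<Rightarrow> ((nat \<Rightarrow> 'a) \<Rightarrow> complex) \<Rightarrow> (nat \<Rightarrow> 'a) \<Rightarrow> complex" where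
  "Sp_action n \<omega> g =
     restrict (\<lambda>\<Omega>. pullback (blinfun_apply (inv\<^bsub>Sp \<omega>\<^esub> g)) \<Omega>) (U_plus n \<omega>)"

text \<open>
  The library's \<open>proper_map\<close> (closed with compact fibres) does not include continuity, which is
  therefore demanded separately.
\<close>

definition acts_properly ::
  "('g::topological_space) monoid \<Rightarrow> ('x::topological_space) set \<Rightarrow> ('g \<Rightarrow> 'x \<Rightarrow> 'x) \<Rightarrow> bool" where
  "acts_properly G X act \<longleftrightarrow>
     group_action G X act \<and>
     continuous_on (carrier G \<times> X) (\<lambda>(g, x). act g x) \<and>
     proper_map (top_of_set (carrier G \<times> X)) (top_of_set (X \<times> X)) (\<lambda>(g, x). (act g x, x))"

end

theory Submission
  imports Defs "HOL-Complex_Analysis.Complex_Analysis" "HOL-Library.Multiset_Order"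
begin

text \<open>
  The set \<open>U_plus\<close> is first described by inequalities. On the Lagrangian subspaces spanned by
  \<open>cos \<theta> * e\<^sub>0 + sin \<theta> * f\<^sub>0, e\<^sub>1, \<dots>\<close>, where \<open>e, f\<close> is a symplectic basis, a form \<open>\<Omega>\<close> takes the
  values \<open>cos \<theta> * a + sin \<theta> * b\<close>, with \<open>a\<close> its value on \<open>e\<close> and \<open>b\<close> its value after replacing
  \<open>e\<^sub>0\<close> by \<open>f\<^sub>0\<close>. For \<open>\<Omega>\<close> in \<open>U_set\<close> these never vanish, so \<open>a\<close> and \<open>b\<close> are a real basis of the
  plane, and the phase loop represents the positive generator exactly if this basis is positive:
  \<open>Im (cnj a * b) > 0\<close> (\<open>plane_loop_homotopic_iff\<close>). The sign is the same for all symplectic bases,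
  because transvections connect any two of them (\<open>frame_transvection_induct\<close>). Thus \<open>U_plus\<close> is cut
  out of \<open>U_set\<close> by one polynomial inequality (\<open>U_plus_iff\<close>), while membership in \<open>U_set\<close> means
  nonvanishing on the compact set of orthonormal bases of Lagrangian subspaces (\<open>U_set_iff\<close>). Openness
  follows.

  For semialgebraicity, the complement of \<open>U_set\<close> is a projection of a set given by polynomial
  equations, so the Tarski-Seidenberg theorem is needed (\<open>semialg_projection\<close>). It is proved by the
  elimination procedure of Cohen and Hoermander in a form without tables of signs: the parameter
  space of a finite family of polynomials in one variable is a finite union of semialgebraic pieces,
  and for any two parameters in the same piece an increasing bijection of the line preserves all
  signs of the family (\<open>stratified_exists\<close>).

  For the homotopy type, let \<open>J\<close> be a compatible complex structure and extend forms complex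
  multilinearly. A form in \<open>U_plus\<close> does not vanish on the vectors \<open>e\<^sub>k + z\<^sub>k * f\<^sub>k\<close> if all \<open>z\<^sub>k\<close> lie in
  the closed lower half plane (\<open>mixed_lower_half_plane_nonzero\<close>): in each variable the value is affine,
  and the sign condition keeps its zero in the upper half plane. Hence the pullback along
  \<open>(1 - \<i> \<kappa> J) / (1 + \<kappa>)\<close>, \<open>0 \<le> \<kappa> \<le> 1\<close>, maps \<open>U_plus\<close> to itself (\<open>flow_U_plus\<close>); it preserves primitivity
  since this map multiplies \<open>\<omega>\<close> by a scalar. For \<open>\<kappa> = 1\<close> the result is a multiple of the holomorphic
  volume form, so \<open>U_plus\<close> is contracted to a punctured complex line.

  For properness, the singular values of a symplectic map \<open>g\<close> come in pairs \<open>\<lambda>, 1 / \<lambda>\<close> exchanged by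
  \<open>J\<close>. The singular vectors with value at least 1 span a Lagrangian subspace, on which \<open>g\<close> expands the
  volume by at least the norm of \<open>g\<close> (\<open>singular_value_frame\<close>). So if \<open>\<Omega>\<close> stays bounded on
  unitary frames while its translate by \<open>g\<close> stays away from zero on them, then \<open>g\<close> stays in a
  compact set.
\<close>

section \<open>Signs of polynomials in one variable\<close>


text \<open>
  Outside the given points the map is piecewise affine; beyond the last point it continues with
  the slope of the last segment, so that it stays onto.
\<close>

lemma strict_mono_interpolation:
  fixes f :: "real \<Rightarrow> real"
  assumes "finite S" "strict_mono_on S f"
  shows "\<exists>k. strict_mono k \<and> surj k \<and> (\<forall>s\<in>S. k s = f s)"
  using assms
proof (induction S rule: finite_linorder_max_induct)
  case empty
  have "strict_mono (\<lambda>t::real. t)" by (simp add: strict_mono_def)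
  then show ?case by (intro exI[of _ "\<lambda>t::real. t"]) auto
next
  case (insert m S)
  have monoS: "strict_mono_on S f"
    using insert.prems by (auto simp: strict_mono_on_def)
  obtain k where k: "strict_mono k" "surj k" "\<forall>s\<in>S. k s = f s"
    using insert.IH[OF monoS] by blast
  show ?case
  proof (cases "S = {}")
    case True
    have "strict_mono (\<lambda>t. t + (f m - m))" by (simp add: strict_mono_def)
    moreover have "surj (\<lambda>t. t + (f m - m))"
      by (rule surjI[of _ "\<lambda>y. y - (f m - m)"]) simp
    ultimately show ?thesis using True by (intro exI[of _ "\<lambda>t. t + (f m - m)"]) auto
  next
    case False
    define s where "s = Max S"
    have s: "s \<in> S" "s < m" using insert.hyps False by (auto simp: s_def)
    have le_s: "t \<le> s" if "t \<in> S" for t using that insert.hyps by (auto simp: s_def)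
    have fs: "f s < f m" using insert.prems s by (auto simp: strict_mono_on_def)
    define c where "c = (f m - f s) / (m - s)"
    have c: "c > 0" using fs s by (simp add: c_def)
    define k' where "k' t = (if t \<le> s then k t else f s + c * (t - s))" for t
    have ks: "k s = f s" using k s by auto
    have "strict_mono k'"
    proof (rule strict_monoI)
      fix x y :: real assume xy: "x < y"
      consider "y \<le> s" | "x \<le> s" "s < y" | "s < x" by linarith
      then show "k' x < k' y"
      proof cases
        case 1 then show ?thesis using k(1) xy by (simp add: k'_def strict_mono_def)
      next
        case 2
        have "k x \<le> k s" using k(1) 2 by (simp add: strict_mono_less_eq)
        moreover have "c * (y - s) > 0" using c 2 by simp
        ultimately show ?thesis using 2 ks by (simp add: k'_def)
      next
        case 3 then show ?thesis using c xy by (simp add: k'_def)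
      qed
    qed
    moreover have "surj k'"
    proof (unfold surj_def, intro allI)
      fix y :: real
      have "\<exists>x. k' x = y"
      proof (cases "y \<le> f s")
        case True
        obtain x where x: "k x = y" using k(2) by (metis surjD)
        have "x \<le> s" using True x ks k(1) by (metis strict_mono_less_eq)
        then show ?thesis using x by (intro exI[of _ x]) (simp add: k'_def)
      next
        case False
        then have "(y - f s) / c > 0" using c by simp
        then have "\<not> s + (y - f s) / c \<le> s" by linarith
        then show ?thesis using c by (intro exI[of _ "s + (y - f s) / c"]) (simp add: k'_def)
      qed
      then show "\<exists>x. y = k' x" by metis
    qed
    moreover have "k' t = f t" if "t \<in> insert m S" for t
    proof (cases "t = m")
      case True then show ?thesis using s by (simp add: k'_def c_def)
    next
      case False then show ?thesis using that k le_s by (simp add: k'_def)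
    qed
    ultimately show ?thesis by blast
  qed
qed

text \<open>
  The points of \<open>Z\<close> cut the line into the points of \<open>Z\<close> themselves and the open intervals between
  them, and \<open>s\<close>, \<open>t\<close> lie in the same one of these cells.
\<close>

definition same_gap :: "real set \<Rightarrow> real \<Rightarrow> real \<Rightarrow> bool" where
  "same_gap Z s t \<longleftrightarrow> (\<forall>z\<in>Z. (z < s \<longleftrightarrow> z < t) \<and> (s < z \<longleftrightarrow> t < z))"

lemma same_gap_refl [simp]: "same_gap Z t t" by (simp add: same_gap_def)
lemma same_gap_sym: "same_gap Z s t \<Longrightarrow> same_gap Z t s" by (simp add: same_gap_def)
lemma same_gap_trans:
  assumes "same_gap Z s t" "same_gap Z t u"
  shows "same_gap Z s u"
proof -
  have "(z < s \<longleftrightarrow> z < u) \<and> (s < z \<longleftrightarrow> u < z)" if "z \<in> Z" for z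
    using assms that unfolding same_gap_def by blast
  then show ?thesis unfolding same_gap_def by blast
qed
lemma same_gap_mem: "same_gap Z s t \<Longrightarrow> s \<in> Z \<Longrightarrow> t = s"
  unfolding same_gap_def by (meson less_irrefl linorder_less_linear)
lemma same_gap_mem2: "same_gap Z s t \<Longrightarrow> s \<in> Z \<longleftrightarrow> t \<in> Z"
  using same_gap_mem same_gap_sym by metis
lemma same_gap_between:
  assumes "same_gap Z s t" "s \<le> u" "u \<le> t"
  shows "same_gap Z s u"
proof -
  have "(z < s \<longleftrightarrow> z < u) \<and> (s < z \<longleftrightarrow> u < z)" if "z \<in> Z" for z
  proof -
    have "(z < s \<longleftrightarrow> z < t) \<and> (s < z \<longleftrightarrow> t < z)"
      using assms(1) that unfolding same_gap_def by blast
    then show ?thesis using assms(2,3) by linarith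
  qed
  then show ?thesis unfolding same_gap_def by blast
qed
lemma same_gap_betweenI:
  assumes "s \<le> u" "\<not> (\<exists>z\<in>Z. s \<le> z \<and> z \<le> u)"
  shows "same_gap Z s u"
proof -
  have "(z < s \<longleftrightarrow> z < u) \<and> (s < z \<longleftrightarrow> u < z)" if "z \<in> Z" for z
  proof -
    have "z < s \<or> u < z" using assms(2) that by (meson not_le)
    then show ?thesis using assms(1) by linarith
  qed
  then show ?thesis unfolding same_gap_def by blast
qed

lemma poly_root_between_opposite_signs:
  fixes p :: "real poly"
  assumes "s < t" "sgn (poly p s) \<noteq> sgn (poly p t)" 
  shows "\<exists>u. s \<le> u \<and> u \<le> t \<and> poly p u = 0"
proof (cases "poly p s = 0 \<or> poly p t = 0")
  case True then show ?thesis using assms(1) by (meson less_imp_le order_refl)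
next
  case False
  then have "poly p s < 0 \<and> 0 < poly p t \<or> 0 < poly p s \<and> poly p t < 0"
    using assms(2) by (auto simp: sgn_if split: if_splits)
  then have "\<exists>x>s. x < t \<and> poly p x = 0"
    using poly_IVT_pos[OF assms(1), of p] poly_IVT_neg[OF assms(1), of p] by blast
  then show ?thesis by (meson less_imp_le)
qed

text \<open>
  By the intermediate value theorem a polynomial changes sign only across one of its roots.
\<close>

lemma sgn_poly_same_gap:
  fixes p :: "real poly"
  assumes Z: "\<And>t. poly p t = 0 \<Longrightarrow> t \<in> Z" and g: "same_gap Z s t"
  shows "sgn (poly p s) = sgn (poly p t)"
proof -
  have *: "sgn (poly p a) = sgn (poly p b)" if "a < b" "same_gap Z a b" for a b
  proof (rule ccontr)
    assume "sgn (poly p a) \<noteq> sgn (poly p b)"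
    then obtain u where u: "a \<le> u" "u \<le> b" "poly p u = 0"
      using poly_root_between_opposite_signs[OF \<open>a < b\<close>] by blast
    then have "u \<in> Z" using Z by blast
    moreover have "same_gap Z u a" using same_gap_between[OF that(2) u(1,2)] same_gap_sym by blast
    moreover have "same_gap Z u b" using calculation that(2) same_gap_trans by blast
    ultimately have "a = u" "b = u" using same_gap_mem by blast+
    then show False using that by simp
  qed
  show ?thesis
  proof (cases s t rule: linorder_cases)
    case less then show ?thesis using * g by blast
  next
    case greater then show ?thesis using *[of t s] same_gap_sym[OF g] by simp
  qed simp
qed

lemma sgn_poly_eventually_at_top:
  fixes p :: "real poly"
  shows "eventually (\<lambda>t. sgn (poly p t) = sgn (lead_coeff p)) at_top"
proof (cases "p = 0")
  case False
  have "\<exists>n. \<forall>x\<ge>n. sgn (poly p x) = sgn (lead_coeff p)"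
  proof (cases "lead_coeff p > 0")
    case True
    then obtain n where "\<forall>x\<ge>n. lead_coeff p \<le> poly p x" using poly_pinfty_gt_lc by blast
    then show ?thesis using True by (metis order_less_le_trans sgn_pos)
  next
    case F: False
    then have "lead_coeff (-p) > 0" using False by (metis leading_coeff_0_iff lead_coeff_minus linorder_neqE neg_0_less_iff_less)
    then obtain n where "\<forall>x\<ge>n. lead_coeff (-p) \<le> poly (-p) x" using poly_pinfty_gt_lc by blast
    then have "\<forall>x\<ge>n. poly p x < 0" using \<open>lead_coeff (-p) > 0\<close> by fastforce
    then show ?thesis using F False by (metis leading_coeff_0_iff linorder_neqE sgn_neg)
  qed
  then show ?thesis by (simp add: eventually_at_top_linorder)
qed simp

lemma sgn_poly_eventually_at_bot:
  fixes p :: "real poly"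
  shows "eventually (\<lambda>t. sgn (poly p t) = (-1) ^ degree p * sgn (lead_coeff p)) at_bot"
proof -
  define q where "q = pcompose p [:0, -1:]"
  have "eventually (\<lambda>t. sgn (poly q t) = sgn (lead_coeff q)) at_top"
    by (rule sgn_poly_eventually_at_top)
  moreover have "lead_coeff q = (-1) ^ degree p * lead_coeff p"
    unfolding q_def by (subst lead_coeff_comp) auto
  ultimately have "eventually (\<lambda>t. sgn (poly p (- t)) = (-1) ^ degree p * sgn (lead_coeff p)) at_top"
    by (simp add: q_def poly_pcompose sgn_mult power_sgn)
  then show ?thesis
    by (simp add: at_bot_mirror eventually_filtermap)
qed

text \<open>
  One step of the Cohen-Hoermander procedure. The set \<open>Z\<close> contains the critical points of \<open>p\<close>, so
  \<open>p\<close> is strictly monotone on each gap of \<open>Z\<close>; the same holds for \<open>p'\<close> and the gaps of \<open>h ` Z\<close>, with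
  the same direction. The signs at the ends of a gap (including the infinite ends) agree by
  assumption, and for a strictly monotone function they decide whether the gap contains a root.
  Hence the roots of \<open>p\<close> and \<open>p'\<close> correspond, and \<open>h\<close> can be corrected inside the gaps so that it
  also maps roots to roots.
\<close>

locale sign_transfer =
  fixes p p' :: "real poly" and h :: "real \<Rightarrow> real" and Z :: "real set"
  assumes mono: "strict_mono h" and surj: "surj h" and fin: "finite Z"
    and deriv: "\<And>t. t \<notin> Z \<Longrightarrow> poly (pderiv p) t \<noteq> 0 \<and>
                sgn (poly (pderiv p) t) = sgn (poly (pderiv p') (h t))"
    and agree: "\<And>t. t \<in> Z \<Longrightarrow> sgn (poly p t) = sgn (poly p' (h t))"
    and top: "\<exists>\<sigma>. (\<forall>\<^sub>F t in at_top. sgn (poly p t) = \<sigma>) \<and> (\<forall>\<^sub>F t in at_top. sgn (poly p' t) = \<sigma>)"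
    and bot: "\<exists>\<sigma>. (\<forall>\<^sub>F t in at_bot. sgn (poly p t) = \<sigma>) \<and> (\<forall>\<^sub>F t in at_bot. sgn (poly p' t) = \<sigma>)"
begin

text \<open>
  The hypotheses are symmetric, which saves the converse directions below.
\<close>

lemma inverse: "sign_transfer p' p (inv_into UNIV h) (h ` Z)"
proof
  have inj: "inj h" using mono by (rule strict_mono_imp_inj_on)
  have hi: "h (inv_into UNIV h t) = t" for t by (simp add: surj surj_f_inv_f)
  have ih: "inv_into UNIV h (h t) = t" for t by (simp add: inj)
  show "strict_mono (inv_into UNIV h)"
    by (rule strict_monoI) (metis hi mono strict_mono_less)
  show "Fun.surj (inv_into UNIV h)" using inj by (simp add: inj_imp_surj_inv)
  show "finite (h ` Z)" using fin by simp
  show "poly (pderiv p') t \<noteq> 0 \<and> sgn (poly (pderiv p') t) = sgn (poly (pderiv p) (inv_into UNIV h t))"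
    if "t \<notin> h ` Z" for t
  proof -
    have "inv_into UNIV h t \<notin> Z" using that hi by (metis image_eqI)
    from deriv[OF this] show ?thesis by (metis hi sgn_0_0)
  qed
  show "sgn (poly p' t) = sgn (poly p (inv_into UNIV h t))" if "t \<in> h ` Z" for t
    using that agree ih by auto
qed (use top bot in blast)+

text \<open>
  If \<open>p\<close> has a constant sign from \<open>w\<close> up to and including the next point of \<open>Z\<close> (or infinity),
  then \<open>p'\<close> takes that sign at the corresponding end.
\<close>

lemma sgn_right:
  assumes "\<And>t. w < t \<Longrightarrow> \<forall>z\<in>Z. \<not> (w < z \<and> z < t) \<Longrightarrow> sgn (poly p t) = \<sigma>"
  shows "\<exists>t. w < t \<and> (\<forall>z\<in>Z. \<not> (w < z \<and> z < t)) \<and> sgn (poly p' (h t)) = \<sigma>"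
proof (cases "{z\<in>Z. w < z} = {}")
  case True
  have all: "sgn (poly p t) = \<sigma>" if "w < t" for t using assms[OF that] True by auto
  obtain \<tau> where \<tau>: "\<forall>\<^sub>F t in at_top. sgn (poly p t) = \<tau>" "\<forall>\<^sub>F t in at_top. sgn (poly p' t) = \<tau>"
    using top by blast
  have "\<forall>\<^sub>F t in at_top. sgn (poly p t) = \<tau> \<and> w < t"
    using \<tau>(1) eventually_gt_at_top by (rule eventually_conj)
  then have "\<tau> = \<sigma>" using all using eventually_happens'[OF trivial_limit_at_top_linorder] by blast
  moreover have "\<forall>\<^sub>F t in at_top. sgn (poly p' t) = \<tau> \<and> h w < t"
    using \<tau>(2) eventually_gt_at_top by (rule eventually_conj)
  then obtain t where "sgn (poly p' t) = \<tau>" "h w < t"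
    using eventually_happens'[OF trivial_limit_at_top_linorder] by blast
  ultimately have "sgn (poly p' (h (inv_into UNIV h t))) = \<sigma>" "w < inv_into UNIV h t"
    using strict_mono_less[OF mono, of w "inv_into UNIV h t"] by (simp_all add: surj surj_f_inv_f)
  then show ?thesis using True by auto
next
  case False
  define z where "z = Min {z\<in>Z. w < z}"
  have z: "z \<in> Z" "w < z" using Min_in[OF _ False] fin by (auto simp: z_def)
  have no: "\<forall>y\<in>Z. \<not> (w < y \<and> y < z)"
    using Min_le[of "{z\<in>Z. w < z}"] fin unfolding z_def by fastforce
  have "sgn (poly p z) = \<sigma>" using assms[OF z(2) no] .
  then show ?thesis using agree[OF z(1)] z no by auto
qed

lemma sgn_left:
  assumes "\<And>t. t < w \<Longrightarrow> \<forall>z\<in>Z. \<not> (t < z \<and> z < w) \<Longrightarrow> sgn (poly p t) = \<sigma>"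
  shows "\<exists>t. t < w \<and> (\<forall>z\<in>Z. \<not> (t < z \<and> z < w)) \<and> sgn (poly p' (h t)) = \<sigma>"
proof (cases "{z\<in>Z. z < w} = {}")
  case True
  have all: "sgn (poly p t) = \<sigma>" if "t < w" for t using assms[OF that] True by auto
  obtain \<tau> where \<tau>: "\<forall>\<^sub>F t in at_bot. sgn (poly p t) = \<tau>" "\<forall>\<^sub>F t in at_bot. sgn (poly p' t) = \<tau>"
    using bot by blast
  have "\<forall>\<^sub>F t in at_bot. sgn (poly p t) = \<tau> \<and> t < w"
    using \<tau>(1) eventually_gt_at_bot by (rule eventually_conj)
  then have "\<tau> = \<sigma>" using all using eventually_happens'[OF trivial_limit_at_bot_linorder] by blast
  moreover have "\<forall>\<^sub>F t in at_bot. sgn (poly p' t) = \<tau> \<and> t < h w"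
    using \<tau>(2) eventually_gt_at_bot by (rule eventually_conj)
  then obtain t where "sgn (poly p' t) = \<tau>" "t < h w"
    using eventually_happens'[OF trivial_limit_at_bot_linorder] by blast
  ultimately have "sgn (poly p' (h (inv_into UNIV h t))) = \<sigma>" "inv_into UNIV h t < w"
    using strict_mono_less[OF mono, of "inv_into UNIV h t" w] by (simp_all add: surj surj_f_inv_f)
  then show ?thesis using True by auto
next
  case False
  define z where "z = Max {z\<in>Z. z < w}"
  have z: "z \<in> Z" "z < w" using Max_in[OF _ False] fin by (auto simp: z_def)
  have no: "\<forall>y\<in>Z. \<not> (z < y \<and> y < w)"
    using Max_ge[of "{z\<in>Z. z < w}"] fin unfolding z_def by fastforce
  have "sgn (poly p z) = \<sigma>" using assms[OF z(2) no] .
  then show ?thesis using agree[OF z(1)] z no by auto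
qed

lemma increment_sgn_right:
  assumes w: "w \<notin> Z" and t: "w < t" "\<forall>z\<in>Z. \<not> (w < z \<and> z < t)"
  shows "sgn (poly p t - poly p w) = sgn (poly (pderiv p) w)"
proof -
  obtain \<xi> where \<xi>: "w < \<xi>" "\<xi> < t" "poly p t - poly p w = (t - w) * poly (pderiv p) \<xi>"
    using poly_MVT[OF t(1)] by blast
  have "same_gap Z w \<xi>" using w t \<xi> by (intro same_gap_betweenI) (auto simp: less_le)
  then have "sgn (poly (pderiv p) w) = sgn (poly (pderiv p) \<xi>)"
    using sgn_poly_same_gap[of "pderiv p" Z] deriv by blast
  then show ?thesis using \<xi> t by (simp add: sgn_mult)
qed

lemma increment_sgn_left:
  assumes w: "w \<notin> Z" and t: "t < w" "\<forall>z\<in>Z. \<not> (t < z \<and> z < w)"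
  shows "sgn (poly p t - poly p w) = - sgn (poly (pderiv p) w)"
proof -
  obtain \<xi> where \<xi>: "t < \<xi>" "\<xi> < w" "poly p w - poly p t = (w - t) * poly (pderiv p) \<xi>"
    using poly_MVT[OF t(1)] by blast
  have "same_gap Z \<xi> w" using w t \<xi> by (intro same_gap_betweenI) (auto simp: less_le)
  then have "sgn (poly (pderiv p) w) = sgn (poly (pderiv p) \<xi>)"
    using sgn_poly_same_gap[of "pderiv p" Z] deriv by (metis same_gap_sym)
  moreover have "sgn (poly p w - poly p t) = sgn (poly (pderiv p) \<xi>)"
    unfolding \<xi>(3) using t by (simp add: sgn_mult)
  ultimately show ?thesis by (metis minus_diff_eq sgn_minus)
qed

text \<open>
  The derivative of \<open>p\<close> at \<open>r\<close> makes the signs of \<open>p\<close> at the two ends of the gap opposite. They are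
  also the signs of \<open>p'\<close> there, so \<open>p'\<close> has a root in between.
\<close>

lemma root_exists:
  assumes r: "r \<notin> Z" "poly p r = 0"
  shows "\<exists>u. same_gap Z r u \<and> poly p' (h u) = 0"
proof -
  define \<delta> where "\<delta> = sgn (poly (pderiv p) r)"
  have \<delta>: "\<delta> \<noteq> 0" using deriv[OF r(1)] unfolding \<delta>_def sgn_0_0 by blast
  obtain t1 where t1: "r < t1" "\<forall>z\<in>Z. \<not> (r < z \<and> z < t1)" "sgn (poly p' (h t1)) = \<delta>"
    using sgn_right[of r \<delta>] increment_sgn_right[OF r(1)] r(2) unfolding \<delta>_def by auto
  obtain t0 where t0: "t0 < r" "\<forall>z\<in>Z. \<not> (t0 < z \<and> z < r)" "sgn (poly p' (h t0)) = - \<delta>"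
    using sgn_left[of r "- \<delta>"] increment_sgn_left[OF r(1)] r(2) unfolding \<delta>_def by auto
  have "h t0 < h t1" using t0 t1 mono by (simp add: strict_mono_less)
  then obtain y where y: "h t0 \<le> y" "y \<le> h t1" "poly p' y = 0"
    using poly_root_between_opposite_signs[of "h t0" "h t1" p'] t0 t1 \<delta> by auto
  obtain u where u: "y = h u" using surj by (metis surjD)
  have "u \<noteq> t0" "u \<noteq> t1" using y u t0 t1 \<delta> by auto
  then have u': "t0 < u" "u < t1" using y u mono by (auto simp: strict_mono_less_eq less_le)
  have "same_gap Z r u"
    unfolding same_gap_def using u' t0 t1 r(1) by (metis linorder_neqE less_trans)
  then show ?thesis using y u by auto
qed

lemma root_exists_reverse:
  assumes u: "u \<notin> Z" "poly p' (h u) = 0"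
  shows "\<exists>r. same_gap Z u r \<and> poly p r = 0"
proof -
  interpret I: sign_transfer p' p "inv_into UNIV h" "h ` Z" by (rule inverse)
  have inj: "inj h" using mono by (rule strict_mono_imp_inj_on)
  have "h u \<notin> h ` Z" using u inj by (simp add: inj_image_mem_iff)
  then obtain v where v: "same_gap (h ` Z) (h u) v" "poly p (inv_into UNIV h v) = 0"
    using I.root_exists u by blast
  have "h (inv_into UNIV h v) = v" by (simp add: surj surj_f_inv_f)
  then have "same_gap Z u (inv_into UNIV h v)"
    using v(1) mono unfolding same_gap_def by (metis image_eqI strict_mono_less)
  then show ?thesis using v by blast
qed

text \<open>
  Rolle: between two roots there would be a zero of the derivative, which lies in \<open>Z\<close>.
\<close>

lemma roots_separated:
  assumes "same_gap Z r s" "r \<notin> Z" "poly p r = 0" "poly p s = 0"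
  shows "r = s"
proof -
  have *: False if "same_gap Z r s" "r \<notin> Z" "poly p r = 0" "poly p s = 0" "r < s" for r s
  proof -
    have "\<forall>z\<in>Z. \<not> (r < z \<and> z < s)" using that unfolding same_gap_def by auto
    from increment_sgn_right[OF that(2,5) this] deriv[OF that(2)] that(3,4) show False
      by (simp add: sgn_0_0)
  qed
  have "s \<notin> Z" using same_gap_mem2[OF assms(1)] assms(2) by blast
  then have "\<not> s < r" using *[of s r] same_gap_sym[OF assms(1)] assms by blast
  then show ?thesis using *[of r s] assms by force
qed

text \<open>
  Towards the end of the gap where \<open>p\<close> moves away from zero it keeps its sign, so \<open>p'\<close> has the sign
  of \<open>p\<close> at that end. A different sign of \<open>p'\<close> inside the gap would force a root of \<open>p'\<close>, and so
  one of \<open>p\<close>.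
\<close>

lemma sgn_eq_of_rootless_gap:
  assumes w: "w \<notin> Z" and no: "\<And>r. same_gap Z w r \<Longrightarrow> poly p r \<noteq> 0"
  shows "sgn (poly p w) = sgn (poly p' (h w))"
proof (rule ccontr)
  assume ne: "sgn (poly p w) \<noteq> sgn (poly p' (h w))"
  have noroot: False if "poly p' (h u) = 0" "same_gap Z w u" for u
    using root_exists_reverse[of u] that no w same_gap_mem2 same_gap_trans by metis
  define \<delta> where "\<delta> = sgn (poly (pderiv p) w)"
  have \<delta>: "\<delta> \<noteq> 0" using deriv[OF w] unfolding \<delta>_def sgn_0_0 by blast
  have pw: "poly p w \<noteq> 0" using no by simp
  have d: "\<delta> = 1 \<or> \<delta> = -1" using \<delta> unfolding \<delta>_def by (metis sgn_0_0 sgn_if)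
  show False
  proof (cases "sgn (poly p w) = \<delta>")
    case True
    have "sgn (poly p t) = \<delta>" if "w < t" "\<forall>z\<in>Z. \<not> (w < z \<and> z < t)" for t
      using increment_sgn_right[OF w that] True d unfolding \<delta>_def[symmetric]
      by (auto simp: sgn_if split: if_splits)
    then obtain t where t: "w < t" "\<forall>z\<in>Z. \<not> (w < z \<and> z < t)" "sgn (poly p' (h t)) = \<delta>"
      using sgn_right by blast
    have "h w < h t" using t mono by (simp add: strict_mono_less)
    then obtain y where y: "h w \<le> y" "y \<le> h t" "poly p' y = 0"
      using poly_root_between_opposite_signs[of "h w" "h t" p'] t ne True by auto
    obtain u where u: "y = h u" using surj by (metis surjD)
    have "u \<noteq> t" using y u t \<delta> by auto
    then have "w \<le> u" "u < t" using y u mono by (auto simp: strict_mono_less_eq less_le)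
    then have "same_gap Z w u" using w t by (intro same_gap_betweenI) (auto simp: less_le)
    then show False using noroot y u by blast
  next
    case False
    then have m: "sgn (poly p w) = - \<delta>" using pw d by (auto simp: sgn_if split: if_splits)
    have "sgn (poly p t) = - \<delta>" if "t < w" "\<forall>z\<in>Z. \<not> (t < z \<and> z < w)" for t
      using increment_sgn_left[OF w that] m d unfolding \<delta>_def[symmetric]
      by (auto simp: sgn_if split: if_splits)
    then obtain t where t: "t < w" "\<forall>z\<in>Z. \<not> (t < z \<and> z < w)" "sgn (poly p' (h t)) = - \<delta>"
      using sgn_left by blast
    have "h t < h w" using t mono by (simp add: strict_mono_less)
    then obtain y where y: "h t \<le> y" "y \<le> h w" "poly p' y = 0"
      using poly_root_between_opposite_signs[of "h t" "h w" p'] t ne m by auto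
    obtain u where u: "y = h u" using surj by (metis surjD)
    have "u \<noteq> t" using y u t \<delta> by auto
    then have "u \<le> w" "t < u" using y u mono by (auto simp: strict_mono_less_eq less_le)
    then have "same_gap Z u w" using w t by (intro same_gap_betweenI) (auto simp: less_le)
    then show False using noroot y u same_gap_sym by blast
  qed
qed

lemma sgn_eq_of_root:
  assumes r: "r \<notin> Z" "poly p r = 0" and u: "same_gap Z r u" "poly p' (h u) = 0"
    and t: "same_gap Z r t" and s: "same_gap Z r s" and ord: "(r < t \<longleftrightarrow> u < s) \<and> (t < r \<longleftrightarrow> s < u)"
  shows "sgn (poly p t) = sgn (poly p' (h s))"
proof -
  interpret I: sign_transfer p' p "inv_into UNIV h" "h ` Z" by (rule inverse)
  have inj: "inj h" using mono by (rule strict_mono_imp_inj_on)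
  have uZ: "u \<notin> Z" using r u same_gap_mem2 by blast
  have hu: "h u \<notin> h ` Z" using uZ inj by (simp add: inj_image_mem_iff)
  have d: "sgn (poly (pderiv p) r) = sgn (poly (pderiv p') (h u))"
    using deriv[OF uZ] sgn_poly_same_gap[of "pderiv p" Z r u] deriv u by metis
  have us: "same_gap Z u s" using s u same_gap_sym same_gap_trans by blast
  have nb: "\<forall>z\<in>Z. \<not> (x < z \<and> z < y)" if "same_gap Z x y" for x y
    using that unfolding same_gap_def by auto
  have nb': "\<forall>z\<in>h ` Z. \<not> (h x < z \<and> z < h y)" if "same_gap Z x y" for x y
    using nb[OF that] mono by (auto simp: strict_mono_less)
  consider "t = r" | "r < t" | "t < r" by linarith
  then show ?thesis
  proof cases
    case 1 then have "s = u" using ord by auto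
    then show ?thesis using 1 r u by simp
  next
    case 2
    then have "h u < h s" using ord mono by (simp add: strict_mono_less)
    then show ?thesis
      using increment_sgn_right[OF r(1) 2 nb[OF t]] I.increment_sgn_right[OF hu _ nb'[OF us]] d r u
      by simp
  next
    case 3
    then have "h s < h u" using ord mono by (simp add: strict_mono_less)
    then show ?thesis
      using increment_sgn_left[OF r(1) 3 nb[OF same_gap_sym[OF t]]]
        I.increment_sgn_left[OF hu _ nb'[OF same_gap_sym[OF us]]] d r u
      by simp
  qed
qed

text \<open>
  Composing \<open>h\<close> with a reparametrization of the line that fixes \<open>Z\<close> and moves each remaining root of
  \<open>p\<close> to the preimage of the corresponding root of \<open>p'\<close> makes the signs of \<open>p\<close> and \<open>p'\<close> agree
  everywhere. Since gaps are preserved, signs that already agreed are not disturbed.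
\<close>

theorem transfer_exists:
  assumes "p \<noteq> 0"
  shows "\<exists>k. strict_mono k \<and> Fun.surj k \<and> (\<forall>t. same_gap Z t (k t)) \<and>
             (\<forall>t. sgn (poly p t) = sgn (poly p' (h (k t))))"
proof -
  define R where "R = {r. poly p r = 0} - Z"
  have finR: "finite R" unfolding R_def using poly_roots_finite[OF assms] by auto
  have "\<forall>r\<in>R. \<exists>u. same_gap Z r u \<and> poly p' (h u) = 0" using root_exists by (auto simp: R_def)
  then obtain u where u: "\<And>r. r \<in> R \<Longrightarrow> same_gap Z r (u r) \<and> poly p' (h (u r)) = 0" by metis
  \<comment> \<open>The reparametrization is prescribed on the finite set of all roots and interpolated.\<close>
  define f where "f t = (if t \<in> Z then t else u t)" for t
  have fR: "f r = u r" if "r \<in> R" for r using that by (auto simp: f_def R_def)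
  have gf: "same_gap Z t (f t)" if "t \<in> Z \<union> R" for t using that u fR by (auto simp: f_def)
  have "strict_mono_on (Z \<union> R) f"
  proof (rule strict_mono_onI)
    fix s t assume st: "s \<in> Z \<union> R" "t \<in> Z \<union> R" "s < t"
    have g: "same_gap Z s (f s)" "same_gap Z t (f t)" using gf st by auto
    \<comment> \<open>Two different points of the set are always separated by \<open>Z\<close>, and \<open>f\<close> respects the gaps.\<close>
    have "\<exists>z\<in>Z. s \<le> z \<and> z \<le> t"
    proof (rule ccontr)
      assume no: "\<not> ?thesis"
      then have "s \<in> R" "t \<in> R" using st by auto
      moreover have "same_gap Z s t" using no st by (intro same_gap_betweenI) auto
      ultimately have "s = t" using roots_separated by (auto simp: R_def)
      then show False using st by simp
    qed
    then obtain z where z: "z \<in> Z" "s \<le> z" "z \<le> t" by blast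
    have 1: "f s \<le> z" "s < z \<Longrightarrow> f s < z" using g(1) z unfolding same_gap_def by (metis linorder_not_less)+
    have 2: "z \<le> f t" "z < t \<Longrightarrow> z < f t" using g(2) z unfolding same_gap_def by (metis linorder_not_less)+
    show "f s < f t" using 1 2 z st(3) by linarith
  qed
  then obtain k where k: "strict_mono k" "Fun.surj k" "\<forall>s\<in>Z \<union> R. k s = f s"
    using strict_mono_interpolation[of "Z \<union> R" f] fin finR by blast
  have kz: "k z = z" if "z \<in> Z" for z using k(3) that by (simp add: f_def)
  have gap: "same_gap Z t (k t)" for t
    unfolding same_gap_def using kz k(1) by (metis strict_mono_less)
  have "sgn (poly p t) = sgn (poly p' (h (k t)))" for t
  proof (cases "t \<in> Z")
    case True then show ?thesis using agree kz by simp
  next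
    case tZ: False
    show ?thesis
    proof (cases "\<exists>r. same_gap Z t r \<and> poly p r = 0")
      case True
      then obtain r where r: "same_gap Z t r" "poly p r = 0" by blast
      have rR: "r \<in> R" using r tZ same_gap_mem2 by (auto simp: R_def)
      have kr: "k r = u r" using k(3) rR fR by auto
      show ?thesis
      proof (rule sgn_eq_of_root)
        show "r \<notin> Z" "poly p r = 0" using rR by (auto simp: R_def)
        show "same_gap Z r (k r)" by (rule gap)
        show "poly p' (h (k r)) = 0" using u[OF rR] kr by simp
        show "same_gap Z r t" using r same_gap_sym by blast
        then show "same_gap Z r (k t)" using gap same_gap_trans by blast
        show "(r < t \<longleftrightarrow> k r < k t) \<and> (t < r \<longleftrightarrow> k t < k r)" using k(1) by (simp add: strict_mono_less)
      qed
    next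
      case False
      have "sgn (poly p t) = sgn (poly p (k t))"
      proof -
        have "sgn (poly p a) = sgn (poly p b)" if "a < b" "same_gap Z t a" "same_gap Z t b" for a b
        proof (rule ccontr)
          assume "sgn (poly p a) \<noteq> sgn (poly p b)"
          then obtain v where v: "a \<le> v" "v \<le> b" "poly p v = 0"
            using poly_root_between_opposite_signs[OF \<open>a < b\<close>] by blast
          have "same_gap Z t v"
            using that v same_gap_between same_gap_sym same_gap_trans by meson
          then show False using False v by blast
        qed
        then show ?thesis
          using gap[of t] same_gap_refl by (metis linorder_less_linear)
      qed
      also have "\<dots> = sgn (poly p' (h (k t)))"
      proof (rule sgn_eq_of_rootless_gap)
        show "k t \<notin> Z" using tZ gap same_gap_mem2 by blast
        show "poly p r \<noteq> 0" if "same_gap Z (k t) r" for r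
          using False that gap same_gap_trans by blast
      qed
      finally show ?thesis .
    qed
  qed
  then show ?thesis using k gap by blast
qed

end

section \<open>The Tarski-Seidenberg theorem\<close>


text \<open>
  Semialgebraic sets relative to an arbitrary set \<open>A\<close> of functions. Keeping \<open>A\<close> abstract allows the
  same elimination step to be used after each added variable.
\<close>

inductive semialg :: "('x \<Rightarrow> real) set \<Rightarrow> 'x set \<Rightarrow> 'x set \<Rightarrow> bool" for A X where
  pos: "f \<in> A \<Longrightarrow> semialg A X {x \<in> X. f x > 0}"
| union: "semialg A X S \<Longrightarrow> semialg A X T \<Longrightarrow> semialg A X (S \<union> T)"
| inter: "semialg A X S \<Longrightarrow> semialg A X T \<Longrightarrow> semialg A X (S \<inter> T)"
| compl: "semialg A X S \<Longrightarrow> semialg A X (X - S)"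

lemma semialg_subset: "semialg A X S \<Longrightarrow> S \<subseteq> X"
  by (induction rule: semialg.induct) auto

text \<open>
  Polynomials in one variable whose coefficients are functions in \<open>A\<close> of a parameter. The number
  \<open>d\<close> is a formal degree: the coefficient of order \<open>d\<close> may vanish for some parameters.
\<close>

definition par_poly :: "('x \<Rightarrow> real) set \<Rightarrow> nat \<Rightarrow> ('x \<Rightarrow> real poly) \<Rightarrow> bool" where
  "par_poly A d p \<longleftrightarrow> (\<forall>i. (\<lambda>x. coeff (p x) i) \<in> A) \<and> (\<forall>x. degree (p x) \<le> d)"

text \<open>
  Instead of tables of signs, the line for the parameter \<open>x\<close> is compared with that for \<open>y\<close> by an
  increasing bijection that preserves the signs of all polynomials of the family. No enumeration
  of roots is needed in this form.
\<close>

definition same_signs :: "('x \<Rightarrow> real poly) set \<Rightarrow> 'x \<Rightarrow> 'x \<Rightarrow> bool" where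
  "same_signs F x y \<longleftrightarrow> (\<exists>h. strict_mono h \<and> surj h \<and>
     (\<forall>p\<in>F. \<forall>t. sgn (poly (p x) t) = sgn (poly (p y) (h t))))"

definition stratified :: "('x \<Rightarrow> real) set \<Rightarrow> 'x set \<Rightarrow> ('x \<Rightarrow> real poly) set \<Rightarrow> 'x set \<Rightarrow> bool" where
  "stratified A X F Y \<longleftrightarrow> (\<exists>P. finite P \<and> Y = \<Union>P \<and>
     (\<forall>S\<in>P. semialg A X S \<and> (\<forall>x\<in>S. \<forall>y\<in>S. same_signs F x y)))"

lemma same_signs_mono: "same_signs F x y \<Longrightarrow> G \<subseteq> F \<Longrightarrow> same_signs G x y"
  unfolding same_signs_def by blast

locale function_algebra =
  fixes A :: "('x \<Rightarrow> real) set"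
  assumes const: "(\<lambda>x. c) \<in> A"
    and add: "f \<in> A \<Longrightarrow> g \<in> A \<Longrightarrow> (\<lambda>x. f x + g x) \<in> A"
    and mult: "f \<in> A \<Longrightarrow> g \<in> A \<Longrightarrow> (\<lambda>x. f x * g x) \<in> A"
begin

lemma uminus: "f \<in> A \<Longrightarrow> (\<lambda>x. - f x) \<in> A"
  using mult[OF const[of "-1"], of f] by simp

lemma diff: "f \<in> A \<Longrightarrow> g \<in> A \<Longrightarrow> (\<lambda>x. f x - g x) \<in> A"
  using add[OF _ uminus, of f g] by simp

lemma semialg_whole: "semialg A X X"
  using semialg.pos[OF const[of 1], of X] by simp

lemma semialg_empty: "semialg A X {}"
  using semialg.compl[OF semialg_whole[of X]] by simp

lemma semialg_neg: "f \<in> A \<Longrightarrow> semialg A X {x \<in> X. f x < 0}"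
  using semialg.pos[OF uminus, of f X] by simp

lemma semialg_zero: assumes "f \<in> A" shows "semialg A X {x \<in> X. f x = 0}"
proof -
  have "semialg A X (X - ({x \<in> X. f x > 0} \<union> {x \<in> X. f x < 0}))"
    by (intro semialg.compl semialg.union semialg.pos semialg_neg assms)
  also have "X - ({x \<in> X. f x > 0} \<union> {x \<in> X. f x < 0}) = {x \<in> X. f x = 0}" by auto
  finally show ?thesis .
qed

lemma semialg_nonzero: assumes "f \<in> A" shows "semialg A X {x \<in> X. f x \<noteq> 0}"
proof -
  have "semialg A X (X - {x \<in> X. f x = 0})" by (intro semialg.compl semialg_zero assms)
  also have "X - {x \<in> X. f x = 0} = {x \<in> X. f x \<noteq> 0}" by auto
  finally show ?thesis .
qed

lemma semialg_Union: "finite P \<Longrightarrow> (\<And>S. S \<in> P \<Longrightarrow> semialg A X S) \<Longrightarrow> semialg A X (\<Union>P)"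
  by (induction P rule: finite_induct) (auto intro: semialg_empty semialg.union)

lemma semialg_finite_conj:
  "finite I \<Longrightarrow> (\<And>i. i \<in> I \<Longrightarrow> semialg A X {x \<in> X. Q i x}) \<Longrightarrow> semialg A X {x \<in> X. \<forall>i\<in>I. Q i x}"
proof (induction I rule: finite_induct)
  case empty then show ?case using semialg_whole by simp
next
  case (insert i I)
  have "semialg A X ({x \<in> X. Q i x} \<inter> {x \<in> X. \<forall>i\<in>I. Q i x})"
    using insert by (intro semialg.inter) auto
  also have "{x \<in> X. Q i x} \<inter> {x \<in> X. \<forall>i\<in>I. Q i x} = {x \<in> X. \<forall>i\<in>insert i I. Q i x}" by auto
  finally show ?case .
qed

lemma stratified_restrict:
  assumes "stratified A X F Y" "semialg A X T"
  shows "stratified A X F (Y \<inter> T)"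
proof -
  obtain P where P: "finite P" "Y = \<Union>P"
    "\<forall>S\<in>P. semialg A X S \<and> (\<forall>x\<in>S. \<forall>y\<in>S. same_signs F x y)"
    using assms(1) unfolding stratified_def by blast
  show ?thesis unfolding stratified_def
    by (rule exI[of _ "(\<lambda>S. S \<inter> T) ` P"]) (use P assms(2) in \<open>auto intro: semialg.inter\<close>)
qed

lemma stratified_Union:
  assumes "finite K" "\<And>Y. Y \<in> K \<Longrightarrow> stratified A X F Y"
  shows "stratified A X F (\<Union>K)"
proof -
  have "\<forall>Y\<in>K. \<exists>P. finite P \<and> Y = \<Union>P \<and>
     (\<forall>S\<in>P. semialg A X S \<and> (\<forall>x\<in>S. \<forall>y\<in>S. same_signs F x y))"
    using assms(2) unfolding stratified_def by blast
  then obtain P where P: "\<forall>Y\<in>K. finite (P Y) \<and> Y = \<Union>(P Y) \<and>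
     (\<forall>S\<in>P Y. semialg A X S \<and> (\<forall>x\<in>S. \<forall>y\<in>S. same_signs F x y))"
    by metis
  have "\<Union>K = (\<Union>Y\<in>K. \<Union>(P Y))" using P by (intro arg_cong[where f = Union] image_cong[of K K "\<lambda>Y. Y", simplified]) blast
  then have "\<Union>K = \<Union>(\<Union>(P ` K))" by auto
  then show ?thesis unfolding stratified_def
    by (intro exI[of _ "\<Union>(P ` K)"]) (use P assms(1) in auto)
qed

lemma stratified_map:
  assumes "stratified A X F Y"
    and "\<And>x y. x \<in> Y \<Longrightarrow> y \<in> Y \<Longrightarrow> same_signs F x y \<Longrightarrow> same_signs G x y"
  shows "stratified A X G Y"
proof -
  obtain P where P: "finite P" "Y = \<Union>P"
    "\<forall>S\<in>P. semialg A X S \<and> (\<forall>x\<in>S. \<forall>y\<in>S. same_signs F x y)"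
    using assms(1) unfolding stratified_def by blast
  show ?thesis unfolding stratified_def
    by (rule exI[of _ P]) (use P assms(2) in blast)
qed

text \<open>
  Polynomials of formal degree zero are governed by the signs of their coefficients.
\<close>

lemma stratified_constants:
  assumes "finite F" "\<And>p. p \<in> F \<Longrightarrow> par_poly A 0 p" "semialg A X Y"
  shows "stratified A X F Y"
  using assms(1,2)
proof (induction F rule: finite_induct)
  case empty
  have "same_signs {} x y" for x y :: 'x
    unfolding same_signs_def by (intro exI[of _ "\<lambda>t. t"]) (auto simp: strict_mono_def)
  then show ?case unfolding stratified_def by (intro exI[of _ "{Y}"]) (auto simp: assms(3))
next
  case (insert p F)
  have s: "stratified A X F Y" using insert by blast
  have par: "par_poly A 0 p" using insert by blast
  define c where "c x = coeff (p x) 0" for x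
  have cA: "c \<in> A" using par unfolding par_poly_def c_def by blast
  have px: "poly (p x) t = c x" for x t
  proof -
    have "degree (p x) = 0" using par by (auto simp: par_poly_def)
    then obtain a where "p x = [:a:]" by (rule degree_eq_zeroE)
    then show ?thesis by (simp add: c_def)
  qed
  have sub: "Y \<subseteq> X" using semialg_subset assms(3) by blast
  define K where "K = {Y \<inter> {x\<in>X. c x > 0}, Y \<inter> {x\<in>X. c x < 0}, Y \<inter> {x\<in>X. c x = 0}}"
  have "stratified A X (insert p F) T" if "T \<in> K" for T
  proof (rule stratified_map[of X F])
    show "stratified A X F T"
      using that unfolding K_def
      by (auto intro!: stratified_restrict s semialg.pos semialg_neg semialg_zero cA)
    fix x y assume xy: "x \<in> T" "y \<in> T" "same_signs F x y"
    have "sgn (c x) = sgn (c y)" using xy that by (auto simp: K_def)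
    then show "same_signs (insert p F) x y" using xy(3) unfolding same_signs_def by (auto simp: px)
  qed
  then have "stratified A X (insert p F) (\<Union>K)" by (intro stratified_Union) (auto simp: K_def)
  moreover have "\<Union>K = Y" using sub by (auto simp: K_def)
  ultimately show ?case by simp
qed

text \<open>
  The first step of the pseudo-division of \<open>p\<close> by \<open>q\<close>. Its multiplier is the square of the leading
  coefficient of \<open>q\<close>, so at a root of \<open>q\<close> the result has the sign of \<open>p\<close>. A single step is enough
  because only the degree of \<open>p\<close> has to drop.
\<close>

definition cancel_lead :: "nat \<Rightarrow> ('x \<Rightarrow> real poly) \<Rightarrow> nat \<Rightarrow> ('x \<Rightarrow> real poly) \<Rightarrow> 'x \<Rightarrow> real poly" where
  "cancel_lead d p e q x = smult ((coeff (q x) e)^2) (p x)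
     - smult (coeff (q x) e * coeff (p x) d) (monom 1 (d - e) * q x)"

lemma par_poly_cancel_lead:
  assumes "par_poly A d p" "par_poly A e q" "e \<le> d" "0 < d"
  shows "par_poly A (d - 1) (cancel_lead d p e q)"
  unfolding par_poly_def
proof (intro conjI allI)
  fix i
  have p: "(\<lambda>x. coeff (p x) j) \<in> A" and q: "(\<lambda>x. coeff (q x) j) \<in> A" for j
    using assms by (auto simp: par_poly_def)
  show "(\<lambda>x. coeff (cancel_lead d p e q x) i) \<in> A"
    unfolding cancel_lead_def
    by (cases "d - e \<le> i")
       (simp_all add: coeff_monom_mult power2_eq_square, intro diff mult p q const, intro mult p q)
next
  fix x
  have p: "coeff (p x) j = 0" if "j > d" for j
    using assms(1) that by (intro coeff_eq_0) (auto simp: par_poly_def intro: le_less_trans)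
  have q: "coeff (q x) j = 0" if "j > e" for j
    using assms(2) that by (intro coeff_eq_0) (auto simp: par_poly_def intro: le_less_trans)
  show "degree (cancel_lead d p e q x) \<le> d - 1"
  proof (rule degree_le, intro allI impI)
    fix i assume "d - 1 < i"
    then consider "i = d" | "i > d" using assms by linarith
    then show "coeff (cancel_lead d p e q x) i = 0"
    proof cases
      case 1 then show ?thesis using assms
        by (simp add: cancel_lead_def coeff_monom_mult power2_eq_square)
    next
      case 2
      then have "i - (d - e) > e" using assms by linarith
      then show ?thesis using 2 p q by (simp add: cancel_lead_def coeff_monom_mult)
    qed
  qed
qed

lemma poly_cancel_lead_at_root:
  assumes "poly (q x) t = 0" "coeff (q x) e \<noteq> 0"
  shows "sgn (poly (cancel_lead d p e q x) t) = sgn (poly (p x) t)"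
proof -
  have "sgn ((coeff (q x) e)^2) = 1" using assms(2) by (intro sgn_pos) simp
  then show ?thesis using assms(1) by (simp add: cancel_lead_def sgn_mult)
qed

definition drop_lead :: "nat \<Rightarrow> ('x \<Rightarrow> real poly) \<Rightarrow> 'x \<Rightarrow> real poly" where
  "drop_lead d p x = p x - monom (coeff (p x) d) d"

lemma par_poly_drop_lead:
  assumes "par_poly A d p" "0 < d"
  shows "par_poly A (d - 1) (drop_lead d p)"
  unfolding par_poly_def
proof (intro conjI allI)
  fix i
  show "(\<lambda>x. coeff (drop_lead d p x) i) \<in> A"
    using assms const[of 0] by (cases "i = d") (auto simp: drop_lead_def par_poly_def)
next
  fix x
  have p: "coeff (p x) j = 0" if "j > d" for j
    using assms(1) that by (intro coeff_eq_0) (auto simp: par_poly_def intro: le_less_trans)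
  show "degree (drop_lead d p x) \<le> d - 1"
    by (rule degree_le) (use p assms in \<open>auto simp: drop_lead_def\<close>)
qed

lemma par_poly_pderiv:
  assumes "par_poly A d p" shows "par_poly A (d - 1) (\<lambda>x. pderiv (p x))"
proof -
  have "(\<lambda>x. of_nat (Suc i) * coeff (p x) (Suc i)) \<in> A" for i
    using assms by (intro mult const) (auto simp: par_poly_def)
  then show ?thesis using assms by (auto simp: par_poly_def coeff_pderiv degree_pderiv intro: diff_le_mono)
qed

lemma par_poly_lead: 
  assumes "par_poly A d p" shows "par_poly A 0 (\<lambda>x. [:coeff (p x) d:])"
  unfolding par_poly_def
proof (intro conjI allI)
  fix i show "(\<lambda>x. coeff [:coeff (p x) d:] i) \<in> A"
    using assms const[of 0] by (cases i) (auto simp: par_poly_def)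
qed simp

text \<open>
  If the signs of the other members, of the derivative and the leading coefficient of \<open>p\<close>, and of
  all \<open>p\<close> reduced modulo a nonconstant one of them agree, then so do the signs of \<open>p\<close>: the reductions
  give the signs of \<open>p\<close> at the roots of the others, the leading coefficient gives those at infinity,
  and the rest is the transfer of roots above.
\<close>

lemma same_signs_step:
  fixes M1 :: "(nat \<times> ('x \<Rightarrow> real poly)) multiset"
  assumes par: "\<And>e q. (e, q) \<in># M1 \<Longrightarrow> par_poly A e q" and parp: "par_poly A d p"
    and d: "0 < d"
    and lead: "\<And>e q z. (e, q) \<in># M1 \<Longrightarrow> 0 < e \<Longrightarrow> z \<in> {x, y} \<Longrightarrow> coeff (q z) e \<noteq> 0"
    and leadp: "\<And>z. z \<in> {x, y} \<Longrightarrow> coeff (p z) d \<noteq> 0"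
    and N: "N = filter_mset (\<lambda>(e, q). 0 < e) (add_mset (d - 1, \<lambda>x. pderiv (p x)) M1)"
    and ss: "same_signs (insert (\<lambda>x. pderiv (p x)) (insert (\<lambda>x. [:coeff (p x) d:])
               (snd ` set_mset M1 \<union> (\<lambda>(e, q). cancel_lead d p e q) ` set_mset N))) x y"
  shows "same_signs (insert p (snd ` set_mset M1)) x y"
proof -
  obtain h where h: "strict_mono h" "surj h"
    and h1: "\<And>t. sgn (poly (pderiv (p x)) t) = sgn (poly (pderiv (p y)) (h t))"
    and h2: "sgn (coeff (p x) d) = sgn (coeff (p y) d)"
    and h3: "\<And>e q t. (e, q) \<in># M1 \<Longrightarrow> sgn (poly (q x) t) = sgn (poly (q y) (h t))"
    and h4: "\<And>e q t. (e, q) \<in># N \<Longrightarrow> sgn (poly (cancel_lead d p e q x) t) = sgn (poly (cancel_lead d p e q y) (h t))"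
  proof -
    from ss obtain h where h: "strict_mono h" "surj h"
      and eq: "\<And>r t. r \<in> insert (\<lambda>x. pderiv (p x)) (insert (\<lambda>x. [:coeff (p x) d:])
               (snd ` set_mset M1 \<union> (\<lambda>(e, q). cancel_lead d p e q) ` set_mset N)) \<Longrightarrow>
               sgn (poly (r x) t) = sgn (poly (r y) (h t))"
      unfolding same_signs_def by meson
    show thesis
    proof (rule that[OF h])
      show "sgn (poly (pderiv (p x)) t) = sgn (poly (pderiv (p y)) (h t))" for t
        using eq[of "\<lambda>x. pderiv (p x)"] by simp
      show "sgn (coeff (p x) d) = sgn (coeff (p y) d)"
        using eq[of "\<lambda>x. [:coeff (p x) d:]"] by simp
      show "sgn (poly (q x) t) = sgn (poly (q y) (h t))" if "(e, q) \<in># M1" for e q t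
        by (rule eq) (use that in force)
      show "sgn (poly (cancel_lead d p e q x) t) = sgn (poly (cancel_lead d p e q y) (h t))"
        if "(e, q) \<in># N" for e q t
        by (rule eq) (use that in force)
    qed
  qed
  have leadN: "coeff (q z) e \<noteq> 0" if "(e, q) \<in># N" "z \<in> {x, y}" for e q z
  proof (cases "e = d - 1 \<and> q = (\<lambda>x. pderiv (p x))")
    case True
    then show ?thesis using leadp[OF that(2)] d by (simp add: coeff_pderiv)
  next
    case False
    then show ?thesis using that lead unfolding N by (auto split: if_splits)
  qed
  have hN: "sgn (poly (q x) t) = sgn (poly (q y) (h t))" if "(e, q) \<in># N" for e q t
    using that h1 h3 unfolding N by (auto split: if_splits)
  have degp: "degree (p z) = d" if "z \<in> {x, y}" for z
    using leadp[OF that] parp le_degree unfolding par_poly_def by (metis le_antisym)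
  \<comment> \<open>\<open>N\<close> contains the derivative unless it is constant, and then it has no zero at all.\<close>
  define Z where "Z = (\<Union>(e, q)\<in>set_mset N. {t. poly (q x) t = 0})"
  have finZ: "finite Z"
    unfolding Z_def
  proof (rule finite_UN_I[OF finite_set_mset], clarify)
    fix e q assume "(e, q) \<in># N"
    then have "q x \<noteq> 0" using leadN[of e q x] by auto
    then show "finite {t. poly (q x) t = 0}" by (rule poly_roots_finite)
  qed
  interpret T: sign_transfer "p x" "p y" h Z
  proof
    show "strict_mono h" "surj h" "finite Z" using h finZ by auto
    fix t
    show "poly (pderiv (p x)) t \<noteq> 0 \<and> sgn (poly (pderiv (p x)) t) = sgn (poly (pderiv (p y)) (h t))"
      if "t \<notin> Z"
    proof (cases "d = 1")
      case True
      then obtain a b where ab: "p x = [:a, b:]" "b \<noteq> 0"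
        using degp[of x] by (metis insertI1 degree1_coeffs)
      then show ?thesis using h1[of t] by (simp add: pderiv_pCons)
    next
      case False
      then have "(d - 1, \<lambda>x. pderiv (p x)) \<in># N" using d unfolding N by auto
      then show ?thesis using that h1 unfolding Z_def by auto
    qed
  next
    fix t assume "t \<in> Z"
    then obtain e q where eq: "(e, q) \<in># N" "poly (q x) t = 0" by (auto simp: Z_def)
    have "poly (q y) (h t) = 0" using hN[OF eq(1), of t] eq(2) by (simp add: sgn_0_0)
    then show "sgn (poly (p x) t) = sgn (poly (p y) (h t))"
      using poly_cancel_lead_at_root[of q x t e d p] poly_cancel_lead_at_root[of q y "h t" e d p]
        leadN[OF eq(1)] eq h4[OF eq(1), of t] by simp
  next
    show "\<exists>\<sigma>. (\<forall>\<^sub>F t in at_top. sgn (poly (p x) t) = \<sigma>) \<and> (\<forall>\<^sub>F t in at_top. sgn (poly (p y) t) = \<sigma>)"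
      using sgn_poly_eventually_at_top[of "p x"] sgn_poly_eventually_at_top[of "p y"] h2 degp by auto
    show "\<exists>\<sigma>. (\<forall>\<^sub>F t in at_bot. sgn (poly (p x) t) = \<sigma>) \<and> (\<forall>\<^sub>F t in at_bot. sgn (poly (p y) t) = \<sigma>)"
      using sgn_poly_eventually_at_bot[of "p x"] sgn_poly_eventually_at_bot[of "p y"] h2 degp by auto
  qed
  have "p x \<noteq> 0" using leadp[of x] by auto
  then obtain k where k: "strict_mono k" "surj k" "\<And>t. same_gap Z t (k t)"
     "\<And>t. sgn (poly (p x) t) = sgn (poly (p y) (h (k t)))"
    using T.transfer_exists by blast
  have q: "sgn (poly (q x) t) = sgn (poly (q y) (h (k t)))" if "(e, q) \<in># M1" for e q t
  proof -
    have "sgn (poly (q x) t) = sgn (poly (q x) (k t))"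
    proof (cases "e = 0")
      case True
      then have "degree (q x) = 0" using par[OF that] by (auto simp: par_poly_def)
      then obtain a where "q x = [:a:]" by (rule degree_eq_zeroE)
      then show ?thesis by simp
    next
      case False
      then have "(e, q) \<in># N" using that unfolding N by auto
      then have "\<And>t. poly (q x) t = 0 \<Longrightarrow> t \<in> Z" unfolding Z_def by auto
      then show ?thesis using sgn_poly_same_gap k(3) by blast
    qed
    then show ?thesis using h3[OF that] by simp
  qed
  have "strict_mono (h \<circ> k)" "surj (h \<circ> k)"
    using strict_mono_o[OF h(1) k(1)] comp_surj[OF k(2) h(2)] by simp_all
  then show ?thesis unfolding same_signs_def
    by (intro exI[of _ "h \<circ> k"]) (use k q in auto)
qed

text \<open>
  Well-founded induction on the multiset of formal degrees. Where a leading coefficient vanishes,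
  that polynomial is replaced by one of smaller formal degree. Where none vanishes, a polynomial
  \<open>p\<close> of maximal degree is replaced by finitely many polynomials of smaller degree, whose signs
  determine those of \<open>p\<close>.
\<close>

theorem stratified_exists:
  fixes M :: "(nat \<times> ('x \<Rightarrow> real poly)) multiset"
  assumes "\<And>e q. (e, q) \<in># M \<Longrightarrow> par_poly A e q" "semialg A X Y"
  shows "stratified A X (snd ` set_mset M) Y"
  using assms
proof (induction "image_mset fst M" arbitrary: M Y rule: less_induct)
  case less
  note par = less.prems(1)
  show ?case
  proof (cases "\<forall>(e, q) \<in># M. e = 0")
    case True
    then have e0: "e = 0" if "(e, q) \<in># M" for e q using that by auto
    have "par_poly A 0 p" if "p \<in> snd ` set_mset M" for p
    proof -
      from that obtain e where "(e, p) \<in># M" by auto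
      then show ?thesis using par e0 by blast
    qed
    then show ?thesis using less.prems(2) by (intro stratified_constants) auto
  next
    case False
    define F where "F = snd ` set_mset M"
    define V where "V e q = Y \<inter> {x\<in>X. coeff (q x) e = 0}" for e and q :: "'x \<Rightarrow> real poly"
    define NC where "NC = {(e, q). (e, q) \<in># M \<and> 0 < e}"
    have finNC: "finite NC" by (rule finite_subset[of _ "set_mset M"]) (auto simp: NC_def)
    have V: "stratified A X F (V e q)" if eq: "(e, q) \<in> NC" for e q
    proof (rule stratified_map)
      define M' where "M' = add_mset (e - 1, drop_lead e q) (M - {#(e, q)#})"
      have eM: "(e, q) \<in># M" "0 < e" using eq by (auto simp: NC_def)
      have Meq: "M = add_mset (e, q) (M - {#(e, q)#})" using eM by simp
      have "image_mset fst M' < image_mset fst M"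
      proof -
        have "{#e - 1#} < {#e#}" using eM(2) by simp
        from add_strict_left_mono[OF this, of "image_mset fst (M - {#(e, q)#})"]
        have "image_mset fst M' < image_mset fst (add_mset (e, q) (M - {#(e, q)#}))"
          by (simp add: M'_def)
        then show ?thesis using Meq by simp
      qed
      moreover have "par_poly A i r" if "(i, r) \<in># M'" for i r
        using that par_poly_drop_lead[OF par eM(2)] par eM(1) by (auto simp: M'_def dest: in_diffD)
      moreover have "semialg A X (V e q)"
        unfolding V_def using par[OF eM(1)]
        by (intro semialg.inter less.prems(2) semialg_zero) (auto simp: par_poly_def)
      ultimately show "stratified A X (snd ` set_mset M') (V e q)" using less.hyps by blast
      fix x y assume xy: "x \<in> V e q" "y \<in> V e q" "same_signs (snd ` set_mset M') x y"
      have dr: "drop_lead e q z = q z" if "z \<in> {x, y}" for z using that xy by (auto simp: drop_lead_def V_def)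
      have F: "F = insert q (snd ` set_mset (M - {#(e, q)#}))" unfolding F_def by (subst Meq) simp
      have F': "snd ` set_mset M' = insert (drop_lead e q) (snd ` set_mset (M - {#(e, q)#}))" 
        by (simp add: M'_def)
      show "same_signs F x y" using xy(3) dr unfolding same_signs_def F F' by simp
    qed
    \<comment> \<open>The remaining parameters: no leading coefficient vanishes.\<close>
    define Y' where "Y' = Y \<inter> {x\<in>X. \<forall>eq\<in>NC. coeff (snd eq x) (fst eq) \<noteq> 0}"
    have sY': "semialg A X Y'" unfolding Y'_def
      by (intro semialg.inter less.prems(2) semialg_finite_conj finNC semialg_nonzero)
         (use par in \<open>auto simp: NC_def par_poly_def\<close>)
    have Y': "stratified A X F Y'"
    proof -
      have ne: "fst ` set_mset M \<noteq> {}" using False by auto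
      define d where "d = Max (fst ` set_mset M)"
      have "d \<in> fst ` set_mset M" unfolding d_def using ne by (intro Max_in) auto
      then obtain p where p: "(d, p) \<in># M" by force
      have dmax: "e \<le> d" if "(e, q) \<in># M" for e q
        unfolding d_def using that by (intro Max_ge) force+
      have d: "0 < d" using False dmax by fastforce
      define M1 where "M1 = M - {#(d, p)#}"
      have Meq: "M = add_mset (d, p) M1" using p by (simp add: M1_def)
      define N where "N = filter_mset (\<lambda>(e, q). 0 < e) (add_mset (d - 1, \<lambda>x. pderiv (p x)) M1)"
      define C where "C = image_mset (\<lambda>(e, q). (d - 1, cancel_lead d p e q)) N"
      define M2 where "M2 = M1 + (add_mset (d - 1, \<lambda>x. pderiv (p x)) (add_mset (0, \<lambda>x. [:coeff (p x) d:]) C))"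
      have M1M: "(e, q) \<in># M1 \<Longrightarrow> (e, q) \<in># M" for e q by (simp add: Meq)
      have parN: "par_poly A e q \<and> e \<le> d" if "(e, q) \<in># N" for e q
        using that par[OF M1M] par_poly_pderiv[OF par[OF p]] dmax[OF M1M] unfolding N_def by (auto split: if_splits)
      show ?thesis
      proof (rule stratified_map)
        \<comment> \<open>One entry \<open>d\<close> is exchanged for entries below \<open>d\<close>.\<close>
        have "image_mset fst (add_mset (d - 1, \<lambda>x. pderiv (p x)) (add_mset (0, \<lambda>x. [:coeff (p x) d:]) C)) < {#d#}"
          by (rule ex_gt_imp_less_multiset) (use d in \<open>auto simp: C_def\<close>)
        from add_strict_left_mono[OF this, of "image_mset fst M1"]
        have "image_mset fst M2 < image_mset fst M" unfolding M2_def Meq by simp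
        moreover have "par_poly A e q" if inM2: "(e, q) \<in># M2" for e q
        proof -
          consider "(e, q) \<in># M1" | "e = d - 1" "q = (\<lambda>x. pderiv (p x))"
            | "e = 0" "q = (\<lambda>x. [:coeff (p x) d:])"
            | i r where "(i, r) \<in># N" "e = d - 1" "q = cancel_lead d p i r"
          proof -
            have "(e, q) \<in># M1 \<or> (e, q) = (d - 1, \<lambda>x. pderiv (p x)) \<or>
                (e, q) = (0, \<lambda>x. [:coeff (p x) d:]) \<or> (e, q) \<in># C"
              using inM2 unfolding M2_def by auto
            then show thesis
            proof (elim disjE)
              assume "(e, q) \<in># C"
              then obtain z where "z \<in># N" "(e, q) = (case z of (i, r) \<Rightarrow> (d - 1, cancel_lead d p i r))"
                unfolding C_def by auto
              then show thesis using that(4) by (cases z) auto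
            qed (use that in auto)
          qed
          then show ?thesis
          proof cases
            case 1 then show ?thesis using par M1M by blast
          next
            case 2 then show ?thesis using par_poly_pderiv[OF par[OF p]] by simp
          next
            case 3 then show ?thesis using par_poly_lead[OF par[OF p]] by simp
          next
            case 4 then show ?thesis using par_poly_cancel_lead[OF par[OF p] _ _ d] parN by blast
          qed
        qed
        ultimately show "stratified A X (snd ` set_mset M2) Y'" using less.hyps sY' by blast
        fix x y assume xy: "x \<in> Y'" "y \<in> Y'" "same_signs (snd ` set_mset M2) x y"
        have lead: "coeff (q z) e \<noteq> 0" if "(e, q) \<in># M" "0 < e" "z \<in> {x, y}" for e q z
          using xy that by (auto simp: Y'_def NC_def)
        have "same_signs (insert p (snd ` set_mset M1)) x y"
        proof (rule same_signs_step[OF _ par[OF p] d _ lead[OF p d] N_def])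
          show "par_poly A e q" if "(e, q) \<in># M1" for e q using par M1M that by blast
          show "coeff (q z) e \<noteq> 0" if "(e, q) \<in># M1" "0 < e" "z \<in> {x, y}" for e q z
            using lead M1M that by blast
          show "same_signs (insert (\<lambda>x. pderiv (p x)) (insert (\<lambda>x. [:coeff (p x) d:])
               (snd ` set_mset M1 \<union> (\<lambda>(e, q). cancel_lead d p e q) ` set_mset N))) x y"
            by (rule same_signs_mono[OF xy(3)]) (force simp: M2_def C_def)
        qed
        then show "same_signs F x y" by (simp add: F_def Meq)
      qed
    qed
    have "stratified A X F (\<Union>(insert Y' ((\<lambda>(e, q). V e q) ` NC)))"
      by (rule stratified_Union) (use finNC V Y' in auto)
    moreover have "\<Union>(insert Y' ((\<lambda>(e, q). V e q) ` NC)) = Y"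
    proof (intro equalityI subsetI)
      fix x assume x: "x \<in> Y"
      then have xX: "x \<in> X" using semialg_subset[OF less.prems(2)] by blast
      show "x \<in> \<Union>(insert Y' ((\<lambda>(e, q). V e q) ` NC))"
      proof (cases "\<forall>eq\<in>NC. coeff (snd eq x) (fst eq) \<noteq> 0")
        case True
        then show ?thesis using x xX by (simp add: Y'_def)
      next
        case False
        then obtain e q where "(e, q) \<in> NC" "coeff (q x) e = 0" by auto
        then have "(e, q) \<in> NC" "x \<in> V e q" using x xX by (auto simp: V_def)
        then show ?thesis by blast
      qed
    qed (auto simp: Y'_def V_def)
    ultimately show ?thesis by (simp add: F_def)
  qed
qed

text \<open>
  On each stratum the condition holds for all parameters or for none, because the bijections
  transport a witness.
\<close>

lemma semialg_exists:
  assumes "finite F" "\<And>p. p \<in> F \<Longrightarrow> \<exists>d. par_poly A d p"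
    and D: "\<And>x y s t. x \<in> X \<Longrightarrow> y \<in> X \<Longrightarrow> \<forall>p\<in>F. sgn (poly (p x) s) = sgn (poly (p y) t) \<Longrightarrow> D x s \<Longrightarrow> D y t"
  shows "semialg A X {x \<in> X. \<exists>t. D x t}"
proof -
  obtain deg where deg: "\<And>p. p \<in> F \<Longrightarrow> par_poly A (deg p) p" using assms(2) by metis
  define M where "M = image_mset (\<lambda>p. (deg p, p)) (mset_set F)"
  have "stratified A X (snd ` set_mset M) X"
    by (rule stratified_exists) (use deg assms(1) semialg_whole in \<open>auto simp: M_def\<close>)
  moreover have "snd ` set_mset M = F" using assms(1) by (force simp: M_def)
  ultimately obtain P where P: "finite P" "X = \<Union>P"
    "\<forall>S\<in>P. semialg A X S \<and> (\<forall>x\<in>S. \<forall>y\<in>S. same_signs F x y)"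
    unfolding stratified_def by auto
  have "{x \<in> X. \<exists>t. D x t} = \<Union>{S\<in>P. \<exists>x\<in>S. \<exists>t. D x t}"
  proof (intro equalityI subsetI)
    fix x assume "x \<in> {x \<in> X. \<exists>t. D x t}" then show "x \<in> \<Union>{S\<in>P. \<exists>x\<in>S. \<exists>t. D x t}" using P by blast
  next
    fix y assume "y \<in> \<Union>{S\<in>P. \<exists>x\<in>S. \<exists>t. D x t}"
    then obtain S x t where S: "S \<in> P" "y \<in> S" "x \<in> S" "D x t" by blast
    then have "same_signs F x y" using P(3) by blast
    then obtain h where "\<forall>p\<in>F. sgn (poly (p x) t) = sgn (poly (p y) (h t))"
      unfolding same_signs_def by blast
    then have "D y (h t)" using D[of x y t "h t"] S P(2) by blast
    then show "y \<in> {x \<in> X. \<exists>t. D x t}" using S P(2) by blast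
  qed
  then show ?thesis using P by (auto intro: semialg_Union)
qed

end

text \<open>
  A Boolean combination of sign conditions only sees the signs of finitely many functions.
\<close>

lemma semialg_sign_determined:
  "semialg A X S \<Longrightarrow> \<exists>G. finite G \<and> G \<subseteq> A \<and>
     (\<forall>x\<in>X. \<forall>y\<in>X. (\<forall>g\<in>G. sgn (g x) = sgn (g y)) \<longrightarrow> x \<in> S \<longrightarrow> y \<in> S)"
proof -
  have "semialg A X S \<Longrightarrow> \<exists>G. finite G \<and> G \<subseteq> A \<and>
     (\<forall>x\<in>X. \<forall>y\<in>X. (\<forall>g\<in>G. sgn (g x) = sgn (g y)) \<longrightarrow> (x \<in> S \<longleftrightarrow> y \<in> S))"
  proof (induction rule: semialg.induct)
    case (pos f)
    then show ?case by (intro exI[of _ "{f}"]) (auto simp: sgn_if split: if_splits)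
  next
    case (union S T)
    then obtain G H where GH: "finite G" "G \<subseteq> A" "finite H" "H \<subseteq> A"
      "\<forall>x\<in>X. \<forall>y\<in>X. (\<forall>g\<in>G. sgn (g x) = sgn (g y)) \<longrightarrow> (x \<in> S \<longleftrightarrow> y \<in> S)"
      "\<forall>x\<in>X. \<forall>y\<in>X. (\<forall>g\<in>H. sgn (g x) = sgn (g y)) \<longrightarrow> (x \<in> T \<longleftrightarrow> y \<in> T)" by blast
    have "finite (G \<union> H)" "G \<union> H \<subseteq> A" using GH by auto
    moreover have "\<forall>g\<in>G. sgn (g x) = sgn (g y)" "\<forall>g\<in>H. sgn (g x) = sgn (g y)"
      if "\<forall>g\<in>G \<union> H. sgn (g x) = sgn (g y)" for x y using that by auto
    ultimately show ?case using GH(5,6) by (intro exI[of _ "G \<union> H"]) (metis Un_iff Int_iff)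
  next
    case (inter S T)
    then obtain G H where GH: "finite G" "G \<subseteq> A" "finite H" "H \<subseteq> A"
      "\<forall>x\<in>X. \<forall>y\<in>X. (\<forall>g\<in>G. sgn (g x) = sgn (g y)) \<longrightarrow> (x \<in> S \<longleftrightarrow> y \<in> S)"
      "\<forall>x\<in>X. \<forall>y\<in>X. (\<forall>g\<in>H. sgn (g x) = sgn (g y)) \<longrightarrow> (x \<in> T \<longleftrightarrow> y \<in> T)" by blast
    have "finite (G \<union> H)" "G \<union> H \<subseteq> A" using GH by auto
    moreover have "\<forall>g\<in>G. sgn (g x) = sgn (g y)" "\<forall>g\<in>H. sgn (g x) = sgn (g y)"
      if "\<forall>g\<in>G \<union> H. sgn (g x) = sgn (g y)" for x y using that by auto
    ultimately show ?case using GH(5,6) by (intro exI[of _ "G \<union> H"]) (metis Un_iff Int_iff)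
  next
    case (compl S) then show ?case by blast
  qed
  then show "semialg A X S \<Longrightarrow> ?thesis" by blast
qed

text \<open>
  Functions of \<open>w\<close> and of real variables \<open>x 0, \<dots>, x (k - 1)\<close> that are polynomial in these
  variables with coefficients in \<open>A\<close>.
\<close>

inductive_set poly_in :: "nat \<Rightarrow> ('w \<Rightarrow> real) set \<Rightarrow> ('w \<times> (nat \<Rightarrow> real) \<Rightarrow> real) set" for k A where
  base: "f \<in> A \<Longrightarrow> (\<lambda>z. f (fst z)) \<in> poly_in k A"
| var: "i < k \<Longrightarrow> (\<lambda>z. snd z i) \<in> poly_in k A"
| add: "f \<in> poly_in k A \<Longrightarrow> g \<in> poly_in k A \<Longrightarrow> (\<lambda>z. f z + g z) \<in> poly_in k A"
| mult: "f \<in> poly_in k A \<Longrightarrow> g \<in> poly_in k A \<Longrightarrow> (\<lambda>z. f z * g z) \<in> poly_in k A"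

lemma poly_in_cong: "f \<in> poly_in k A \<Longrightarrow> \<forall>i<k. x i = y i \<Longrightarrow> f (w, x) = f (w, y)"
  by (induction rule: poly_in.induct) auto

context function_algebra begin

lemma function_algebra_poly_in: "function_algebra (poly_in k A)"
proof
  show "(\<lambda>x. c) \<in> poly_in k A" for c using poly_in.base[OF const[of c]] by simp
qed (auto intro: poly_in.intros)

lemma poly_in_Suc_par_poly:
  assumes "f \<in> poly_in (Suc k) A"
  shows "\<exists>p d. par_poly (poly_in k A) d p \<and> (\<forall>w x. f (w, x) = poly (p (w, x)) (x k))"
  using assms
proof (induction rule: poly_in.induct)
  interpret k: function_algebra "poly_in k A" by (rule function_algebra_poly_in)
  have c0: "(\<lambda>x. coeff [:f x:] i) \<in> poly_in k A" if "f \<in> poly_in k A" for f i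
    using that k.const[of 0] by (cases i) auto
  {
    case (base f)
    then show ?case
      by (intro exI[of _ "\<lambda>z. [:f (fst z):]"] exI[of _ 0]) (auto simp: par_poly_def intro: c0 poly_in.base)
  next
    case (var i)
    show ?case
    proof (cases "i = k")
      case True
      have "(\<lambda>x. coeff [:0, 1::real:] j) \<in> poly_in k A" for j by (rule k.const)
      then show ?thesis using True
        by (intro exI[of _ "\<lambda>z. [:0, 1:]"] exI[of _ 1]) (auto simp: par_poly_def)
    next
      case False
      then have "(\<lambda>z. snd z i) \<in> poly_in k A" using var by (intro poly_in.var) auto
      then show ?thesis
        by (intro exI[of _ "\<lambda>z. [:snd z i:]"] exI[of _ 0]) (auto simp: par_poly_def intro: c0)
    qed
  next
    case (add f g)
    then obtain p d q e where p: "par_poly (poly_in k A) d p" "\<forall>w x. f (w, x) = poly (p (w, x)) (x k)"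
      and q: "par_poly (poly_in k A) e q" "\<forall>w x. g (w, x) = poly (q (w, x)) (x k)" by metis
    have "par_poly (poly_in k A) (max d e) (\<lambda>z. p z + q z)"
      using p q by (auto simp: par_poly_def intro!: k.add degree_add_le intro: le_max_iff_disj[THEN iffD2])
    then show ?case using p q by (intro exI[of _ "\<lambda>z. p z + q z"] exI[of _ "max d e"]) auto
  next
    case (mult f g)
    then obtain p d q e where p: "par_poly (poly_in k A) d p" "\<forall>w x. f (w, x) = poly (p (w, x)) (x k)"
      and q: "par_poly (poly_in k A) e q" "\<forall>w x. g (w, x) = poly (q (w, x)) (x k)" by metis
    have sum: "(\<lambda>z. \<Sum>i\<in>I. h i z) \<in> poly_in k A" if "\<And>i. h i \<in> poly_in k A" "finite I" for h and I :: "nat set"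
      using that(2) by (induction I rule: finite_induct) (auto intro: k.const k.add that)
    have "par_poly (poly_in k A) (d + e) (\<lambda>z. p z * q z)"
      using p q by (auto simp: par_poly_def coeff_mult intro!: sum k.mult
          order.trans[OF degree_mult_le add_mono])
    then show ?case using p q by (intro exI[of _ "\<lambda>z. p z * q z"] exI[of _ "d + e"]) auto
  }
qed

lemma semialg_project_one:
  assumes S: "semialg (poly_in (Suc k) A) (X \<times> UNIV) S"
  shows "semialg (poly_in k A) (X \<times> UNIV) {z \<in> X \<times> UNIV. \<exists>t. (fst z, (snd z)(k := t)) \<in> S}"
proof -
  interpret k: function_algebra "poly_in k A" by (rule function_algebra_poly_in)
  obtain G where G: "finite G" "G \<subseteq> poly_in (Suc k) A"
    "\<forall>x\<in>X\<times>UNIV. \<forall>y\<in>X\<times>UNIV. (\<forall>g\<in>G. sgn (g x) = sgn (g y)) \<longrightarrow> x \<in> S \<longrightarrow> y \<in> S"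
    using semialg_sign_determined[OF S] by blast
  have "\<forall>g\<in>G. \<exists>p. (\<exists>d. par_poly (poly_in k A) d p) \<and> (\<forall>w x. g (w, x) = poly (p (w, x)) (x k))"
    using G(2) poly_in_Suc_par_poly by blast
  then obtain p where p: "\<And>g. g \<in> G \<Longrightarrow> \<exists>d. par_poly (poly_in k A) d (p g)"
    "\<And>g w x. g \<in> G \<Longrightarrow> g (w, x) = poly (p g (w, x)) (x k)" by metis
  have indep: "p g (w, x(k := t)) = p g (w, x)" if "g \<in> G" for g w x t
  proof (rule poly_eqI)
    fix i
    have "(\<lambda>z. coeff (p g z) i) \<in> poly_in k A" using p(1)[OF that] by (auto simp: par_poly_def)
    from poly_in_cong[OF this, of "x(k := t)" x w] show "coeff (p g (w, x(k := t))) i = coeff (p g (w, x)) i"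
      by simp
  qed
  show ?thesis
  proof (rule k.semialg_exists[of "p ` G"])
    fix z z' s t
    assume z: "z \<in> X \<times> UNIV" "z' \<in> X \<times> UNIV" "\<forall>q\<in>p ` G. sgn (poly (q z) s) = sgn (poly (q z') t)"
      and S: "(fst z, (snd z)(k := s)) \<in> S"
    have "sgn (g (fst z, (snd z)(k := s))) = sgn (g (fst z', (snd z')(k := t)))" if "g \<in> G" for g
      using z(3) that p(2)[OF that] indep[OF that] by (cases z; cases z') simp
    moreover have "(fst z, (snd z)(k := s)) \<in> X \<times> UNIV" "(fst z', (snd z')(k := t)) \<in> X \<times> UNIV"
      using z by auto
    ultimately show "(fst z', (snd z')(k := t)) \<in> S" using G(3) S by blast
  qed (use G p in auto)
qed

text \<open>
  The Tarski-Seidenberg theorem: the variables are eliminated one after the other.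
\<close>

theorem semialg_projection:
  assumes "semialg (poly_in k A) (X \<times> UNIV) S"
  shows "semialg A X {w \<in> X. \<exists>x. (w, x) \<in> S}"
  using assms
proof (induction k arbitrary: S)
  case 0
  have *: "semialg A X {w \<in> X. (w, x) \<in> S}" for x
    using 0
  proof (induction rule: semialg.induct)
    case (pos f)
    have "(\<lambda>w. f (w, x)) \<in> A" using pos
      by (induction rule: poly_in.induct) (auto intro: add mult)
    from semialg.pos[OF this, of X] show ?case by simp
  next
    case (union S T)
    then have "semialg A X ({w \<in> X. (w, x) \<in> S} \<union> {w \<in> X. (w, x) \<in> T})" by (intro semialg.union)
    also have "{w \<in> X. (w, x) \<in> S} \<union> {w \<in> X. (w, x) \<in> T} = {w \<in> X. (w, x) \<in> S \<union> T}" by auto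
    finally show ?case .
  next
    case (inter S T)
    then have "semialg A X ({w \<in> X. (w, x) \<in> S} \<inter> {w \<in> X. (w, x) \<in> T})" by (intro semialg.inter)
    also have "{w \<in> X. (w, x) \<in> S} \<inter> {w \<in> X. (w, x) \<in> T} = {w \<in> X. (w, x) \<in> S \<inter> T}" by auto
    finally show ?case .
  next
    case (compl S)
    then have "semialg A X (X - {w \<in> X. (w, x) \<in> S})" by (intro semialg.compl)
    also have "X - {w \<in> X. (w, x) \<in> S} = {w \<in> X. (w, x) \<in> X \<times> UNIV - S}" by auto
    finally show ?case .
  qed
  obtain G where G: "G \<subseteq> poly_in 0 A"
    "\<forall>x\<in>X\<times>UNIV. \<forall>y\<in>X\<times>UNIV. (\<forall>g\<in>G. sgn (g x) = sgn (g y)) \<longrightarrow> x \<in> S \<longrightarrow> y \<in> S"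
    using semialg_sign_determined[OF 0] by blast
  have "(w, y) \<in> S" if "(w, x) \<in> S" "w \<in> X" for w x y
  proof -
    have "\<forall>g\<in>G. g (w, x) = g (w, y)" using G(1) poly_in_cong[of _ 0 A x y w] by auto
    then show ?thesis using G(2) that by (metis SigmaI UNIV_I)
  qed
  then have "{w \<in> X. \<exists>x. (w, x) \<in> S} = {w \<in> X. (w, \<lambda>_. 0) \<in> S}" by blast
  then show ?case using * by simp
next
  case (Suc k)
  define S' where "S' = {z \<in> X \<times> UNIV. \<exists>t. (fst z, (snd z)(k := t)) \<in> S}"
  have "semialg A X {w \<in> X. \<exists>x. (w, x) \<in> S'}"
    unfolding S'_def by (intro Suc.IH semialg_project_one Suc.prems)
  moreover have "{w \<in> X. \<exists>x. (w, x) \<in> S'} = {w \<in> X. \<exists>x. (w, x) \<in> S}"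
    unfolding S'_def by auto (metis fun_upd_triv)
  ultimately show ?case by simp
qed

end

section \<open>Alternating forms\<close>


text \<open>
  The space of values is arbitrary, so that real forms and their complexifications are treated
  together.
\<close>

definition alt_form :: "nat \<Rightarrow> ((nat \<Rightarrow> 'a::real_vector) \<Rightarrow> 'b::real_vector) \<Rightarrow> bool" where
  "alt_form p \<alpha> \<longleftrightarrow>
     (\<forall>v w. (\<forall>i<p. v i = w i) \<longrightarrow> \<alpha> v = \<alpha> w) \<and>
     (\<forall>v. \<forall>i<p. linear (\<lambda>x. \<alpha> (v(i := x)))) \<and>
     (\<forall>v. \<forall>i<p. \<forall>j<p. i \<noteq> j \<and> v i = v j \<longrightarrow> \<alpha> v = 0)"

lemma alternating_forms_iff: "\<alpha> \<in> alternating_forms p \<longleftrightarrow> alt_form p \<alpha>"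
  unfolding alternating_forms_def mem_Collect_eq unfolding alt_form_def by (rule refl)

lemma alt_form_cong:
  assumes "alt_form p \<alpha>" "\<And>i. i < p \<Longrightarrow> v i = w i"
  shows "\<alpha> v = \<alpha> w"
proof -
  have "\<forall>v w. (\<forall>i<p. v i = w i) \<longrightarrow> \<alpha> v = \<alpha> w"
    using assms(1) unfolding alt_form_def by (rule conjunct1)
  then show ?thesis using assms(2) by simp
qed

lemma alt_form_linear: "alt_form p \<alpha> \<Longrightarrow> i < p \<Longrightarrow> linear (\<lambda>x. \<alpha> (v(i := x)))"
  unfolding alt_form_def by blast

lemma alt_form_eq_0: "alt_form p \<alpha> \<Longrightarrow> i < p \<Longrightarrow> j < p \<Longrightarrow> i \<noteq> j \<Longrightarrow> v i = v j \<Longrightarrow> \<alpha> v = 0"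
  unfolding alt_form_def by blast

lemma alt_form_swap:
  assumes "alt_form p \<alpha>" "i < p" "j < p" "i \<noteq> j"
  shows "\<alpha> (v(i := v j, j := v i)) = - \<alpha> v"
proof -
  define F where "F x y = \<alpha> (v(i := x, j := y))" for x y
  have l2: "linear (\<lambda>y. F x y)" for x
    unfolding F_def by (rule alt_form_linear[OF assms(1,3)])
  have "linear (\<lambda>x. \<alpha> ((v(j := y))(i := x)))" for y
    by (rule alt_form_linear[OF assms(1,2)])
  then have l1: "linear (\<lambda>x. F x y)" for y
    unfolding F_def using assms(4) by (simp add: fun_upd_twist)
  have z: "F x x = 0" for x
    unfolding F_def by (rule alt_form_eq_0[OF assms]) (use assms(4) in simp)
  have "F (v i + v j) (v i + v j) = F (v i) (v i) + F (v i) (v j) + (F (v j) (v i) + F (v j) (v j))"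
    by (simp add: linear_add[OF l1] linear_add[OF l2])
  then have "F (v j) (v i) = - F (v i) (v j)" by (simp add: z add_eq_0_iff2)
  then show ?thesis by (simp add: F_def)
qed

text \<open>
  Permutations are products of transpositions, each of which changes the sign.
\<close>

lemma alt_form_permute:
  assumes "alt_form p \<alpha>" "\<sigma> permutes {..<p}"
  shows "\<alpha> (\<lambda>i. v (\<sigma> i)) = real_of_int (sign \<sigma>) *\<^sub>R \<alpha> v"
proof -
  have "\<forall>v. \<alpha> (\<lambda>i. v (\<sigma> i)) = real_of_int (sign \<sigma>) *\<^sub>R \<alpha> v"
    using finite_lessThan assms(2)
  proof (induction rule: permutes_rev_induct)
    case id then show ?case by simp
  next
    case (swap a b \<tau>)
    have "\<alpha> (\<lambda>i. v ((\<tau> \<circ> Transposition.transpose a b) i)) = real_of_int (sign (\<tau> \<circ> Transposition.transpose a b)) *\<^sub>R \<alpha> v" for v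
    proof (cases "a = b")
      case True then show ?thesis using swap by simp
    next
      case False
      have "(\<lambda>i. v ((\<tau> \<circ> Transposition.transpose a b) i)) = (\<lambda>i. v (\<tau> i))(a := v (\<tau> b), b := v (\<tau> a))"
        by (auto simp: Transposition.transpose_def fun_eq_iff)
      then have "\<alpha> (\<lambda>i. v ((\<tau> \<circ> Transposition.transpose a b) i)) = - \<alpha> (\<lambda>i. v (\<tau> i))"
        using alt_form_swap[OF assms(1), of a b "\<lambda>i. v (\<tau> i)"] swap False by simp
      also have "\<alpha> (\<lambda>i. v (\<tau> i)) = real_of_int (sign \<tau>) *\<^sub>R \<alpha> v" using swap by blast
      finally show ?thesis using swap False
        by (simp add: sign_compose sign_swap_id permutation_swap_id permutes_imp_permutation[OF finite_lessThan])
    qed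
    then show ?case by blast
  qed
  then show ?thesis by blast
qed

text \<open>
  Properties that are preserved by linear combinations in each argument need to be checked on
  generators only; the arguments are changed one at a time.
\<close>

lemma multilinear_span_induct:
  fixes P :: "(nat \<Rightarrow> 'a::real_vector) \<Rightarrow> bool"
  assumes cong: "\<And>v w. (\<And>i. i < n \<Longrightarrow> v i = w i) \<Longrightarrow> P v \<Longrightarrow> P w"
    and sub: "\<And>v i. i < n \<Longrightarrow> subspace {x. P (v(i := x))}"
    and gen: "\<And>v. (\<And>i. i < n \<Longrightarrow> v i \<in> B) \<Longrightarrow> P v"
    and v: "\<And>i. i < n \<Longrightarrow> v i \<in> span B"
  shows "P v"
proof -
  have "j \<le> n \<Longrightarrow> (\<And>i. i < j \<Longrightarrow> v i \<in> span B) \<Longrightarrow> (\<And>i. j \<le> i \<Longrightarrow> i < n \<Longrightarrow> v i \<in> B) \<Longrightarrow> P v" for j v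
  proof (induction j arbitrary: v)
    case 0 then show ?case using gen by simp
  next
    case (Suc j)
    have "B \<subseteq> {x. P (v(j := x))}"
    proof
      fix b assume "b \<in> B"
      have "P (v(j := b))"
        by (rule Suc.IH) (use Suc.prems \<open>b \<in> B\<close> in \<open>auto simp: less_Suc_eq\<close>)
      then show "b \<in> {x. P (v(j := x))}" by simp
    qed
    then have "span B \<subseteq> {x. P (v(j := x))}" using sub[of j v] Suc.prems(1) by (intro span_minimal) auto
    then have "P (v(j := v j))" using Suc.prems(2)[of j] by auto
    then show ?case by simp
  qed
  from this[of n v] show ?thesis using v by simp
qed

text \<open>
  The factor is a determinant. Only its existence and its independence of the form matter, and
  these follow from the case where all entries of \<open>v\<close> are entries of \<open>w\<close>: then \<open>v\<close> is a permutation
  of \<open>w\<close> or has a repetition.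
\<close>

lemma alt_form_change_of_basis:
  fixes v w :: "nat \<Rightarrow> 'a::real_vector"
  assumes "\<And>i. i < n \<Longrightarrow> v i \<in> span (w ` {..<n})"
  shows "\<exists>c::real. \<forall>\<Omega>::(nat \<Rightarrow> 'a) \<Rightarrow> 'b::real_vector. alt_form n \<Omega> \<longrightarrow> \<Omega> v = c *\<^sub>R \<Omega> w"
    (is "?P v")
proof (rule multilinear_span_induct[of n ?P "w ` {..<n}"])
  fix v v' :: "nat \<Rightarrow> 'a"
  assume eq: "\<And>i. i < n \<Longrightarrow> v i = v' i" and "?P v"
  then obtain c :: real where c: "\<And>\<Omega>::(nat \<Rightarrow> 'a) \<Rightarrow> 'b. alt_form n \<Omega> \<Longrightarrow> \<Omega> v = c *\<^sub>R \<Omega> w" by blast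
  have "\<Omega> v' = c *\<^sub>R \<Omega> w" if "alt_form n \<Omega>" for \<Omega> :: "(nat \<Rightarrow> 'a) \<Rightarrow> 'b"
    using c[OF that] alt_form_cong[OF that eq] by simp
  then show "?P v'" by blast
next
  fix v :: "nat \<Rightarrow> 'a" and i assume i: "i < n"
  note lin = alt_form_linear[OF _ i, of _ v]
  show "subspace {x. ?P (v(i := x))}"
  proof (rule subspaceI)
    show "0 \<in> {x. ?P (v(i := x))}"
      using linear_0[OF lin] by (auto intro!: exI[of _ 0] simp del: fun_upd_apply)
  next
    fix x y assume "x \<in> {x. ?P (v(i := x))}" "y \<in> {x. ?P (v(i := x))}"
    then obtain c d where
      c: "\<And>\<Omega>::(nat \<Rightarrow> 'a) \<Rightarrow> 'b. alt_form n \<Omega> \<Longrightarrow> \<Omega> (v(i := x)) = c *\<^sub>R \<Omega> w" and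
      d: "\<And>\<Omega>::(nat \<Rightarrow> 'a) \<Rightarrow> 'b. alt_form n \<Omega> \<Longrightarrow> \<Omega> (v(i := y)) = d *\<^sub>R \<Omega> w" by blast
    show "x + y \<in> {x. ?P (v(i := x))}"
      by (rule CollectI, rule exI[of _ "c + d"])
         (simp add: linear_add[OF lin] c d scaleR_add_left del: fun_upd_apply)
  next
    fix a x assume "x \<in> {x. ?P (v(i := x))}"
    then obtain c where
      c: "\<And>\<Omega>::(nat \<Rightarrow> 'a) \<Rightarrow> 'b. alt_form n \<Omega> \<Longrightarrow> \<Omega> (v(i := x)) = c *\<^sub>R \<Omega> w" by blast
    show "a *\<^sub>R x \<in> {x. ?P (v(i := x))}"
      by (rule CollectI, rule exI[of _ "a * c"]) (simp add: linear_scale[OF lin] c del: fun_upd_apply)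
  qed
next
  fix v :: "nat \<Rightarrow> 'a" assume "\<And>i. i < n \<Longrightarrow> v i \<in> w ` {..<n}"
  then have "\<forall>i. \<exists>j. i < n \<longrightarrow> j < n \<and> v i = w j" by blast
  then obtain \<phi> where \<phi>: "\<And>i. i < n \<Longrightarrow> \<phi> i < n \<and> v i = w (\<phi> i)" by metis
  show "?P v"
  proof (cases "inj_on \<phi> {..<n}")
    case True
    define \<sigma> where "\<sigma> i = (if i < n then \<phi> i else i)" for i
    have "bij_betw \<phi> {..<n} {..<n}"
      using True \<phi> endo_inj_surj[OF finite_lessThan, of \<phi> n] by (auto simp: bij_betw_def)
    then have "bij_betw \<sigma> {..<n} {..<n}" by (subst bij_betw_cong[of _ _ \<phi>]) (auto simp: \<sigma>_def)
    then have \<sigma>: "\<sigma> permutes {..<n}" by (rule bij_imp_permutes) (auto simp: \<sigma>_def)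
    have "\<Omega> v = real_of_int (sign \<sigma>) *\<^sub>R \<Omega> w" if "alt_form n \<Omega>" for \<Omega> :: "(nat \<Rightarrow> 'a) \<Rightarrow> 'b"
      using alt_form_permute[OF that \<sigma>, of w] alt_form_cong[OF that, of v "\<lambda>i. w (\<sigma> i)"] \<phi>
      by (simp add: \<sigma>_def)
    then show ?thesis by blast
  next
    case False
    then obtain i j where "i < n" "j < n" "i \<noteq> j" "\<phi> i = \<phi> j" by (auto simp: inj_on_def)
    then have "\<Omega> v = 0" if "alt_form n \<Omega>" for \<Omega> :: "(nat \<Rightarrow> 'a) \<Rightarrow> 'b"
      using alt_form_eq_0[OF that, of i j v] \<phi> by metis
    then show ?thesis by (intro exI[of _ 0]) auto
  qed
qed (use assms in blast)

lemma alt_form_slot_expand: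
  fixes \<Omega> :: "(nat \<Rightarrow> 'a::euclidean_space) \<Rightarrow> 'b::real_vector"
  assumes "alt_form n \<Omega>" "i < n"
  shows "\<Omega> (v(i := x)) = (\<Sum>b\<in>Basis. (x \<bullet> b) *\<^sub>R \<Omega> (v(i := b)))"
proof -
  note lin = alt_form_linear[OF assms, of v]
  have "\<Omega> (v(i := x)) = \<Omega> (v(i := (\<Sum>b\<in>Basis. (x \<bullet> b) *\<^sub>R b)))" by (simp add: euclidean_representation)
  also have "\<dots> = (\<Sum>b\<in>Basis. (x \<bullet> b) *\<^sub>R \<Omega> (v(i := b)))"
    by (simp add: linear_sum[OF lin] linear_scale[OF lin])
  finally show ?thesis .
qed

text \<open>
  Pointwise convergence of forms is enough for joint continuity, since every value is a finite sum
  of products of coordinates with values on basis vectors. The arguments are expanded one at a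
  time.
\<close>

lemma continuous_on_alt_form_eval:
  fixes \<Omega> :: "'z::topological_space \<Rightarrow> (nat \<Rightarrow> 'a::euclidean_space) \<Rightarrow> complex"
  assumes alt: "\<And>z. z \<in> D \<Longrightarrow> alt_form n (\<Omega> z)"
    and cont\<Omega>: "\<And>v. continuous_on D (\<lambda>z. \<Omega> z v)"
    and cont: "\<And>i. i < n \<Longrightarrow> continuous_on D (\<lambda>z. v z i)"
  shows "continuous_on D (\<lambda>z. \<Omega> z (v z))"
proof -
  have "j \<le> n \<Longrightarrow> continuous_on D (\<lambda>z. \<Omega> z (\<lambda>i. if i < j then v z i else \<phi> i))" for j \<phi>
  proof (induction j arbitrary: \<phi>)
    case 0 then show ?case using cont\<Omega> by simp
  next
    case (Suc j)
    have eq: "(\<Sum>b\<in>Basis. (v z j \<bullet> b) *\<^sub>R \<Omega> z (\<lambda>i. if i < j then v z i else (\<phi>(j := b)) i)) =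
       \<Omega> z (\<lambda>i. if i < Suc j then v z i else \<phi> i)" if "z \<in> D" for z
    proof -
      define u where "u = (\<lambda>i. if i < j then v z i else \<phi> i)"
      have 1: "(\<lambda>i. if i < j then v z i else (\<phi>(j := x)) i) = u(j := x)" for x
        by (auto simp: u_def)
      have 2: "(\<lambda>i. if i < Suc j then v z i else \<phi> i) = u(j := v z j)"
        by (auto simp: less_Suc_eq u_def)
      show ?thesis unfolding 1 2
        by (rule alt_form_slot_expand[OF alt[OF that], symmetric]) (use Suc.prems in simp)
    qed
    have "continuous_on D (\<lambda>z. (v z j \<bullet> b) *\<^sub>R \<Omega> z (\<lambda>i. if i < j then v z i else (\<phi>(j := b)) i))" for b
      using Suc.prems Suc.IH[of "\<phi>(j := b)"]
      by (intro continuous_on_scaleR continuous_on_inner cont continuous_on_const) auto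
    then have "continuous_on D (\<lambda>z. \<Sum>b\<in>Basis. (v z j \<bullet> b) *\<^sub>R \<Omega> z (\<lambda>i. if i < j then v z i else (\<phi>(j := b)) i))"
      by (rule continuous_on_sum)
    then show ?case by (rule continuous_on_eq) (rule eq)
  qed
  from this[of n] have "continuous_on D (\<lambda>z. \<Omega> z (\<lambda>i. if i < n then v z i else 0))" by simp
  then show ?thesis by (rule continuous_on_eq) (rule alt_form_cong[OF alt], simp_all)
qed

lemma alt_form_cmult: "alt_form n \<Omega> \<Longrightarrow> alt_form n (\<lambda>v. c * \<Omega> v :: complex)"
  unfolding alt_form_def linear_iff by (simp add: algebra_simps)

lemma alt_form_diff:
  fixes \<alpha> \<beta> :: "(nat \<Rightarrow> 'a::real_vector) \<Rightarrow> 'b::real_vector"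
  assumes "alt_form n \<alpha>" "alt_form n \<beta>"
  shows "alt_form n (\<lambda>v. \<alpha> v - \<beta> v)"
  unfolding alt_form_def
proof (intro conjI allI impI)
  fix v w :: "nat \<Rightarrow> 'a" assume "\<forall>i<n. v i = w i"
  then show "\<alpha> v - \<beta> v = \<alpha> w - \<beta> w"
    using alt_form_cong[OF assms(1), of v w] alt_form_cong[OF assms(2), of v w] by simp
qed (use assms in \<open>auto intro: linear_compose_sub alt_form_linear simp: alt_form_eq_0\<close>)

text \<open>
  The wedge product with \<open>\<omega>\<close>, extended to complex-valued forms, without the constant factor.
\<close>

definition wedge2 :: "nat \<Rightarrow> ('a \<Rightarrow> 'a \<Rightarrow> real) \<Rightarrow> ((nat \<Rightarrow> 'a) \<Rightarrow> complex) \<Rightarrow> (nat \<Rightarrow> 'a) \<Rightarrow> complex" where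
  "wedge2 n \<omega> \<Omega> v = (\<Sum>\<sigma> | \<sigma> permutes {..<n + 2}.
     of_int (sign \<sigma>) * \<Omega> (\<lambda>i. v (\<sigma> i)) * of_real (\<omega> (v (\<sigma> n)) (v (\<sigma> (n + 1)))))"

lemma wedge2_cmult: "wedge2 n \<omega> (\<lambda>v. c * \<Omega> v) v = c * wedge2 n \<omega> \<Omega> v"
  by (simp add: wedge2_def sum_distrib_left mult_ac)

lemma Re_wedge2: "Re (wedge2 n \<omega> \<Omega> v) = wedge n 2 (\<lambda>v. Re (\<Omega> v)) (\<lambda>v. \<omega> (v 0) (v 1)) v * (fact n * 2)"
  by (simp add: wedge2_def wedge_def fact_2)

lemma Im_wedge2: "Im (wedge2 n \<omega> \<Omega> v) = wedge n 2 (\<lambda>v. Im (\<Omega> v)) (\<lambda>v. \<omega> (v 0) (v 1)) v * (fact n * 2)"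
  by (simp add: wedge2_def wedge_def fact_2)

lemma alt_form_complex_iff:
  "alt_form n \<Omega> \<longleftrightarrow> alt_form n (\<lambda>v. Re (\<Omega> v)) \<and> alt_form n (\<lambda>v. Im (\<Omega> v))"
proof -
  have "linear f \<longleftrightarrow> linear (\<lambda>x. Re (f x)) \<and> linear (\<lambda>x. Im (f x))" for f :: "'a \<Rightarrow> complex"
    by (auto simp: linear_iff complex_eq_iff)
  then show ?thesis unfolding alt_form_def by (auto simp: complex_eq_iff)
qed

lemma complex_primitive_forms_iff:
  "\<Omega> \<in> complex_primitive_forms n \<omega> \<longleftrightarrow> alt_form n \<Omega> \<and> (\<forall>v. wedge2 n \<omega> \<Omega> v = 0)"
proof -
  have *: "alt_form n (\<lambda>v. Re (\<Omega> v)) \<and> alt_form n (\<lambda>v. Im (\<Omega> v)) \<and> (\<forall>v. wedge2 n \<omega> \<Omega> v = 0) \<longleftrightarrow>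
     (\<lambda>v. Re (\<Omega> v)) \<in> primitive_forms n \<omega> \<and> (\<lambda>v. Im (\<Omega> v)) \<in> primitive_forms n \<omega>"
    by (auto simp: primitive_forms_def alternating_forms_iff fun_eq_iff complex_eq_iff Re_wedge2 Im_wedge2)
  have "\<Omega> \<in> complex_primitive_forms n \<omega> \<longleftrightarrow>
     (\<lambda>v. Re (\<Omega> v)) \<in> primitive_forms n \<omega> \<and> (\<lambda>v. Im (\<Omega> v)) \<in> primitive_forms n \<omega>"
  proof
    assume "\<Omega> \<in> complex_primitive_forms n \<omega>"
    then show "(\<lambda>v. Re (\<Omega> v)) \<in> primitive_forms n \<omega> \<and> (\<lambda>v. Im (\<Omega> v)) \<in> primitive_forms n \<omega>"
      by (auto simp: complex_primitive_forms_def)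
  next
    assume "(\<lambda>v. Re (\<Omega> v)) \<in> primitive_forms n \<omega> \<and> (\<lambda>v. Im (\<Omega> v)) \<in> primitive_forms n \<omega>"
    then show "\<Omega> \<in> complex_primitive_forms n \<omega>"
      unfolding complex_primitive_forms_def mem_Collect_eq
      by (intro exI[of _ "\<lambda>v. Re (\<Omega> v)"] exI[of _ "\<lambda>v. Im (\<Omega> v)"]) (simp add: complex_eq[symmetric])
  qed
  then show ?thesis using * alt_form_complex_iff by blast
qed

lemma alt_form_pullback:
  fixes g :: "'a::real_vector \<Rightarrow> 'a"
  assumes "alt_form n \<Omega>" "linear g"
  shows "alt_form n (pullback g \<Omega>)"
  unfolding alt_form_def pullback_def
proof (intro conjI allI impI)
  fix v w :: "nat \<Rightarrow> 'a" assume "\<forall>i<n. v i = w i"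
  then show "\<Omega> (\<lambda>i. g (v i)) = \<Omega> (\<lambda>i. g (w i))" by (intro alt_form_cong[OF assms(1)]) simp
next
  fix v :: "nat \<Rightarrow> 'a" and i assume i: "i < n"
  have "(\<lambda>k. g ((v(i := x)) k)) = (\<lambda>k. g (v k))(i := g x)" for x by auto
  then show "linear (\<lambda>x. \<Omega> (\<lambda>k. g ((v(i := x)) k)))"
    using linear_compose[OF assms(2) alt_form_linear[OF assms(1) i, of "\<lambda>k. g (v k)"]] by (simp add: o_def)
next
  fix v :: "nat \<Rightarrow> 'a" and i j assume "i < n" "j < n" "i \<noteq> j \<and> v i = v j"
  then show "\<Omega> (\<lambda>k. g (v k)) = 0" using alt_form_eq_0[OF assms(1), of i j] by simp
qed

lemma complex_primitive_forms_pullback: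
  assumes "\<Omega> \<in> complex_primitive_forms n \<omega>" "linear g" "\<And>x y. \<omega> (g x) (g y) = \<omega> x y"
  shows "pullback g \<Omega> \<in> complex_primitive_forms n \<omega>"
proof -
  have "wedge2 n \<omega> (pullback g \<Omega>) v = wedge2 n \<omega> \<Omega> (\<lambda>i. g (v i))" for v
    by (simp add: wedge2_def pullback_def assms(3))
  then show ?thesis using assms by (simp add: complex_primitive_forms_iff alt_form_pullback)
qed

section \<open>Symplectic bases and transvections\<close>


locale symplectic =
  fixes \<omega> :: "'a::euclidean_space \<Rightarrow> 'a \<Rightarrow> real" and n :: nat
  assumes symplectic: "symplectic_form \<omega>" and dim: "DIM('a) = 2 * n" and n_pos: "n > 0"
begin

lemma linear_right: "linear (\<lambda>y. \<omega> x y)" and linear_left: "linear (\<lambda>x. \<omega> x y)"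
  using symplectic by (auto simp: symplectic_form_def bilinear_def)

lemmas form_simps [simp] =
  linear_add[OF linear_left] linear_add[OF linear_right]
  linear_diff[OF linear_left] linear_diff[OF linear_right]
  linear_neg[OF linear_left] linear_neg[OF linear_right]
  linear_0[OF linear_left] linear_0[OF linear_right]
  linear_scale[OF linear_left] linear_scale[OF linear_right]
  linear_sum[OF linear_left] linear_sum[OF linear_right]

lemma form_self [simp]: "\<omega> x x = 0"
  using symplectic by (simp add: symplectic_form_def)

lemma form_skew: "\<omega> x y = - \<omega> y x"
  using form_self[of "x + y"] by (simp del: form_self) (simp add: eq_neg_iff_add_eq_0)

lemma form_nondegenerate: "(\<And>y. \<omega> x y = 0) \<Longrightarrow> x = 0"
  using symplectic by (simp add: symplectic_form_def)

lemma continuous_form: "continuous_on S f \<Longrightarrow> continuous_on S g \<Longrightarrow> continuous_on S (\<lambda>z. \<omega> (f z) (g z))"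
proof -
  assume "continuous_on S f" "continuous_on S g"
  moreover have "bounded_bilinear \<omega>"
    using symplectic by (simp add: symplectic_form_def bilinear_conv_bounded_bilinear)
  ultimately show ?thesis by (rule bounded_bilinear.continuous_on[rotated])
qed

text \<open>
  The first \<open>m\<close> hyperbolic pairs of a symplectic basis.
\<close>

definition hyperbolic :: "nat \<Rightarrow> (nat \<Rightarrow> 'a) \<Rightarrow> (nat \<Rightarrow> 'a) \<Rightarrow> bool" where
  "hyperbolic m e f \<longleftrightarrow> (\<forall>i<m. \<forall>j<m. \<omega> (e i) (e j) = 0 \<and> \<omega> (f i) (f j) = 0 \<and>
      \<omega> (e i) (f j) = (if i = j then 1 else 0))"

lemma hyperbolicD:
  assumes "hyperbolic m e f" "i < m" "j < m"
  shows "\<omega> (e i) (e j) = 0" "\<omega> (f i) (f j) = 0" "\<omega> (e i) (f j) = (if i = j then 1 else 0)"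
    "\<omega> (f i) (e j) = (if i = j then -1 else 0)"
  using assms form_skew[of "f i" "e j"] by (auto simp: hyperbolic_def)

text \<open>
  The projection onto the span of the pairs along its symplectic complement.
\<close>

definition hyp_proj :: "nat \<Rightarrow> (nat \<Rightarrow> 'a) \<Rightarrow> (nat \<Rightarrow> 'a) \<Rightarrow> 'a \<Rightarrow> 'a" where
  "hyp_proj m e f x = (\<Sum>k<m. \<omega> x (f k) *\<^sub>R e k - \<omega> x (e k) *\<^sub>R f k)"

lemma hyp_proj_orthogonal:
  assumes "hyperbolic m e f" "i < m"
  shows "\<omega> (x - hyp_proj m e f x) (e i) = 0" "\<omega> (x - hyp_proj m e f x) (f i) = 0"
  using assms by (simp_all add: hyp_proj_def hyperbolicD sum_subtractf sum_negf if_distrib cong: if_cong)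

lemma hyp_proj_in_span: "hyp_proj m e f x \<in> span (e ` {..<m} \<union> f ` {..<m})"
  unfolding hyp_proj_def by (intro span_sum span_diff span_scale span_base) auto

lemma hyperbolic_not_spanning:
  fixes e f :: "nat \<Rightarrow> 'a"
  assumes "m < n"
  shows "\<exists>x. x \<notin> span (e ` {..<m} \<union> f ` {..<m})"
proof (rule ccontr)
  let ?A = "e ` {..<m} \<union> f ` {..<m}"
  assume "\<nexists>x. x \<notin> span ?A"
  then have "UNIV \<subseteq> span ?A" by blast
  then have "dim (UNIV :: 'a set) \<le> card ?A" by (rule span_card_ge_dim[OF subset_UNIV]) simp
  also have "card ?A \<le> m + m"
    by (rule order.trans[OF card_Un_le]) (intro add_mono order.trans[OF card_image_le]; simp)
  finally show False using assms dim by simp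
qed

text \<open>
  A vector outside the span, made orthogonal to it, pairs nontrivially with some vector, which can
  be made orthogonal to the span as well.
\<close>

lemma hyperbolic_extend:
  assumes h: "hyperbolic m e f" and m: "m < n"
  shows "\<exists>x y. hyperbolic (Suc m) (e(m := x)) (f(m := y))"
proof -
  obtain v where v: "v \<notin> span (e ` {..<m} \<union> f ` {..<m})" using hyperbolic_not_spanning[OF m] by blast
  define x where "x = v - hyp_proj m e f v"
  have "x \<noteq> 0" using v hyp_proj_in_span[of m e f v] by (auto simp: x_def)
  then obtain y0 where y0: "\<omega> x y0 \<noteq> 0" using form_nondegenerate by blast
  define y where "y = (1 / \<omega> x y0) *\<^sub>R (y0 - hyp_proj m e f y0)"
  have x: "\<omega> x (e i) = 0" "\<omega> x (f i) = 0" if "i < m" for i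
    unfolding x_def using hyp_proj_orthogonal[OF h that] by blast+
  have y: "\<omega> y (e i) = 0" "\<omega> y (f i) = 0" if "i < m" for i
    unfolding y_def using hyp_proj_orthogonal[OF h that] by simp_all
  have "\<omega> x (hyp_proj m e f y0) = 0" by (simp add: hyp_proj_def x)
  then have xy: "\<omega> x y = 1" using y0 by (simp add: y_def)
  have x': "\<omega> (e i) x = 0" "\<omega> (f i) x = 0" and y': "\<omega> (e i) y = 0" "\<omega> (f i) y = 0" if "i < m" for i
    using x[OF that] y[OF that] form_skew by (metis neg_equal_0_iff_equal)+
  have "hyperbolic (Suc m) (e(m := x)) (f(m := y))"
    unfolding hyperbolic_def using h by (auto simp: less_Suc_eq x y x' y' xy hyperbolicD)
  then show ?thesis by blast
qed

abbreviation frame :: "(nat \<Rightarrow> 'a) \<Rightarrow> (nat \<Rightarrow> 'a) \<Rightarrow> bool" where "frame \<equiv> hyperbolic n"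

lemma frame_exists: "\<exists>e f. frame e f"
proof -
  have "m \<le> n \<Longrightarrow> \<exists>e f. hyperbolic m e f" for m
  proof (induction m)
    case 0 then show ?case by (auto simp: hyperbolic_def)
  next
    case (Suc m) then show ?case using hyperbolic_extend by (metis Suc_leD Suc_le_lessD)
  qed
  then show ?thesis by blast
qed

text \<open>
  Pairing a linear relation with the dual vectors of the frame isolates its coefficients; the
  number of vectors is the dimension.
\<close>

lemma frame_basis:
  assumes "frame e f"
  shows "independent (e ` {..<n} \<union> f ` {..<n})" "span (e ` {..<n} \<union> f ` {..<n}) = UNIV"
    "inj_on e {..<n}"
proof -
  let ?A = "e ` {..<n} \<union> f ` {..<n}"
  note D = hyperbolicD[OF assms]
  have e: "\<omega> x (f i) = (if x = e i then 1 else 0)" if "x \<in> ?A" "i < n" for x i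
    using that D by (auto split: if_splits)
  have f: "\<omega> x (e i) = (if x = f i then -1 else 0)" if "x \<in> ?A" "i < n" for x i
    using that D by (auto split: if_splits)
  show ind: "independent ?A"
  proof (rule independent_if_scalars_zero)
    fix u x assume sum: "(\<Sum>x\<in>?A. u x *\<^sub>R x) = 0" and x: "x \<in> ?A"
    from x consider i where "i < n" "x = e i" | i where "i < n" "x = f i" by auto
    then show "u x = 0"
    proof cases
      case 1
      have "0 = \<omega> (\<Sum>x\<in>?A. u x *\<^sub>R x) (f i)" by (simp only: sum form_simps)
      also have "\<dots> = (\<Sum>y\<in>?A. u y * (if y = e i then 1 else 0))"
        by (simp only: form_simps) (intro sum.cong refl, simp add: e 1)
      also have "\<dots> = u x" using x 1 by (simp add: if_distrib cong: if_cong)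
      finally show ?thesis by simp
    next
      case 2
      have "0 = \<omega> (\<Sum>x\<in>?A. u x *\<^sub>R x) (e i)" by (simp only: sum form_simps)
      also have "\<dots> = (\<Sum>y\<in>?A. u y * (if y = f i then -1 else 0))"
        by (simp only: form_simps) (intro sum.cong refl, simp add: f 2)
      also have "\<dots> = - u x" using x 2 by (simp add: if_distrib cong: if_cong)
      finally show ?thesis by simp
    qed
  qed simp
  show inj: "inj_on e {..<n}"
    by (rule inj_onI) (metis D(3) lessThan_iff zero_neq_one)
  have injf: "inj_on f {..<n}"
    by (rule inj_onI) (metis D(3) lessThan_iff zero_neq_one)
  have "e i \<noteq> f j" if "i < n" "j < n" for i j using D(2,3) that by (metis zero_neq_one)
  then have "e ` {..<n} \<inter> f ` {..<n} = {}" by blast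
  then have "card ?A = 2 * n" by (simp add: card_Un_disjoint card_image inj injf)
  then have "UNIV \<subseteq> span ?A" using ind dim by (intro card_ge_dim_independent) auto
  then show "span ?A = UNIV" by blast
qed

lemma frame_expansion:
  assumes "frame e f"
  shows "x = (\<Sum>k<n. \<omega> x (f k) *\<^sub>R e k - \<omega> x (e k) *\<^sub>R f k)"
proof -
  define d where "d = x - hyp_proj n e f x"
  have "\<omega> d y = 0" for y
  proof -
    have "y \<in> span (e ` {..<n} \<union> f ` {..<n})" using frame_basis[OF assms] by simp
    then show ?thesis
      by (induction rule: span_induct)
         (use hyp_proj_orthogonal[OF assms] in \<open>auto simp: d_def subspace_def\<close>)
  qed
  then have "d = 0" by (rule form_nondegenerate)
  then show ?thesis by (simp add: d_def hyp_proj_def)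
qed

lemma frame_independent: "frame e f \<Longrightarrow> independent (e ` {..<n})"
  using frame_basis(1) by (rule independent_mono) auto

lemma span_frame_lagrangian:
  assumes "frame e f"
  shows "span (e ` {..<n}) \<in> lagrangian_grassmannian n \<omega>"
proof -
  have "dim (span (e ` {..<n})) = n"
    using frame_independent[OF assms] frame_basis(3)[OF assms]
    by (simp add: dim_span dim_eq_card_independent card_image)
  moreover have "\<omega> x y = 0" if x: "x \<in> span (e ` {..<n})" and y: "y \<in> span (e ` {..<n})" for x y
  proof -
    have 1: "\<omega> (e i) y = 0" if "i < n" for i
      using y by (induction rule: span_induct) (auto simp: subspace_def hyperbolicD[OF assms] that)
    show ?thesis using x by (induction rule: span_induct) (auto simp: subspace_def 1)
  qed
  ultimately show ?thesis by (auto simp: lagrangian_grassmannian_def)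
qed

lemma U_alt_form: "\<Omega> \<in> U_set n \<omega> \<Longrightarrow> alt_form n \<Omega>"
  by (simp add: U_set_def complex_primitive_forms_iff)

text \<open>
  Any two bases of a Lagrangian subspace give values that differ by a real factor.
\<close>

lemma U_nonzero:
  assumes "\<Omega> \<in> U_set n \<omega>" "frame e f"
  shows "\<Omega> e \<noteq> 0"
proof -
  obtain v where v: "\<forall>i. v i \<in> span (e ` {..<n})" "\<Omega> v \<noteq> 0"
    using assms(1) span_frame_lagrangian[OF assms(2)] by (auto simp: U_set_def)
  obtain c :: real where "\<Omega> v = c *\<^sub>R \<Omega> e"
    using alt_form_change_of_basis[of n v e] v(1) U_alt_form[OF assms(1)] by blast
  then show ?thesis using v(2) by auto
qed

lemma frame_rotate:
  assumes "frame e f" "m < n"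
  shows "frame (e(m := cos \<theta> *\<^sub>R e m + sin \<theta> *\<^sub>R f m)) (f(m := - sin \<theta> *\<^sub>R e m + cos \<theta> *\<^sub>R f m))"
  unfolding hyperbolic_def using assms
  by (auto simp: hyperbolicD[OF assms(1)] simp flip: power2_eq_square)

text \<open>
  The orientation of the pencil of Lagrangian subspaces through the hyperplane spanned by the \<open>e i\<close>
  with \<open>i \<noteq> m\<close>, as seen by \<open>\<Omega>\<close>: the value on the member of the pencil at angle \<open>\<theta>\<close> is
  \<open>cos \<theta> * a + sin \<theta> * b\<close> with \<open>a = \<Omega> e\<close> and \<open>b = \<Omega> (e(m := f m))\<close>, and it turns counterclockwise
  exactly if \<open>Im (cnj a * b) > 0\<close>.
\<close>

definition orientation :: "((nat \<Rightarrow> 'a) \<Rightarrow> complex) \<Rightarrow> nat \<Rightarrow> (nat \<Rightarrow> 'a) \<Rightarrow> (nat \<Rightarrow> 'a) \<Rightarrow> real" where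
  "orientation \<Omega> m e f = Im (cnj (\<Omega> e) * \<Omega> (e(m := f m)))"

lemma alt_form_rotate:
  assumes "alt_form n \<Omega>" "m < n"
  shows "\<Omega> (e(m := cos \<theta> *\<^sub>R e m + sin \<theta> *\<^sub>R f m)) =
     of_real (cos \<theta>) * \<Omega> e + of_real (sin \<theta>) * (\<Omega> (e(m := f m)) :: complex)"
proof -
  note lin = alt_form_linear[OF assms, of e]
  show ?thesis by (simp add: linear_add[OF lin] linear_scale[OF lin] scaleR_conv_of_real)
qed

end

text \<open>
  If \<open>a\<close> and \<open>b\<close> are real multiples of each other, the line through them passes through zero in some
  direction.
\<close>

lemma Im_cnj_mult_nonzero:
  assumes "\<And>\<theta>. of_real (cos \<theta>) * a + of_real (sin \<theta>) * b \<noteq> (0::complex)"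
  shows "Im (cnj a * b) \<noteq> 0"
proof
  assume 0: "Im (cnj a * b) = 0"
  have a: "a \<noteq> 0" using assms[of 0] by simp
  define r where "r = Re (cnj a * b) / (cmod a)^2"
  have "cnj a * b = of_real (r * (cmod a)^2)" using 0 a by (simp add: complex_eq_iff r_def)
  also have "\<dots> = cnj a * (of_real r * a)" unfolding of_real_mult complex_norm_square by (simp add: mult_ac)
  finally have b: "b = of_real r * a" using a by simp
  have s: "sqrt (1 + r^2) > 0" by (simp add: add_pos_nonneg)
  \<comment> \<open>With \<open>b = r a\<close> the combination vanishes if \<open>cos \<theta> = - r sin \<theta>\<close>.\<close>
  have "(- r / sqrt (1 + r^2))^2 + (1 / sqrt (1 + r^2))^2 = 1"
    using s by (simp add: power_divide add_divide_distrib[symmetric] add_nonneg_nonneg add.commute)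
  then obtain \<theta> where \<theta>: "- r / sqrt (1 + r^2) = cos \<theta>" "1 / sqrt (1 + r^2) = sin \<theta>"
    using sincos_total_2pi by metis
  have "of_real (cos \<theta>) * a + of_real (sin \<theta>) * b = of_real (cos \<theta> + sin \<theta> * r) * a"
    by (simp add: b algebra_simps)
  also have "\<dots> = 0" by (simp flip: \<theta>)
  finally show False using assms by blast
qed

lemma continuous_nonzero_pos:
  fixes F :: "real \<Rightarrow> real"
  assumes "continuous_on {0..1} F" "\<And>s. s \<in> {0..1} \<Longrightarrow> F s \<noteq> 0" "F 0 > 0"
  shows "F 1 > 0"
proof (rule ccontr)
  assume "\<not> F 1 > 0"
  then have "\<exists>s\<ge>0. s \<le> 1 \<and> F s = 0" using assms by (intro IVT2') auto
  then show False using assms(2) by auto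
qed

context symplectic begin

lemma orientation_nonzero:
  assumes "\<Omega> \<in> U_set n \<omega>" "frame e f" "m < n"
  shows "orientation \<Omega> m e f \<noteq> 0"
  unfolding orientation_def
  by (rule Im_cnj_mult_nonzero)
     (use U_nonzero[OF assms(1) frame_rotate[OF assms(2,3)]] alt_form_rotate[OF U_alt_form[OF assms(1)] assms(3)] in simp)

definition transvection :: "'a \<Rightarrow> real \<Rightarrow> 'a \<Rightarrow> 'a" where
  "transvection u c x = x + (c * \<omega> u x) *\<^sub>R u"

lemma form_transvection [simp]: "\<omega> (transvection u c x) (transvection u c y) = \<omega> x y"
  using form_skew[of x u] by (simp add: transvection_def)

lemma transvection_frame: "frame e f \<Longrightarrow> frame (transvection u c \<circ> e) (transvection u c \<circ> f)"
  by (simp add: hyperbolic_def)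

lemma transvection_maps: "\<omega> y x \<noteq> 0 \<Longrightarrow> transvection (y - x) (1 / \<omega> y x) x = y"
  by (simp add: transvection_def)

text \<open>
  Transvections act transitively on symplectic bases. The vectors of the basis are moved into place
  one after the other by transvections along vectors \<open>u\<close> orthogonal to the pairs that are already
  in place, which therefore stay fixed. A transvection along \<open>y - x\<close> moves \<open>x\<close> to \<open>y\<close> if
  \<open>\<omega> x y \<noteq> 0\<close>; otherwise an intermediate vector is used.
\<close>

theorem frame_transvection_induct:
  assumes fr: "frame e f" and fr': "frame e' f'" and P: "P e f"
    and step: "\<And>e f u c. frame e f \<Longrightarrow> P e f \<Longrightarrow> P (transvection u c \<circ> e) (transvection u c \<circ> f)"
    and cong: "\<And>e f e' f'. (\<And>i. i < n \<Longrightarrow> e i = e' i \<and> f i = f' i) \<Longrightarrow> P e f \<Longrightarrow> P e' f'"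
  shows "P e' f'"
proof -
  have "k \<le> n \<Longrightarrow> \<exists>e f. frame e f \<and> P e f \<and> (\<forall>i<k. e i = e' i \<and> f i = f' i)" for k
  proof (induction k)
    case 0 then show ?case using fr P by auto
  next
    case (Suc k)
    then have k: "k < n" by simp
    define R where "R e f \<longleftrightarrow> frame e f \<and> P e f \<and> (\<forall>i<k. e i = e' i \<and> f i = f' i)" for e f
    define W where "W = {u. \<forall>i<k. \<omega> u (e' i) = 0 \<and> \<omega> u (f' i) = 0}"
    have W_add: "u + v \<in> W" "u - v \<in> W" if "u \<in> W" "v \<in> W" for u v using that by (auto simp: W_def)
    have R_step: "R (transvection u c \<circ> e) (transvection u c \<circ> f)" if "R e f" "u \<in> W" for e f u c
      using that step transvection_frame by (auto simp: R_def W_def) (auto simp: transvection_def)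
    have W_frame: "e k \<in> W" "f k \<in> W" if "R e f" for e f
    proof -
      have "frame e f" using that by (simp add: R_def)
      note D = hyperbolicD[OF this k]
      have "\<omega> (e k) (e i) = 0 \<and> \<omega> (e k) (f i) = 0 \<and> \<omega> (f k) (e i) = 0 \<and> \<omega> (f k) (f i) = 0"
        if "i < k" for i using D[of i] k that by simp
      then show "e k \<in> W" "f k \<in> W" using that by (auto simp: R_def W_def)
    qed
    have D': "\<omega> (e' k) (f' k) = 1" using hyperbolicD(3)[OF fr' k k] by simp
    have W': "e' k \<in> W" "f' k \<in> W" using hyperbolicD[OF fr' k] k by (auto simp: W_def)
    have move: "\<exists>e1 f1. R e1 f1 \<and> e1 k = z" if "R e f" "z \<in> W" "\<omega> z (e k) \<noteq> 0" for e f z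
      using R_step[OF that(1) W_add(2)[OF that(2) W_frame(1)[OF that(1)]], of "1 / \<omega> z (e k)"]
        transvection_maps[OF that(3)] by fastforce
    obtain e0 f0 where R0: "R e0 f0" using Suc unfolding R_def by auto
    have D0: "\<omega> (e0 k) (f0 k) = 1" using R0 hyperbolicD(3)[of n e0 f0 k k] k by (simp add: R_def)
    have "\<exists>e1 f1. R e1 f1 \<and> e1 k = e' k"
    proof (cases "\<omega> (e' k) (e0 k) = 0")
      case False then show ?thesis using move R0 W' by blast
    next
      case True
      have "\<exists>z\<in>W. \<omega> z (e0 k) \<noteq> 0 \<and> \<omega> (e' k) z \<noteq> 0"
      proof -
        consider "\<omega> (e' k) (f0 k) \<noteq> 0" | "\<omega> (f' k) (e0 k) \<noteq> 0"
          | "\<omega> (e' k) (f0 k) = 0" "\<omega> (f' k) (e0 k) = 0" by blast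
        then show ?thesis
        proof cases
          case 1 then show ?thesis using W_frame[OF R0] D0 form_skew[of "f0 k" "e0 k"] by (intro bexI[of _ "f0 k"]) auto
        next
          case 2 then show ?thesis using W' D' by (intro bexI[of _ "f' k"]) auto
        next
          case 3 then show ?thesis using W' W_frame[OF R0] D0 D' form_skew[of "f0 k" "e0 k"]
            by (intro bexI[of _ "f0 k + f' k"] W_add) auto
        qed
      qed
      then obtain z where z: "z \<in> W" "\<omega> z (e0 k) \<noteq> 0" "\<omega> (e' k) z \<noteq> 0" by blast
      obtain e1 f1 where "R e1 f1" "e1 k = z" using move[OF R0 z(1,2)] by blast
      then show ?thesis using move[of e1 f1 "e' k"] W' z(3) by auto
    qed
    then obtain e1 f1 where R1: "R e1 f1" "e1 k = e' k" by blast
    have D1: "\<omega> (e' k) (f1 k) = 1" using R1 hyperbolicD(3)[of n e1 f1 k k] k by (simp add: R_def)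
    \<comment> \<open>If \<open>\<omega> (e' k) z = 1\<close>, the transvection along \<open>z - f k\<close> fixes \<open>e' k\<close>.\<close>
    have move': "\<exists>e2 f2. R e2 f2 \<and> e2 k = e' k \<and> f2 k = z"
      if "R e f" "e k = e' k" "z \<in> W" "\<omega> (e' k) z = 1" "\<omega> z (f k) \<noteq> 0" for e f z
    proof -
      have "\<omega> (e' k) (f k) = 1" using that hyperbolicD(3)[of n e f k k] k by (simp add: R_def)
      then have "\<omega> (z - f k) (e' k) = 0" using that(4) form_skew[of z "e' k"] form_skew[of "f k" "e' k"] by simp
      then have "transvection (z - f k) c (e' k) = e' k" for c by (simp add: transvection_def)
      then show ?thesis
        using R_step[OF that(1) W_add(2)[OF that(3) W_frame(2)[OF that(1)]], of "1 / \<omega> z (f k)"]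
        transvection_maps[OF that(5)] that(2) by fastforce
    qed
    have "\<exists>e2 f2. R e2 f2 \<and> e2 k = e' k \<and> f2 k = f' k"
    proof (cases "\<omega> (f' k) (f1 k) = 0")
      case False then show ?thesis using move'[OF R1 W'(2) D'] by blast
    next
      case True
      \<comment> \<open>The intermediate vector \<open>e' k + f1 k\<close> still pairs to 1 with \<open>e' k\<close>, and it pairs nontrivially
        with both \<open>f1 k\<close> and \<open>f' k\<close>.\<close>
      obtain e2 f2 where R2: "R e2 f2" "e2 k = e' k" "f2 k = e' k + f1 k"
        using move'[OF R1, of "e' k + f1 k"] W_add(1)[OF W'(1) W_frame(2)[OF R1(1)]] D1 by auto
      have "\<omega> (f' k) (f2 k) \<noteq> 0" using R2(3) True D' form_skew[of "f' k" "e' k"] by simp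
      then show ?thesis using move'[OF R2(1,2) W'(2) D'] by blast
    qed
    then show ?case by (auto simp: R_def less_Suc_eq)
  qed
  from this[OF order_refl] show ?thesis using cong by blast
qed

lemma continuous_on_transvection:
  assumes "continuous_on D c" shows "continuous_on D (\<lambda>s. transvection u (c s) x)"
  unfolding transvection_def using assms by (intro continuous_intros)

text \<open>
  A transvection is joined to the identity by a path of transvections, along which the orientation is
  continuous and never zero.
\<close>

theorem orientation_independent:
  assumes U: "\<Omega> \<in> U_set n \<omega>" and m: "m < n" and fr: "frame e f" and fr': "frame e' f'"
    and pos: "orientation \<Omega> m e f > 0"
  shows "orientation \<Omega> m e' f' > 0"
proof (rule frame_transvection_induct[where P = "\<lambda>e f. orientation \<Omega> m e f > 0", OF fr fr' pos])
  fix e f u and c :: real assume fr: "frame e f" and pos: "orientation \<Omega> m e f > 0"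
  define F where "F s = orientation \<Omega> m (transvection u (s * c) \<circ> e) (transvection u (s * c) \<circ> f)" for s
  note alt = U_alt_form[OF U]
  have "F 1 > 0"
  proof (rule continuous_nonzero_pos)
    have c: "continuous_on {0..1} (\<lambda>s. \<Omega> (\<lambda>i. transvection u (s * c) (v i)))" for v
      by (rule continuous_on_alt_form_eval[of _ n "\<lambda>_. \<Omega>"])
         (intro alt continuous_on_const continuous_on_transvection continuous_on_mult continuous_on_id)+
    have "(\<lambda>i. transvection u (s * c) (e i))(m := transvection u (s * c) (f m)) =
        (\<lambda>i. transvection u (s * c) ((e(m := f m)) i))" for s
      by auto
    then show "continuous_on {0..1} F" unfolding F_def orientation_def o_def
      using c[of e] c[of "e(m := f m)"] by (simp add: continuous_intros)
    show "F s \<noteq> 0" for s unfolding F_def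
      by (rule orientation_nonzero[OF U transvection_frame[OF fr] m])
    show "F 0 > 0" using pos by (simp add: F_def transvection_def o_def orientation_def fun_upd_def)
  qed
  then show "orientation \<Omega> m (transvection u c \<circ> e) (transvection u c \<circ> f) > 0" by (simp add: F_def)
next
  fix e f e' f' :: "nat \<Rightarrow> 'a" assume eq: "\<And>i. i < n \<Longrightarrow> e i = e' i \<and> f i = f' i" and pos: "orientation \<Omega> m e f > 0"
  have "\<Omega> e = \<Omega> e'" "\<Omega> (e(m := f m)) = \<Omega> (e'(m := f' m))"
    by (rule alt_form_cong[OF U_alt_form[OF U]]; use eq m in simp)+
  then show "orientation \<Omega> m e' f' > 0" using pos by (simp add: orientation_def)
qed

lemma frame_permute: "frame e f \<Longrightarrow> \<tau> permutes {..<n} \<Longrightarrow> frame (\<lambda>i. e (\<tau> i)) (\<lambda>i. f (\<tau> i))"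
  unfolding hyperbolic_def using permutes_in_image[of \<tau> "{..<n}"] permutes_inj[of \<tau> "{..<n}"]
  by (auto simp: inj_eq)

text \<open>
  Exchanging two pairs of the frame changes the sign of both values of \<open>\<Omega>\<close>, so the exchanged frame
  has at index \<open>k\<close> the orientation of the old one at \<open>m\<close>.
\<close>

theorem orientation_index:
  assumes U: "\<Omega> \<in> U_set n \<omega>" and m: "m < n" "k < n" and fr: "frame e f"
    and pos: "orientation \<Omega> k e f > 0"
  shows "orientation \<Omega> m e f > 0"
proof (cases "m = k")
  case False
  note alt = U_alt_form[OF U]
  define e' where "e' = e(m := e k, k := e m)"
  define f' where "f' = f(m := f k, k := f m)"
  have "Transposition.transpose m k permutes {..<n}" using m by (simp add: permutes_swap_id)
  moreover have "e' = (\<lambda>i. e (Transposition.transpose m k i))" "f' = (\<lambda>i. f (Transposition.transpose m k i))"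
    using False by (auto simp: e'_def f'_def Transposition.transpose_def)
  ultimately have "frame e' f'" using frame_permute[OF fr] by simp
  then have pos': "orientation \<Omega> k e' f' > 0" using orientation_independent[OF U m(2) fr _ pos] by blast
  have 1: "\<Omega> e' = - \<Omega> e" unfolding e'_def using alt_form_swap[OF alt m False] .
  have "e'(k := f' k) = (e(m := f m))(m := (e(m := f m)) k, k := (e(m := f m)) m)"
    using False by (auto simp: e'_def f'_def)
  then have 2: "\<Omega> (e'(k := f' k)) = - \<Omega> (e(m := f m))" using alt_form_swap[OF alt m False, of "e(m := f m)"] by simp
  show ?thesis using pos' by (simp add: orientation_def 1 2)
qed (use pos in simp)

end

section \<open>The phase loop and its homotopy class\<close>


lemma abs_real_mod_pi_eq_iff: "abs_real_mod_pi x = abs_real_mod_pi y \<longleftrightarrow> [x = y] (rmod pi)"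
  by (rule real_mod_pi.abs_eq_iff)

lemma abs_real_mod_pi_shift [simp]: "abs_real_mod_pi (x + pi) = abs_real_mod_pi x"
  "abs_real_mod_pi (x - pi) = abs_real_mod_pi x"
  unfolding abs_real_mod_pi_eq_iff
  by (auto simp: rcong_altdef intro: exI[of _ "-1::int"] exI[of _ "1::int"])

lemma continuous_on_abs_real_mod_pi: "continuous_on S abs_real_mod_pi"
  by (rule continuous_on_subset[of UNIV])
     (auto simp: continuous_on_open_vimage open_real_mod_pi_def)

text \<open>
  The argument modulo \<open>\<pi>\<close>; unlike \<open>Arg\<close> itself it is continuous on the punctured plane.
\<close>

definition arg_class :: "complex \<Rightarrow> real_mod_pi" where
  "arg_class z = abs_real_mod_pi (Arg z)"

lemma arg_class_minus: "z \<noteq> 0 \<Longrightarrow> arg_class (- z) = arg_class z"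
  by (simp add: arg_class_def Arg_minus)

lemma arg_class_scale:
  assumes "r \<noteq> 0" "z \<noteq> 0" shows "arg_class (of_real r * z) = arg_class z"
proof (cases "r > 0")
  case True then show ?thesis by (simp add: arg_class_def)
next
  case False
  then have "arg_class (of_real (-r) * z) = arg_class z" using assms by (simp add: arg_class_def del: of_real_minus)
  then show ?thesis using arg_class_minus[of "of_real r * z"] assms by simp
qed

lemma arg_class_cis: "arg_class (cis x) = abs_real_mod_pi x"
proof -
  have "cis (Arg (cis x)) = cis x" by (simp add: cis_Arg)
  then have "cis (Arg (cis x) - x) = 1" by (simp flip: cis_divide)
  then obtain k :: int where "Arg (cis x) - x = 2 * pi * k"
    by (auto simp: cis_conv_exp exp_eq_1 mult_ac)
  then have "Arg (cis x) = x + of_int (2 * k) * pi" by (simp add: algebra_simps)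
  then have "x = Arg (cis x) + of_int (- 2 * k) * pi" by simp
  then show ?thesis unfolding arg_class_def abs_real_mod_pi_eq_iff rcong_altdef by blast
qed

text \<open>
  Near the cut of \<open>Arg\<close> the class can be computed at \<open>- z\<close>.
\<close>

lemma continuous_on_arg_class: "continuous_on (- {0}) arg_class"
proof -
  have 1: "continuous_on (- \<real>\<^sub>\<le>\<^sub>0) arg_class"
    unfolding arg_class_def
    by (rule continuous_on_compose2[OF continuous_on_abs_real_mod_pi[of UNIV] continuous_on_Arg]) simp
  have "continuous_on ((\<lambda>z. - z) -` (- \<real>\<^sub>\<le>\<^sub>0)) (\<lambda>z. arg_class (- z))"
    by (rule continuous_on_compose2[OF 1]) (auto intro: continuous_intros)
  then have 2: "continuous_on ((\<lambda>z. - z) -` (- \<real>\<^sub>\<le>\<^sub>0)) arg_class"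
    by (rule continuous_on_eq) (auto intro!: arg_class_minus)
  have "open ((\<lambda>z::complex. - z) -` (- \<real>\<^sub>\<le>\<^sub>0))"
    by (intro open_vimage continuous_intros) (simp add: closed_nonpos_Reals_complex open_Compl)
  then have "continuous_on (- \<real>\<^sub>\<le>\<^sub>0 \<union> (\<lambda>z. - z) -` (- \<real>\<^sub>\<le>\<^sub>0)) arg_class"
    using 1 2 by (intro continuous_on_open_Un) (auto simp: closed_nonpos_Reals_complex open_Compl)
  moreover have "- \<real>\<^sub>\<le>\<^sub>0 \<union> (\<lambda>z. - z) -` (- \<real>\<^sub>\<le>\<^sub>0) = - {0::complex}"
    by (auto simp: complex_nonpos_Reals_iff complex_eq_iff)
  ultimately show ?thesis by simp
qed

text \<open>
  The homeomorphism of \<open>\<real>/\<pi>\<int>\<close> with the unit circle; it makes winding numbers available.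
\<close>

definition double_cis :: "real_mod_pi \<Rightarrow> complex" where
  "double_cis q = cis (2 * rep_real_mod_pi q)"

lemma double_cis_abs: "double_cis (abs_real_mod_pi x) = cis (2 * x)"
proof -
  define r where "r = rep_real_mod_pi (abs_real_mod_pi x)"
  have "[r = x] (rmod pi)"
    unfolding r_def using Quotient_rep_abs[OF Quotient_real_mod_pi] by simp
  then obtain k :: int where "x = r + of_int k * pi" by (auto simp: rcong_altdef)
  then have "2 * x = 2 * r + 2 * pi * of_int k" by simp
  then have "cis (2 * x) = cis (2 * r) * cis (2 * pi * of_int k)"
    by (simp only: cis_mult)
  also have "cis (2 * pi * of_int k) = 1" by (rule cis_multiple_2pi) simp
  finally show ?thesis by (simp add: double_cis_def r_def)
qed

lemma continuous_on_double_cis: "continuous_on UNIV double_cis"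
proof -
  have "open (abs_real_mod_pi -` (double_cis -` V))" if "open V" for V
  proof -
    have "abs_real_mod_pi -` (double_cis -` V) = (\<lambda>x. cis (2 * x)) -` V"
      by (auto simp: double_cis_abs)
    also have "open \<dots>" using that by (intro open_vimage continuous_intros)
    finally show ?thesis .
  qed
  then show ?thesis by (simp add: continuous_on_open_vimage open_real_mod_pi_def)
qed

lemma double_cis_arg_class_cnj:
  assumes "z \<noteq> 0" shows "double_cis (arg_class (cnj z)) = cnj (double_cis (arg_class z))"
proof -
  have *: "double_cis (arg_class z) = sgn z ^ 2" if "z \<noteq> 0" for z
    using that by (simp add: arg_class_def double_cis_abs Complex.DeMoivre flip: cis_Arg)
  show ?thesis using assms by (simp add: * sgn_eq)
qed

definition plane_loop :: "complex \<Rightarrow> complex \<Rightarrow> real \<Rightarrow> real_mod_pi" where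
  "plane_loop a b t = arg_class (of_real (cos (pi * t)) * a + of_real (sin (pi * t)) * b)"

lemma real_combination_nonzero:
  assumes "Im (cnj a * b) \<noteq> 0"
  shows "of_real (cos \<theta>) * a + of_real (sin \<theta>) * b \<noteq> (0::complex)"
proof
  assume 0: "of_real (cos \<theta>) * a + of_real (sin \<theta>) * b = 0"
  have "of_real (sin \<theta>) * (cnj a * b) = - of_real (cos \<theta>) * (cnj a * a)"
    using arg_cong[OF 0, of "\<lambda>z. cnj a * z"] by (simp add: algebra_simps eq_neg_iff_add_eq_0)
  then have "sin \<theta> * Im (cnj a * b) = 0" by (simp add: complex_eq_iff)
  then have "sin \<theta> = 0" using assms by simp
  moreover have "a \<noteq> 0" using assms by auto
  ultimately have "sin \<theta> = 0" "cos \<theta> = 0" using 0 by auto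
  then show False using sin_cos_squared_add[of \<theta>] by simp
qed

text \<open>
  The pairs \<open>(a, b)\<close> with \<open>Im (cnj a * b) > 0\<close> are the positive bases of the plane. They are deformed
  to \<open>(1, \<i>)\<close> by moving \<open>a\<close> to 1 along a logarithm and the ratio \<open>b / a\<close> to \<open>\<i>\<close> inside the upper half
  plane.
\<close>

lemma plane_loop_homotopic:
  assumes "Im (cnj a * b) > 0"
  shows "homotopic_loops UNIV (plane_loop a b) (\<lambda>t. abs_real_mod_pi (pi * t))"
proof -
  have a: "a \<noteq> 0" using assms by auto
  define \<beta> where "\<beta> s = of_real (1 - s) * (b / a) + of_real s * \<i>" for s :: real
  define H where "H z = exp (of_real (1 - fst z) * Ln a) *
     (of_real (cos (pi * snd z)) * 1 + of_real (sin (pi * snd z)) * \<beta> (fst z))" for z :: "real \<times> real"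
  have "b / a = cnj a * b / of_real ((cmod a)^2)" 
    unfolding complex_norm_square using a by (simp add: field_simps)
  then have "Im (b / a) = Im (cnj a * b) / (cmod a)^2" by simp
  then have ba: "Im (b / a) > 0" using assms a by simp
  have Im\<beta>: "Im (\<beta> s) = (1 - s) * Im (b / a) + s" for s
    unfolding \<beta>_def by (simp only: plus_complex.sel Im_complex_of_real Re_complex_of_real times_complex.sel imaginary_unit.sel)
  have \<beta>: "Im (\<beta> s) > 0" if "s \<in> {0..1}" for s
  proof (cases "s = 0")
    case False
    then show ?thesis using that ba unfolding Im\<beta> by (intro add_nonneg_pos mult_nonneg_nonneg) auto
  qed (use ba Im\<beta>[of 0] in simp)
  have H0: "H z \<noteq> 0" if "fst z \<in> {0..1}" for z
    using real_combination_nonzero[of 1 "\<beta> (fst z)" "pi * snd z"] \<beta>[OF that] by (auto simp: H_def)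
  show ?thesis unfolding homotopic_loops
  proof (intro exI[of _ "\<lambda>z. arg_class (H z)"] conjI ballI)
    show "continuous_on ({0..1} \<times> {0..1}) (\<lambda>z. arg_class (H z))"
    proof (rule continuous_on_compose2[OF continuous_on_arg_class])
      show "continuous_on ({0..1} \<times> {0..1}) H"
        unfolding H_def \<beta>_def by (intro continuous_intros)
    qed (use H0 in auto)
    show "arg_class (H (0, t)) = plane_loop a b t" for t
      using a by (simp add: H_def \<beta>_def plane_loop_def algebra_simps)
    show "arg_class (H (1, t)) = abs_real_mod_pi (pi * t)" for t
    proof -
      have "H (1, t) = cis (pi * t)" by (simp add: H_def \<beta>_def complex_eq_iff)
      then show ?thesis by (simp add: arg_class_cis)
    qed
    fix s :: real assume "s \<in> {0..1}"
    then have "H (s, 1) = - H (s, 0)" "H (s, 0) \<noteq> 0" using H0[of "(s, 0)"] by (simp_all add: H_def)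
    then show "pathfinish ((\<lambda>z. arg_class (H z)) \<circ> Pair s) = pathstart ((\<lambda>z. arg_class (H z)) \<circ> Pair s)"
      by (simp add: pathfinish_def pathstart_def arg_class_minus)
  qed simp
qed

text \<open>
  If the basis is negative, complex conjugation turns the loop into one of the previous lemma. Were it
  also homotopic to the positive generator, the circle would be homotopic to its reverse, against
  the winding numbers 1 and -1.
\<close>

lemma plane_loop_homotopic_iff:
  assumes "Im (cnj a * b) \<noteq> 0"
  shows "homotopic_loops UNIV (plane_loop a b) (\<lambda>t. abs_real_mod_pi (pi * t)) \<longleftrightarrow> Im (cnj a * b) > 0"
proof (rule iffI[OF _ plane_loop_homotopic])
  assume hom: "homotopic_loops UNIV (plane_loop a b) (\<lambda>t. abs_real_mod_pi (pi * t))"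
  show "Im (cnj a * b) > 0"
  proof (rule ccontr)
    assume "\<not> Im (cnj a * b) > 0"
    then have "Im (cnj (cnj a) * cnj b) > 0" using assms by simp
    then have hom': "homotopic_loops UNIV (plane_loop (cnj a) (cnj b)) (\<lambda>t. abs_real_mod_pi (pi * t))"
      by (rule plane_loop_homotopic)
    have cis0: "double_cis q \<in> - {0}" for q by (simp add: double_cis_def)
    have 1: "homotopic_loops (- {0}) (double_cis \<circ> plane_loop a b) (double_cis \<circ> (\<lambda>t. abs_real_mod_pi (pi * t)))"
      by (rule homotopic_loops_continuous_image[OF hom continuous_on_double_cis]) (use cis0 in auto)
    have 2: "homotopic_loops (- {0}) ((cnj \<circ> double_cis) \<circ> plane_loop (cnj a) (cnj b))
        ((cnj \<circ> double_cis) \<circ> (\<lambda>t. abs_real_mod_pi (pi * t)))"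
      by (rule homotopic_loops_continuous_image[OF hom'])
         (use cis0 in \<open>auto intro!: continuous_intros continuous_on_double_cis\<close>)
    have eq: "(cnj \<circ> double_cis) \<circ> plane_loop (cnj a) (cnj b) = double_cis \<circ> plane_loop a b"
    proof
      fix t
      have "of_real (cos (pi * t)) * a + of_real (sin (pi * t)) * b \<noteq> 0"
        by (rule real_combination_nonzero[OF assms])
      from double_cis_arg_class_cnj[OF this]
      show "((cnj \<circ> double_cis) \<circ> plane_loop (cnj a) (cnj b)) t = (double_cis \<circ> plane_loop a b) t"
        by (simp add: plane_loop_def)
    qed
    have 3: "homotopic_loops (- {0}) (double_cis \<circ> (\<lambda>t. abs_real_mod_pi (pi * t)))
        ((cnj \<circ> double_cis) \<circ> (\<lambda>t. abs_real_mod_pi (pi * t)))"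
      by (rule homotopic_loops_trans[OF homotopic_loops_sym[OF 1] 2[unfolded eq]])
    have c: "double_cis \<circ> (\<lambda>t. abs_real_mod_pi (pi * t)) = circlepath 0 1"
      by (rule ext) (simp add: double_cis_abs circlepath cis_conv_exp mult_ac)
    have r: "(cnj \<circ> double_cis) \<circ> (\<lambda>t. abs_real_mod_pi (pi * t)) = reversepath (circlepath 0 1)"
    proof
      fix t :: real
      have "cnj (cis (2 * (pi * t))) = cis (2 * (pi * (1 - t)))"
      proof -
        have "2 * (pi * (1 - t)) = 2 * pi + - (2 * (pi * t))" by (simp add: algebra_simps)
        then show ?thesis by (simp only: cis_cnj cis_2pi mult_1 flip: cis_mult)
      qed
      also have "\<dots> = circlepath 0 1 (1 - t)" by (simp add: circlepath cis_conv_exp mult_ac)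
      finally show "((cnj \<circ> double_cis) \<circ> (\<lambda>t. abs_real_mod_pi (pi * t))) t = reversepath (circlepath 0 1) t"
        by (simp add: double_cis_abs reversepath_def)
    qed
    have "winding_number (circlepath 0 1) 0 = winding_number (reversepath (circlepath 0 1)) 0"
      using winding_number_homotopic_loops[OF 3[unfolded c r]] .
    also have "\<dots> = - winding_number (circlepath 0 1) 0"
      by (rule winding_number_reversepath) (auto simp: path_image_circlepath_nonneg)
    finally show False by (simp add: winding_number_circlepath_centre)
  qed
qed

definition unit_vec :: "nat \<Rightarrow> complex \<Rightarrow> nat \<Rightarrow> complex" where
  "unit_vec k c = (\<lambda>_. 0)(k := c)"

lemma unit_vec_complex_space: "k < n \<Longrightarrow> unit_vec k c \<in> complex_space n"
  by (simp add: complex_space_def unit_vec_def)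

lemma standard_form_unit_vec:
  assumes "k < n" "l < n"
  shows "standard_form n (unit_vec k c) (unit_vec l d) = (if k = l then Re c * Im d - Im c * Re d else 0)"
proof -
  have "standard_form n (unit_vec k c) (unit_vec l d) =
     (\<Sum>j<n. if j = k then (if k = l then Re c * Im d - Im c * Re d else 0) else 0)"
    unfolding standard_form_def by (intro sum.cong) (auto simp: unit_vec_def)
  then show ?thesis using assms by simp
qed

context symplectic begin

text \<open>
  The basis selected in the definition of the phase differs from \<open>e\<close> by a real factor.
\<close>

lemma phase_frame:
  assumes "\<Omega> \<in> U_set n \<omega>" "frame e f"
  shows "phase n \<Omega> (span (e ` {..<n})) = arg_class (\<Omega> e)"
proof -
  define v where "v = (SOME v. span (v ` {..<n}) = span (e ` {..<n}))"
  have v: "span (v ` {..<n}) = span (e ` {..<n})" unfolding v_def by (rule someI[of _ e]) simp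
  have "v i \<in> span (e ` {..<n})" "e i \<in> span (v ` {..<n})" if "i < n" for i
    using that span_base[of "v i" "v ` {..<n}"] span_base[of "e i" "e ` {..<n}"] by (simp_all only: v) auto
  then obtain c d :: real where c: "\<Omega> v = c *\<^sub>R \<Omega> e" and d: "\<Omega> e = d *\<^sub>R \<Omega> v"
    using alt_form_change_of_basis[of n v e] alt_form_change_of_basis[of n e v] U_alt_form[OF assms(1)] by meson
  have "\<Omega> e \<noteq> 0" by (rule U_nonzero[OF assms])
  then have "c \<noteq> 0" using c d by (metis scale_zero_left scale_zero_right)
  then have "arg_class (\<Omega> v) = arg_class (\<Omega> e)"
    using arg_class_scale[of c "\<Omega> e"] c \<open>\<Omega> e \<noteq> 0\<close> by (simp add: scaleR_conv_of_real)
  then show ?thesis by (simp add: phase_def v_def arg_class_def)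
qed

text \<open>
  The coordinates of a symplectic basis, as a map from \<open>\<complex>\<^sup>n\<close>. Every linear symplectomorphism has this
  form, which translates them into frames.
\<close>

definition frame_map :: "(nat \<Rightarrow> 'a) \<Rightarrow> (nat \<Rightarrow> 'a) \<Rightarrow> (nat \<Rightarrow> complex) \<Rightarrow> 'a" where
  "frame_map e f z = (\<Sum>k<n. Re (z k) *\<^sub>R e k + Im (z k) *\<^sub>R f k)"

lemma frame_map_linear: "frame_map e f (\<lambda>k. of_real a * z k + of_real b * w k) =
    a *\<^sub>R frame_map e f z + b *\<^sub>R frame_map e f w"
  by (simp add: frame_map_def scaleR_right.sum scaleR_add_right scaleR_add_left sum.distrib)

lemma form_frame_map_left:
  assumes "frame e f" "k < n"
  shows "\<omega> (frame_map e f z) (f k) = Re (z k)" "\<omega> (frame_map e f z) (e k) = - Im (z k)"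
  using assms by (simp_all add: frame_map_def hyperbolicD sum.distrib sum_negf if_distrib cong: if_cong)

lemma frame_map_symplectomorphism:
  assumes fr: "frame e f"
  shows "linear_symplectomorphism n \<omega> (frame_map e f)"
  unfolding linear_symplectomorphism_def
proof (intro conjI ballI allI)
  show "bij_betw (frame_map e f) (complex_space n) UNIV"
  proof (rule bij_betwI'; clarsimp?)
    fix z w assume z: "z \<in> complex_space n" and w: "w \<in> complex_space n"
    show "frame_map e f z = frame_map e f w \<longleftrightarrow> z = w"
    proof
      assume eq: "frame_map e f z = frame_map e f w"
      have "z k = w k" for k
        using form_frame_map_left[OF fr, of k z] form_frame_map_left[OF fr, of k w] eq z w
        by (cases "k < n") (auto simp: complex_eq_iff complex_space_def not_less)
      then show "z = w" by blast
    qed simp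
  next
    fix x
    have "x = frame_map e f (\<lambda>k. if k < n then Complex (\<omega> x (f k)) (- \<omega> x (e k)) else 0)"
      unfolding frame_map_def by (subst frame_expansion[OF fr, of x]) (intro sum.cong, auto)
    then show "\<exists>z\<in>complex_space n. x = frame_map e f z"
      by (intro bexI[of _ "\<lambda>k. if k < n then Complex (\<omega> x (f k)) (- \<omega> x (e k)) else 0"])
         (auto simp: complex_space_def)
  qed
  show "frame_map e f (\<lambda>k. of_real a * z k + of_real b * w k) =
    a *\<^sub>R frame_map e f z + b *\<^sub>R frame_map e f w" for a b z w by (rule frame_map_linear)
  show "\<omega> (frame_map e f z) (frame_map e f w) = standard_form n z w" for z w
  proof -
    have "\<omega> (frame_map e f z) (frame_map e f w) =
       (\<Sum>k<n. Re (w k) * \<omega> (frame_map e f z) (e k) + Im (w k) * \<omega> (frame_map e f z) (f k))"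
      by (subst (2) frame_map_def) simp
    also have "\<dots> = standard_form n z w" unfolding standard_form_def
      by (intro sum.cong) (simp_all add: form_frame_map_left[OF fr])
    finally show ?thesis .
  qed
qed

lemma symplectomorphism_frame:
  assumes T: "linear_symplectomorphism n \<omega> T"
  defines "e \<equiv> \<lambda>k. T (unit_vec k 1)" and "f \<equiv> \<lambda>k. T (unit_vec k \<i>)"
  shows "frame e f" "\<And>z. z \<in> complex_space n \<Longrightarrow> T z = frame_map e f z"
proof -
  show "frame e f" unfolding hyperbolic_def e_def f_def
    using T by (auto simp: linear_symplectomorphism_def unit_vec_complex_space standard_form_unit_vec)
  have lin: "T (\<lambda>k. of_real a * z k + of_real b * w k) = a *\<^sub>R T z + b *\<^sub>R T w"
    if "z \<in> complex_space n" "w \<in> complex_space n" for z w a b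
    using T that by (simp add: linear_symplectomorphism_def)
  have T0: "T (\<lambda>_. 0) = 0" using lin[of "\<lambda>_. 0" "\<lambda>_. 0" 0 0] by (simp add: complex_space_def)
  fix z assume z: "z \<in> complex_space n"
  have "m \<le> n \<Longrightarrow> T (\<lambda>k. if k < m then z k else 0) = (\<Sum>k<m. Re (z k) *\<^sub>R e k + Im (z k) *\<^sub>R f k)" for m
  proof (induction m)
    case 0 then show ?case using T0 by simp
  next
    case (Suc m)
    have u: "unit_vec m (z m) = (\<lambda>k. of_real (Re (z m)) * unit_vec m 1 k + of_real (Im (z m)) * unit_vec m \<i> k)"
      by (auto simp: unit_vec_def complex_eq_iff)
    have Tu: "T (unit_vec m (z m)) = Re (z m) *\<^sub>R e m + Im (z m) *\<^sub>R f m"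
      unfolding e_def f_def by (subst u, rule lin) (use Suc.prems in \<open>auto intro: unit_vec_complex_space\<close>)
    have "(\<lambda>k. if k < Suc m then z k else 0) =
      (\<lambda>k. of_real 1 * (if k < m then z k else 0) + of_real 1 * unit_vec m (z m) k)"
      by (auto simp: unit_vec_def less_Suc_eq)
    then have "T (\<lambda>k. if k < Suc m then z k else 0) =
       1 *\<^sub>R T (\<lambda>k. if k < m then z k else 0) + 1 *\<^sub>R T (unit_vec m (z m))"
      using Suc.prems by (simp only:) (rule lin, auto simp: complex_space_def unit_vec_def)
    then show ?case using Suc Tu by simp
  qed
  from this[of n] have "T (\<lambda>k. if k < n then z k else 0) = frame_map e f z" by (simp add: frame_map_def)
  moreover have "(\<lambda>k. if k < n then z k else 0) = z" using z by (auto simp: complex_space_def not_less)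
  ultimately show "T z = frame_map e f z" by simp
qed

lemma frame_map_standard_lagrangian:
  assumes fr: "frame e f"
  shows "frame_map e f ` standard_lagrangian n \<theta> =
     span ((e(0 := cos \<theta> *\<^sub>R e 0 + sin \<theta> *\<^sub>R f 0)) ` {..<n})" (is "_ = span (?e ` _)")
proof (intro equalityI)
  show "frame_map e f ` standard_lagrangian n \<theta> \<subseteq> span (?e ` {..<n})"
  proof safe
    fix z assume z: "z \<in> standard_lagrangian n \<theta>"
    then obtain t where t: "z 0 = cis \<theta> * of_real t" by (auto simp: standard_lagrangian_def)
    have "Re (z k) *\<^sub>R e k + Im (z k) *\<^sub>R f k = (if k = 0 then t else Re (z k)) *\<^sub>R ?e k" for k
      using z t by (cases "k = 0") (auto simp: standard_lagrangian_def complex_is_Real_iff algebra_simps)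
    moreover have "?e k \<in> span (?e ` {..<n})" if "k < n" for k using that by (intro span_base imageI) simp
    ultimately show "frame_map e f z \<in> span (?e ` {..<n})"
      unfolding frame_map_def by (simp only:) (intro span_sum span_scale, simp del: fun_upd_apply)
  qed
  have "subspace (frame_map e f ` standard_lagrangian n \<theta>)"
  proof (rule subspaceI)
    have "frame_map e f (\<lambda>_. 0) = 0" by (simp add: frame_map_def)
    moreover have "(\<lambda>_. 0) \<in> standard_lagrangian n \<theta>"
      by (auto simp: standard_lagrangian_def complex_space_def intro: image_eqI[of _ _ 0])
    ultimately show "0 \<in> frame_map e f ` standard_lagrangian n \<theta>" by (metis imageI)
  next
    have comb: "(\<lambda>k. of_real a * z k + of_real b * w k) \<in> standard_lagrangian n \<theta>"
      if zw: "z \<in> standard_lagrangian n \<theta>" "w \<in> standard_lagrangian n \<theta>" for z w and a b :: real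
    proof -
      obtain t where "z 0 = cis \<theta> * of_real t"
        using zw(1) unfolding standard_lagrangian_def by blast
      moreover obtain s where "w 0 = cis \<theta> * of_real s"
        using zw(2) unfolding standard_lagrangian_def by blast
      ultimately have "of_real a * z 0 + of_real b * w 0 = cis \<theta> * of_real (a * t + b * s)"
        by (simp add: algebra_simps)
      then have "of_real a * z 0 + of_real b * w 0 \<in> range (\<lambda>t. cis \<theta> * complex_of_real t)"
        by (rule range_eqI)
      then show ?thesis using zw unfolding standard_lagrangian_def complex_space_def
        by (simp add: Reals_add Reals_mult)
    qed
    show "x + y \<in> frame_map e f ` standard_lagrangian n \<theta>"
      if "x \<in> frame_map e f ` standard_lagrangian n \<theta>" "y \<in> frame_map e f ` standard_lagrangian n \<theta>" for x y
    proof -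
      obtain z w where "z \<in> standard_lagrangian n \<theta>" "w \<in> standard_lagrangian n \<theta>"
        "x = frame_map e f z" "y = frame_map e f w" using \<open>x \<in> _\<close> \<open>y \<in> _\<close> by blast
      then show ?thesis using comb[of z w 1 1] frame_map_linear[of e f 1 z 1 w]
        by (intro image_eqI[of _ _ "\<lambda>k. z k + w k"]) auto
    qed
    show "a *\<^sub>R x \<in> frame_map e f ` standard_lagrangian n \<theta>"
      if "x \<in> frame_map e f ` standard_lagrangian n \<theta>" for x a
    proof -
      obtain z where "z \<in> standard_lagrangian n \<theta>" "x = frame_map e f z" using \<open>x \<in> _\<close> by blast
      then show ?thesis using comb[of z z a 0] frame_map_linear[of e f a z 0 z]
        by (intro image_eqI[of _ _ "\<lambda>k. of_real a * z k"]) auto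
    qed
  qed
  moreover have "?e ` {..<n} \<subseteq> frame_map e f ` standard_lagrangian n \<theta>"
  proof safe
    fix k assume k: "k < n"
    define z where "z = unit_vec k (if k = 0 then cis \<theta> else 1)"
    have "frame_map e f z = (\<Sum>j<n. if j = k then ?e k else 0)"
      unfolding frame_map_def by (intro sum.cong) (auto simp: z_def unit_vec_def)
    then have "?e k = frame_map e f z" using k by simp
    moreover have "z \<in> standard_lagrangian n \<theta>"
      using k by (auto simp: standard_lagrangian_def z_def unit_vec_def complex_space_def
          intro: image_eqI[of _ _ 0] image_eqI[of _ _ 1])
    ultimately show "?e k \<in> frame_map e f ` standard_lagrangian n \<theta>" by blast
  qed
  ultimately show "span (?e ` {..<n}) \<subseteq> frame_map e f ` standard_lagrangian n \<theta>"
    by (intro span_minimal)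
qed

lemma phase_loop:
  assumes U: "\<Omega> \<in> U_set n \<omega>" and fr: "frame e f"
  shows "phase n \<Omega> (frame_map e f ` standard_lagrangian n (pi * t)) = plane_loop (\<Omega> e) (\<Omega> (e(0 := f 0))) t"
  unfolding frame_map_standard_lagrangian[OF fr] plane_loop_def
    alt_form_rotate[OF U_alt_form[OF U] n_pos, symmetric]
  by (rule phase_frame[OF U frame_rotate[OF fr n_pos]])

text \<open>
  Inside \<open>U_set\<close>, the topological condition is a single strict inequality, and any frame may be used
  to test it.
\<close>

theorem U_plus_iff:
  assumes fr: "frame e f"
  shows "\<Omega> \<in> U_plus n \<omega> \<longleftrightarrow> \<Omega> \<in> U_set n \<omega> \<and> orientation \<Omega> 0 e f > 0"
proof -
  have iff: "homotopic_loops UNIV (\<lambda>t. phase n \<Omega> (frame_map e f ` standard_lagrangian n (pi * t)))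
      (\<lambda>t. abs_real_mod_pi (pi * t)) \<longleftrightarrow> orientation \<Omega> 0 e f > 0"
    if "\<Omega> \<in> U_set n \<omega>" "frame e f" for e f
    unfolding phase_loop[OF that] orientation_def
    by (rule plane_loop_homotopic_iff) (use orientation_nonzero[OF that n_pos] in \<open>simp add: orientation_def\<close>)
  show ?thesis
  proof safe
    assume "\<Omega> \<in> U_plus n \<omega>"
    then obtain T where U: "\<Omega> \<in> U_set n \<omega>" and T: "linear_symplectomorphism n \<omega> T"
      and hom: "homotopic_loops UNIV (\<lambda>t. phase n \<Omega> (T ` standard_lagrangian n (pi * t)))
                             (\<lambda>t. abs_real_mod_pi (pi * t))"
      by (auto simp: U_plus_def)
    define e1 where "e1 k = T (unit_vec k 1)" for k
    define f1 where "f1 k = T (unit_vec k \<i>)" for k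
    have fr1: "frame e1 f1" and T1: "\<And>z. z \<in> complex_space n \<Longrightarrow> T z = frame_map e1 f1 z"
      using symplectomorphism_frame[OF T] by (simp_all add: e1_def[abs_def] f1_def[abs_def])
    have "T ` standard_lagrangian n \<theta> = frame_map e1 f1 ` standard_lagrangian n \<theta>" for \<theta>
      by (rule image_cong) (auto simp: standard_lagrangian_def T1)
    then have "orientation \<Omega> 0 e1 f1 > 0" using hom iff[OF U fr1] by simp
    then show "orientation \<Omega> 0 e f > 0" by (rule orientation_independent[OF U n_pos fr1 fr])
    show "\<Omega> \<in> U_set n \<omega>" by fact
  next
    assume U: "\<Omega> \<in> U_set n \<omega>" and "orientation \<Omega> 0 e f > 0"
    then show "\<Omega> \<in> U_plus n \<omega>"
      using iff[OF U fr] frame_map_symplectomorphism[OF fr] by (auto simp: U_plus_def)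
  qed
qed

end

section \<open>Unitary frames and singular values\<close>


text \<open>
  The Cauchy-Schwarz argument for a semidefinite form: a null vector lies in its kernel, as otherwise
  the form would be negative at \<open>x + s y\<close> for some small \<open>s\<close>.
\<close>

lemma quadratic_form_kernel:
  fixes B :: "'a::real_vector \<Rightarrow> 'a \<Rightarrow> real"
  assumes lin: "\<And>x. linear (B x)" and sym: "\<And>x y. B x y = B y x" and S: "subspace S"
    and nonneg: "\<And>y. y \<in> S \<Longrightarrow> B y y \<ge> 0" and x: "x \<in> S" "B x x = 0" and y: "y \<in> S"
  shows "B x y = 0"
proof (rule ccontr)
  assume ne: "B x y \<noteq> 0"
  have *: "2 * s * B x y + s^2 * B y y \<ge> 0" for s
  proof -
    have "B (x + s *\<^sub>R y) (x + s *\<^sub>R y) = B x x + 2 * s * B x y + s^2 * B y y"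
      using sym[of "x + s *\<^sub>R y"] sym[of y x]
      by (simp add: linear_add[OF lin] linear_scale[OF lin] power2_eq_square algebra_simps)
    moreover have "x + s *\<^sub>R y \<in> S" using S x y by (simp add: subspace_add subspace_scale)
    ultimately show ?thesis using nonneg[of "x + s *\<^sub>R y"] x by simp
  qed
  define c where "c = B y y"
  have c: "c \<ge> 0" using nonneg y by (simp add: c_def)
  \<comment> \<open>The value at \<open>s = - B x y / (c + 1)\<close>; adding 1 avoids a division by zero.\<close>
  have "2 * (- B x y / (c + 1)) * B x y + (- B x y / (c + 1))^2 * c = - ((B x y)^2 * (c + 2) / (c + 1)^2)"
  proof -
    have "c + 1 \<noteq> 0" using c by simp
    then show ?thesis by (simp add: divide_simps power2_eq_square) (simp add: algebra_simps)
  qed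
  moreover have "(B x y)^2 * (c + 2) / (c + 1)^2 > 0" using ne c by simp
  ultimately show False using *[of "- B x y / (c + 1)"] unfolding c_def by simp
qed

text \<open>
  A reference frame \<open>p\<close>, \<open>q\<close> defines a compatible complex structure \<open>J\<close> with \<open>J (p k) = q k\<close> and the
  inner product \<open>G\<close> for which the frame is orthonormal.
\<close>

locale polarized = symplectic +
  fixes p q :: "nat \<Rightarrow> 'a"
  assumes ref: "frame p q"
begin

definition J :: "'a \<Rightarrow> 'a" where
  "J x = (\<Sum>k<n. \<omega> x (q k) *\<^sub>R q k + \<omega> x (p k) *\<^sub>R p k)"

definition G :: "'a \<Rightarrow> 'a \<Rightarrow> real" where
  "G x y = \<omega> x (J y)"

lemma linear_J: "linear J"
  by (rule linearI) (simp_all add: J_def scaleR_add_left sum.distrib scaleR_right.sum scaleR_add_right)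

lemmas J_simps [simp] = linear_add[OF linear_J] linear_diff[OF linear_J] linear_neg[OF linear_J]
  linear_0[OF linear_J] linear_scale[OF linear_J] linear_sum[OF linear_J]

lemma J_ref: "k < n \<Longrightarrow> J (p k) = q k" "k < n \<Longrightarrow> J (q k) = - p k"
  by (simp_all add: J_def hyperbolicD[OF ref] if_distrib[of "\<lambda>c. c *\<^sub>R _"] sum_negf cong: if_cong)

lemma J_J [simp]: "J (J x) = - x"
proof -
  have "J (J x) = (\<Sum>k<n. \<omega> x (q k) *\<^sub>R J (q k) + \<omega> x (p k) *\<^sub>R J (p k))"
    by (subst (2) J_def) simp
  also have "\<dots> = (\<Sum>k<n. - (\<omega> x (q k) *\<^sub>R p k - \<omega> x (p k) *\<^sub>R q k))"
    by (intro sum.cong) (simp_all add: J_ref)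
  also have "\<dots> = - x" unfolding sum_negf by (simp flip: frame_expansion[OF ref])
  finally show ?thesis .
qed

lemma G_expand: "G x y = (\<Sum>k<n. \<omega> x (q k) * \<omega> y (q k) + \<omega> x (p k) * \<omega> y (p k))"
  by (simp add: G_def J_def mult.commute)

lemma G_sym: "G x y = G y x"
  by (simp add: G_expand mult.commute)

lemma form_J_left: "\<omega> (J x) y = - \<omega> x (J y)"
  using form_skew[of "J x" y] G_sym[of x y] by (simp add: G_def)

lemma form_J_J [simp]: "\<omega> (J x) (J y) = \<omega> x y"
  by (simp add: form_J_left)

lemma G_J_left: "G (J x) y = \<omega> x y"
  by (simp add: G_def)

lemma linear_G_right: "linear (\<lambda>y. G x y)"
  unfolding G_def using linear_compose[OF linear_J linear_right] by (simp add: o_def)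

lemma linear_G_left: "linear (\<lambda>x. G x y)"
  unfolding G_def by (rule linear_left)

lemmas G_simps [simp] =
  linear_add[OF linear_G_left] linear_add[OF linear_G_right]
  linear_diff[OF linear_G_left] linear_diff[OF linear_G_right]
  linear_0[OF linear_G_left] linear_0[OF linear_G_right]
  linear_scale[OF linear_G_left] linear_scale[OF linear_G_right]
  linear_sum[OF linear_G_left] linear_sum[OF linear_G_right]

lemma G_nonneg: "G x x \<ge> 0"
  by (simp add: G_expand sum_nonneg)

lemma G_eq_0: "G x x = 0 \<longleftrightarrow> x = 0"
proof
  assume "G x x = 0"
  then have "\<forall>k\<in>{..<n}. \<omega> x (q k) * \<omega> x (q k) + \<omega> x (p k) * \<omega> x (p k) = 0"
    unfolding G_expand by (subst (asm) sum_nonneg_eq_0_iff) auto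
  then have "\<omega> x (q k) = 0 \<and> \<omega> x (p k) = 0" if "k < n" for k
    using that by (metis lessThan_iff sum_squares_eq_zero_iff)
  then show "x = 0" by (subst frame_expansion[OF ref]) simp
qed simp

lemma G_pos: "x \<noteq> 0 \<Longrightarrow> G x x > 0"
  using G_nonneg[of x] G_eq_0[of x] by linarith

lemma continuous_G: "continuous_on S f \<Longrightarrow> continuous_on S g \<Longrightarrow> continuous_on S (\<lambda>z. G (f z) (g z))"
  unfolding G_expand by (intro continuous_intros continuous_form)

text \<open>
  Compares the norm of the type with the norm of \<open>G\<close>.
\<close>

definition norm_bound :: real where "norm_bound = (\<Sum>k<n. norm (p k) + norm (q k))"

lemma norm_le_G: "norm x \<le> norm_bound * sqrt (G x x)"
proof -
  have c: "\<bar>\<omega> x (q k)\<bar> \<le> sqrt (G x x)" "\<bar>\<omega> x (p k)\<bar> \<le> sqrt (G x x)" if "k < n" for k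
  proof -
    have "\<omega> x (q k) * \<omega> x (q k) + \<omega> x (p k) * \<omega> x (p k) \<le> G x x"
      unfolding G_expand using that by (intro member_le_sum) auto
    then have "(\<omega> x (q k))^2 \<le> G x x" "(\<omega> x (p k))^2 \<le> G x x"
      by (simp_all add: power2_eq_square) (metis add.commute add_increasing2 dual_order.trans zero_le_square le_add_same_cancel1 order_refl)+
    then show "\<bar>\<omega> x (q k)\<bar> \<le> sqrt (G x x)" "\<bar>\<omega> x (p k)\<bar> \<le> sqrt (G x x)"
      by (simp_all add: real_le_rsqrt)
  qed
  have "norm x = norm (\<Sum>k<n. \<omega> x (q k) *\<^sub>R p k - \<omega> x (p k) *\<^sub>R q k)"
    using frame_expansion[OF ref, of x] by simp
  also have "\<dots> \<le> (\<Sum>k<n. norm (\<omega> x (q k) *\<^sub>R p k - \<omega> x (p k) *\<^sub>R q k))" by (rule norm_sum)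
  also have "\<dots> \<le> (\<Sum>k<n. (norm (p k) + norm (q k)) * sqrt (G x x))"
  proof (rule sum_mono)
    fix k assume "k \<in> {..<n}"
    then have "norm (\<omega> x (q k) *\<^sub>R p k) + norm (\<omega> x (p k) *\<^sub>R q k) \<le> sqrt (G x x) * norm (p k) + sqrt (G x x) * norm (q k)"
      using c by (simp add: add_mono mult_right_mono)
    then show "norm (\<omega> x (q k) *\<^sub>R p k - \<omega> x (p k) *\<^sub>R q k) \<le> (norm (p k) + norm (q k)) * sqrt (G x x)"
      using norm_triangle_ineq4[of "\<omega> x (q k) *\<^sub>R p k" "\<omega> x (p k) *\<^sub>R q k"] by (simp add: algebra_simps)
  qed
  also have "\<dots> = norm_bound * sqrt (G x x)" by (simp add: norm_bound_def sum_distrib_right)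
  finally show ?thesis .
qed

lemma norm_bound_nonneg: "norm_bound \<ge> 0"
  unfolding norm_bound_def by (intro sum_nonneg) auto

lemma compact_G_sphere: "compact {x. G x x = 1}"
proof -
  have "{x. G x x = 1} \<subseteq> cball 0 norm_bound"
    using norm_le_G by (auto simp: dist_norm) (metis mult.right_neutral real_sqrt_one)
  then have "bounded {x. G x x = 1}" using bounded_cball bounded_subset by blast
  moreover have "closed {x. G x x = 1}"
    by (intro closed_Collect_eq continuous_G continuous_intros)
  ultimately show ?thesis by (simp add: compact_eq_bounded_closed)
qed

text \<open>
  Orthonormal and isotropic, that is, orthonormal for the Hermitian form belonging to \<open>J\<close>. For
  \<open>m = n\<close> these are the orthonormal bases of Lagrangian subspaces.
\<close>

definition unitary :: "nat \<Rightarrow> (nat \<Rightarrow> 'a) \<Rightarrow> bool" where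
  "unitary m v \<longleftrightarrow> (\<forall>i<m. \<forall>j<m. \<omega> (v i) (v j) = 0 \<and> G (v i) (v j) = (if i = j then 1 else 0))"

lemma unitary_hyperbolic: "unitary m v \<Longrightarrow> hyperbolic m v (\<lambda>i. J (v i))"
  by (auto simp: unitary_def hyperbolic_def G_def)

lemma unitary_frame: "unitary n v \<Longrightarrow> frame v (\<lambda>i. J (v i))"
  by (rule unitary_hyperbolic)

lemma unitary_ref: "unitary n p"
  by (auto simp: unitary_def G_def J_ref hyperbolicD[OF ref])

text \<open>
  Gram-Schmidt orthogonalization inside the subspace.
\<close>

lemma lagrangian_unitary_basis:
  assumes L: "L \<in> lagrangian_grassmannian n \<omega>"
  shows "\<exists>v. unitary n v \<and> span (v ` {..<n}) = L"
proof -
  have subL: "subspace L" and dimL: "dim L = n" and iso: "\<And>x y. x \<in> L \<Longrightarrow> y \<in> L \<Longrightarrow> \<omega> x y = 0"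
    using L by (auto simp: lagrangian_grassmannian_def)
  have "m \<le> n \<Longrightarrow> \<exists>v. (\<forall>i<m. v i \<in> L) \<and> (\<forall>i<m. \<forall>j<m. G (v i) (v j) = (if i = j then 1 else 0))" for m
  proof (induction m)
    case 0 then show ?case by simp
  next
    case (Suc m)
    then obtain v where vL: "\<forall>i<m. v i \<in> L" and vG: "\<forall>i<m. \<forall>j<m. G (v i) (v j) = (if i = j then 1 else 0)" by auto
    have "\<not> L \<subseteq> span (v ` {..<m})"
    proof
      assume "L \<subseteq> span (v ` {..<m})"
      then have "dim L \<le> card (v ` {..<m})" by (intro dim_le_card) auto
      also have "\<dots> \<le> m" using card_image_le[of "{..<m}" v] by simp
      finally show False using dimL Suc.prems by simp
    qed
    then obtain y where y: "y \<in> L" "y \<notin> span (v ` {..<m})" by blast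
    define z where "z = y - (\<Sum>i<m. G y (v i) *\<^sub>R v i)"
    have zL: "z \<in> L" unfolding z_def using vL y by (intro subspace_diff subspace_sum subspace_scale subL) auto
    have "(\<Sum>i<m. G y (v i) *\<^sub>R v i) \<in> span (v ` {..<m})" by (intro span_sum span_scale span_base) auto
    then have "z \<noteq> 0" using y by (auto simp: z_def)
    then have Gz: "G z z > 0" by (rule G_pos)
    have orth: "G z (v j) = 0" if "j < m" for j
    proof -
      have "(\<Sum>i<m. G y (v i) * G (v i) (v j)) = (\<Sum>i<m. if i = j then G y (v j) else 0)"
        using that vG by (intro sum.cong) auto
      then show ?thesis using that by (simp add: z_def)
    qed
    define x where "x = (1 / sqrt (G z z)) *\<^sub>R z"
    have "G x x = 1" "\<And>j. j < m \<Longrightarrow> G x (v j) = 0" "x \<in> L"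
      using Gz orth zL subL by (auto simp: x_def subspace_scale)
    moreover have "G (v j) x = G x (v j)" for j by (rule G_sym)
    ultimately show ?case using vL vG
      by (intro exI[of _ "v(m := x)"]) (auto simp: less_Suc_eq)
  qed
  then obtain v where vL: "\<forall>i<n. v i \<in> L" and vG: "\<forall>i<n. \<forall>j<n. G (v i) (v j) = (if i = j then 1 else 0)" by blast
  have un: "unitary n v" using vL vG iso by (auto simp: unitary_def)
  note fr = unitary_frame[OF un]
  have "v ` {..<n} \<subseteq> L" using vL by auto
  moreover have "L \<subseteq> span (v ` {..<n})"
    using calculation frame_independent[OF fr] frame_basis(3)[OF fr] dimL
    by (intro card_ge_dim_independent) (auto simp: card_image)
  ultimately have "span (v ` {..<n}) = L" using subL by (metis span_minimal subset_antisym)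
  then show ?thesis using un by blast
qed

text \<open>
  The irrelevant entries are set to zero in order to obtain a compact set.
\<close>

definition unitary_frames :: "(nat \<Rightarrow> 'a) set" where
  "unitary_frames = {v. unitary n v \<and> (\<forall>i\<ge>n. v i = 0)}"

lemma unitary_cong: "unitary n v \<Longrightarrow> (\<And>i. i < n \<Longrightarrow> v i = w i) \<Longrightarrow> unitary n w"
  by (simp add: unitary_def)

lemma compact_unitary_frames: "compact unitary_frames"
proof -
  have "compactin (product_topology (\<lambda>_. euclidean) UNIV) (PiE UNIV (\<lambda>_::nat. cball (0::'a) norm_bound))"
    by (simp add: compactin_PiE)
  then have "compact (PiE UNIV (\<lambda>_::nat. cball (0::'a) norm_bound))"
    by (simp add: euclidean_product_topology)
  moreover have "closed unitary_frames"
    unfolding unitary_frames_def unitary_def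
    by (intro closed_Collect_conj closed_Collect_all closed_Collect_imp closed_Collect_eq open_Collect_const
        continuous_G continuous_form continuous_intros continuous_on_product_coordinates)
  moreover have "unitary_frames \<subseteq> PiE UNIV (\<lambda>_::nat. cball (0::'a) norm_bound)"
  proof
    fix v assume v: "v \<in> unitary_frames"
    have "norm (v i) \<le> norm_bound" for i
    proof (cases "i < n")
      case True
      then have "G (v i) (v i) = 1" using v by (auto simp: unitary_frames_def unitary_def)
      then show ?thesis using norm_le_G[of "v i"] by simp
    next
      case False
      then have "v i = 0" using v by (auto simp: unitary_frames_def)
      then show ?thesis using norm_bound_nonneg by simp
    qed
    then show "v \<in> PiE UNIV (\<lambda>_::nat. cball (0::'a) norm_bound)" by (auto simp: dist_norm)
  qed
  ultimately show ?thesis using compact_Int_closed by (metis inf.absorb_iff2 inf.commute)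
qed

text \<open>
  The condition on all Lagrangian subspaces becomes one on a compact set of tuples.
\<close>

theorem U_set_iff:
  "\<Omega> \<in> U_set n \<omega> \<longleftrightarrow> \<Omega> \<in> complex_primitive_forms n \<omega> \<and> (\<forall>v\<in>unitary_frames. \<Omega> v \<noteq> 0)"
proof safe
  assume U: "\<Omega> \<in> U_set n \<omega>"
  then show "\<Omega> \<in> complex_primitive_forms n \<omega>" by (simp add: U_set_def)
  fix v assume "v \<in> unitary_frames" "\<Omega> v = 0"
  then show False using U_nonzero[OF U unitary_frame] by (auto simp: unitary_frames_def)
next
  assume W: "\<Omega> \<in> complex_primitive_forms n \<omega>" and nz: "\<forall>v\<in>unitary_frames. \<Omega> v \<noteq> 0"
  have alt: "alt_form n \<Omega>" using W by (simp add: complex_primitive_forms_iff)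
  have "\<exists>v. (\<forall>i. v i \<in> L) \<and> \<Omega> v \<noteq> 0" if L: "L \<in> lagrangian_grassmannian n \<omega>" for L
  proof -
    obtain v where v: "unitary n v" "span (v ` {..<n}) = L" using lagrangian_unitary_basis[OF L] by blast
    define w where "w i = (if i < n then v i else 0)" for i
    have "w \<in> unitary_frames"
      using unitary_cong[OF v(1), of w] by (auto simp: unitary_frames_def w_def)
    moreover have "w i \<in> L" for i unfolding w_def v(2)[symmetric] by (auto intro: span_base span_zero)
    ultimately show ?thesis using nz by blast
  qed
  then show "\<Omega> \<in> U_set n \<omega>" using W by (simp add: U_set_def)
qed

text \<open>
  The numbers \<open>\<mu> i\<close> are squares of singular values of \<open>g\<close>. If \<open>x\<close> is a singular vector for \<open>\<mu>\<close> then
  \<open>J x\<close> is one for \<open>1 / \<mu>\<close>, because \<open>g\<close> is symplectic. Maximizing \<open>G (g x) (g x)\<close> on the orthogonal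
  complement of the vectors already found therefore yields values at least 1, and the vectors found
  span a Lagrangian subspace on which \<open>g\<close> does not contract.
\<close>

theorem singular_value_frame:
  assumes g: "linear g" and sp: "\<And>x y. \<omega> (g x) (g y) = \<omega> x y"
  shows "\<exists>v \<mu>. unitary n v \<and> (\<forall>i<n. \<mu> i \<ge> 1 \<and> (\<forall>y. G (g (v i)) (g y) = \<mu> i * G (v i) y)) \<and>
     (\<forall>y. G (g y) (g y) \<le> \<mu> 0 * G y y)"
proof -
  have inj: "inj g"
  proof (rule linear_injective_0[THEN iffD2, OF g], intro allI impI)
    fix x assume "g x = 0"
    then have "\<omega> x y = 0" for y using sp[of x y] by simp
    then show "x = 0" by (rule form_nondegenerate)
  qed
  have surj: "surj g" by (rule linear_injective_imp_surjective[OF g inj]) simp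
  have g_pos: "G (g x) (g x) > 0" if "x \<noteq> 0" for x
    using G_pos[of "g x"] inj g that by (metis linear_injective_0)
  have dual: "G (g (J x)) (g y) = G (J x) y / \<mu>" if ev: "\<And>y. G (g x) (g y) = \<mu> * G x y" and \<mu>: "\<mu> \<noteq> 0" for x y \<mu>
  proof -
    have "J (g x) = \<mu> *\<^sub>R g (J x)"
    proof -
      have "\<omega> (J (g x) - \<mu> *\<^sub>R g (J x)) z = 0" for z
      proof -
        obtain y where y: "z = g y" using surj by (metis surjD)
        have "\<omega> (J (g x)) (g y) = - G (g x) (g y)" by (simp add: form_J_left G_def)
        moreover have "\<omega> (g (J x)) (g y) = - G x y" by (simp add: sp form_J_left G_def)
        ultimately show ?thesis by (simp add: y ev)
      qed
      then have "J (g x) - \<mu> *\<^sub>R g (J x) = 0" by (rule form_nondegenerate)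
      then show ?thesis by simp
    qed
    then have "\<mu> * G (g (J x)) (g y) = G (J (g x)) (g y)" by simp
    also have "\<dots> = G (J x) y" by (simp add: G_J_left sp)
    finally show ?thesis using \<mu> by (simp add: field_simps)
  qed
  have "m \<le> n \<Longrightarrow> \<exists>v \<mu>. unitary m v \<and> (\<forall>i<m. \<mu> i \<ge> 1 \<and> (\<forall>y. G (g (v i)) (g y) = \<mu> i * G (v i) y)) \<and>
     (0 < m \<longrightarrow> (\<forall>y. G (g y) (g y) \<le> \<mu> 0 * G y y))" for m
  proof (induction m)
    case 0 then show ?case by (simp add: unitary_def)
  next
    case (Suc m)
    then obtain v \<mu> where v: "unitary m v"
      and \<mu>: "\<And>i. i < m \<Longrightarrow> \<mu> i \<ge> 1" "\<And>i y. i < m \<Longrightarrow> G (g (v i)) (g y) = \<mu> i * G (v i) y"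
      and top: "0 < m \<longrightarrow> (\<forall>y. G (g y) (g y) \<le> \<mu> 0 * G y y)" by auto
    note hyp = unitary_hyperbolic[OF v]
    define W where "W = {x. \<forall>i<m. \<omega> x (v i) = 0 \<and> \<omega> x (J (v i)) = 0}"
    have W: "subspace W" by (auto simp: W_def subspace_def)
    define \<pi> where "\<pi> = hyp_proj m v (\<lambda>i. J (v i))"
    have \<pi>: "x - \<pi> x \<in> W" for x
      using hyp_proj_orthogonal[OF hyp] unfolding W_def \<pi>_def by blast
    obtain z where z: "z \<notin> span (v ` {..<m} \<union> (\<lambda>i. J (v i)) ` {..<m})"
      using hyperbolic_not_spanning Suc.prems by (metis Suc_le_lessD)
    define z' where "z' = z - \<pi> z"
    have z': "z' \<in> W" "z' \<noteq> 0"
      using \<pi> z hyp_proj_in_span[of m v "\<lambda>i. J (v i)" z] by (auto simp: z'_def \<pi>_def)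
    define C where "C = W \<inter> {x. G x x = 1}"
    have Cc: "compact C" unfolding C_def
      by (intro closed_Int_compact closed_subspace W compact_G_sphere)
    have "(1 / sqrt (G z' z')) *\<^sub>R z' \<in> C"
      using z' W G_pos[OF z'(2)] by (auto simp: C_def subspace_scale)
    then have Cn: "C \<noteq> {}" by blast
    have Cg: "continuous_on C (\<lambda>x. G (g x) (g x))"
      using g by (intro continuous_G linear_continuous_on linear_conv_bounded_linear[THEN iffD1])
    obtain x where x: "x \<in> C" "\<And>y. y \<in> C \<Longrightarrow> G (g y) (g y) \<le> G (g x) (g x)"
      using continuous_attains_sup[OF Cc Cn Cg] by blast
    define \<kappa> where "\<kappa> = G (g x) (g x)"
    have xW: "x \<in> W" and Gx: "G x x = 1" using x by (auto simp: C_def)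
    then have "x \<noteq> 0" by auto
    then have c0: "\<kappa> > 0" unfolding \<kappa>_def by (rule g_pos)
    have maxW: "G (g y) (g y) \<le> \<kappa> * G y y" if "y \<in> W" for y
    proof (cases "y = 0")
      case True then show ?thesis by (simp add: linear_0[OF g])
    next
      case False
      then have Gy: "G y y > 0" by (rule G_pos)
      have "(1 / sqrt (G y y)) *\<^sub>R y \<in> C" using that W Gy by (auto simp: C_def subspace_scale)
      from x(2)[OF this] show ?thesis using Gy by (simp add: linear_scale[OF g] \<kappa>_def field_simps)
    qed
    \<comment> \<open>The maximizer is a null vector of the semidefinite form \<open>\<kappa> G - g\<^sup>* G\<close> on \<open>W\<close>.\<close>
    have evW: "G (g x) (g y) = \<kappa> * G x y" if "y \<in> W" for y
    proof -
      define B where "B u w = \<kappa> * G u w - G (g u) (g w)" for u w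
      have lin: "linear (B u)" for u unfolding B_def
        by (rule linearI) (simp_all add: linear_add[OF g] linear_scale[OF g] algebra_simps)
      have sym: "B u w = B w u" for u w
        unfolding B_def using G_sym[of u w] G_sym[of "g u" "g w"] by simp
      have "B x y = 0"
      proof (rule quadratic_form_kernel[OF lin sym W _ xW _ that])
        show "B z z \<ge> 0" if "z \<in> W" for z using maxW[OF that] by (simp add: B_def)
        show "B x x = 0" by (simp add: B_def \<kappa>_def Gx)
      qed
      then show ?thesis by (simp add: B_def)
    qed
    have orth: "G x (v i) = 0" "G x (J (v i)) = 0" if "i < m" for i
      using xW that by (auto simp: W_def G_def)
    have ev0: "G (g x) (g (v i)) = 0" "G (g x) (g (J (v i))) = 0" if "i < m" for i
    proof -
      show "G (g x) (g (v i)) = 0" using \<mu>(2)[OF that, of x] orth[OF that] G_sym[of x] G_sym[of "g x"] by simp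
      have "\<mu> i \<noteq> 0" using \<mu>(1)[OF that] by auto
      from dual[OF \<mu>(2)[OF that] this, of x] show "G (g x) (g (J (v i))) = 0"
        using orth[OF that] G_sym[of x] G_sym[of "g x"] by simp
    qed
    have ev: "G (g x) (g y) = \<kappa> * G x y" for y
    proof -
      have y: "y = (y - \<pi> y) + \<pi> y" by simp
      have "G x (\<pi> y) = 0" unfolding \<pi>_def hyp_proj_def by (simp add: orth)
      moreover have "G (g x) (g (\<pi> y)) = 0"
        unfolding \<pi>_def hyp_proj_def
        by (simp add: linear_sum[OF g] linear_diff[OF g] linear_scale[OF g] ev0)
      ultimately show ?thesis using evW[OF \<pi>, of y] by (simp add: linear_diff[OF g])
    qed
    have "J x \<in> W" using xW by (auto simp: W_def form_J_left)
    have GJ: "G (J x) (J x) = 1" using Gx G_J_left[of x "J x"] unfolding G_def by simp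
    \<comment> \<open>\<open>J x\<close> competes with \<open>x\<close> for the maximum.\<close>
    have "1 / \<kappa> \<le> \<kappa>"
      using maxW[OF \<open>J x \<in> W\<close>] dual[OF ev, of "J x"] c0 GJ by simp
    then have "1 \<le> \<kappa> * \<kappa>" using c0 by (simp add: divide_le_eq)
    then have c1: "\<kappa> \<ge> 1" using c0 mult_left_le[of \<kappa> \<kappa>] by linarith
    have "unitary (Suc m) (v(m := x))"
      unfolding unitary_def
    proof (intro allI impI)
      fix i j assume ij: "i < Suc m" "j < Suc m"
      have 0: "\<omega> x (v k) = 0" "\<omega> (v k) x = 0" "G x (v k) = 0" "G (v k) x = 0" if "k < m" for k
        using xW orth[OF that] that G_sym[of x "v k"] form_skew[of "v k" x] by (simp_all add: W_def)
      consider "i = m" "j = m" | "i = m" "j < m" | "i < m" "j = m" | "i < m" "j < m"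
        using ij by linarith
      then show "\<omega> ((v(m := x)) i) ((v(m := x)) j) = 0 \<and> G ((v(m := x)) i) ((v(m := x)) j) = (if i = j then 1 else 0)"
        by cases (use 0 Gx v in \<open>simp_all add: unitary_def\<close>)
    qed
    moreover have "\<forall>i<Suc m. (\<mu>(m := \<kappa>)) i \<ge> 1 \<and> (\<forall>y. G (g ((v(m := x)) i)) (g y) = (\<mu>(m := \<kappa>)) i * G ((v(m := x)) i) y)"
      using \<mu> ev c1 by (auto simp: less_Suc_eq)
    moreover have "\<forall>y. G (g y) (g y) \<le> (\<mu>(m := \<kappa>)) 0 * G y y"
    proof (cases "m = 0")
      case True
      then show ?thesis using maxW by (simp add: W_def)
    next
      case False then show ?thesis using top by simp
    qed
    ultimately show ?case by blast
  qed
  from this[of n] show ?thesis using n_pos by auto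
qed

end

section \<open>Nonvanishing in the lower half plane\<close>


definition mix_args :: "nat set \<Rightarrow> (nat \<Rightarrow> 'a) \<Rightarrow> (nat \<Rightarrow> 'a) \<Rightarrow> nat \<Rightarrow> 'a" where
  "mix_args S v w i = (if i \<in> S then w i else v i)"

text \<open>
  The value of the complex multilinear extension of \<open>\<Omega>\<close> on the vectors \<open>v i + z i * w i\<close>, expanded into
  the choices of \<open>v i\<close> or \<open>w i\<close> in each argument.
\<close>

definition mixed :: "nat \<Rightarrow> ((nat \<Rightarrow> 'a) \<Rightarrow> complex) \<Rightarrow> (nat \<Rightarrow> complex) \<Rightarrow> (nat \<Rightarrow> 'a) \<Rightarrow> (nat \<Rightarrow> 'a) \<Rightarrow> complex" where
  "mixed n \<Omega> z v w = (\<Sum>S\<in>Pow {..<n}. (\<Prod>i\<in>S. z i) * \<Omega> (mix_args S v w))"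

lemma mixed_slot:
  assumes m: "m < n"
  shows "mixed n \<Omega> z v w = (\<Sum>S\<in>Pow ({..<n} - {m}). (\<Prod>i\<in>S. z i) * \<Omega> ((mix_args S v w)(m := v m)))
     + z m * (\<Sum>S\<in>Pow ({..<n} - {m}). (\<Prod>i\<in>S. z i) * \<Omega> ((mix_args S v w)(m := w m)))"
proof -
  let ?I = "{..<n} - {m}"
  have Pow: "Pow {..<n} = Pow ?I \<union> insert m ` Pow ?I"
    using m Pow_insert[of m ?I] by (simp add: insert_absorb)
  have "mixed n \<Omega> z v w = (\<Sum>S\<in>Pow ?I. (\<Prod>i\<in>S. z i) * \<Omega> (mix_args S v w)) +
     (\<Sum>S\<in>insert m ` Pow ?I. (\<Prod>i\<in>S. z i) * \<Omega> (mix_args S v w))"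
    unfolding mixed_def Pow by (rule sum.union_disjoint) auto
  also have "(\<Sum>S\<in>insert m ` Pow ?I. (\<Prod>i\<in>S. z i) * \<Omega> (mix_args S v w)) =
     (\<Sum>S\<in>Pow ?I. (\<Prod>i\<in>insert m S. z i) * \<Omega> (mix_args (insert m S) v w))"
    by (subst sum.reindex) (auto simp: inj_on_def)
  also have "\<dots> = (\<Sum>S\<in>Pow ?I. z m * ((\<Prod>i\<in>S. z i) * \<Omega> ((mix_args S v w)(m := w m))))"
  proof (rule sum.cong)
    fix S assume S: "S \<in> Pow ?I"
    then have "finite S" "m \<notin> S" by (auto intro: finite_subset)
    moreover have "mix_args (insert m S) v w = (mix_args S v w)(m := w m)" by (auto simp: mix_args_def)
    ultimately show "(\<Prod>i\<in>insert m S. z i) * \<Omega> (mix_args (insert m S) v w) =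
        z m * ((\<Prod>i\<in>S. z i) * \<Omega> ((mix_args S v w)(m := w m)))"
      by simp
  qed simp
  also have "(\<Sum>S\<in>Pow ?I. (\<Prod>i\<in>S. z i) * \<Omega> (mix_args S v w)) =
     (\<Sum>S\<in>Pow ?I. (\<Prod>i\<in>S. z i) * \<Omega> ((mix_args S v w)(m := v m)))"
  proof (rule sum.cong)
    fix S assume "S \<in> Pow ?I"
    then have "mix_args S v w = (mix_args S v w)(m := v m)" by (auto simp: mix_args_def fun_eq_iff)
    then show "(\<Prod>i\<in>S. z i) * \<Omega> (mix_args S v w) = (\<Prod>i\<in>S. z i) * \<Omega> ((mix_args S v w)(m := v m))" by simp
  qed simp
  finally show ?thesis by (simp only: sum_distrib_left)
qed

text \<open>
  As in \<open>mixed\<close>, but the argument of index \<open>m\<close> is the real vector \<open>x\<close>.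
\<close>

definition mixed_at :: "nat \<Rightarrow> ((nat \<Rightarrow> 'a) \<Rightarrow> complex) \<Rightarrow> (nat \<Rightarrow> complex) \<Rightarrow> (nat \<Rightarrow> 'a) \<Rightarrow> (nat \<Rightarrow> 'a) \<Rightarrow> nat \<Rightarrow> 'a \<Rightarrow> complex" where
  "mixed_at n \<Omega> z v w m x = (\<Sum>S\<in>Pow ({..<n} - {m}). (\<Prod>i\<in>S. z i) * \<Omega> ((mix_args S v w)(m := x)))"

lemma mixed_eq_mixed_at:
  "m < n \<Longrightarrow> mixed n \<Omega> z v w = mixed_at n \<Omega> z v w m (v m) + z m * mixed_at n \<Omega> z v w m (w m)"
  unfolding mixed_at_def by (rule mixed_slot)

lemma mixed_at_cong:
  assumes "\<And>i. i \<noteq> m \<Longrightarrow> z i = z' i" "\<And>i. i \<noteq> m \<Longrightarrow> v i = v' i" "\<And>i. i \<noteq> m \<Longrightarrow> w i = w' i"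
  shows "mixed_at n \<Omega> z v w m x = mixed_at n \<Omega> z' v' w' m x"
  unfolding mixed_at_def
proof (rule sum.cong[OF refl])
  fix S assume S: "S \<in> Pow ({..<n} - {m})"
  then have "(\<Prod>i\<in>S. z i) = (\<Prod>i\<in>S. z' i)" using assms(1) by (intro prod.cong) auto
  moreover have "(mix_args S v w)(m := x) = (mix_args S v' w')(m := x)"
    using assms by (auto simp: mix_args_def)
  ultimately show "(\<Prod>i\<in>S. z i) * \<Omega> ((mix_args S v w)(m := x)) = (\<Prod>i\<in>S. z' i) * \<Omega> ((mix_args S v' w')(m := x))"
    by simp
qed

lemma linear_mixed_at:
  assumes "alt_form n \<Omega>" "m < n"
  shows "linear (\<lambda>x. mixed_at n \<Omega> z v w m x)"
proof -
  have "linear (\<lambda>x. (\<Prod>i\<in>S. z i) * \<Omega> ((mix_args S v w)(m := x)))" for S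
    using alt_form_linear[OF assms, of "mix_args S v w"] by (simp add: linear_iff algebra_simps)
  then show ?thesis unfolding mixed_at_def by (intro linear_compose_sum) auto
qed

lemma mixed_upd_0: "m < n \<Longrightarrow> mixed n \<Omega> (z(m := 0)) v w = mixed_at n \<Omega> z v w m (v m)"
  by (simp add: mixed_eq_mixed_at[of m] cong: mixed_at_cong)

lemma mixed_zero: "mixed n \<Omega> (\<lambda>_. 0) v w = \<Omega> v"
proof -
  have "mixed n \<Omega> (\<lambda>_. 0) v w = (\<Sum>S\<in>Pow {..<n}. if S = {} then \<Omega> v else 0)"
    unfolding mixed_def
    by (intro sum.cong refl) (auto simp: mix_args_def[abs_def] power_0_left card_eq_0_iff intro: finite_subset)
  then show ?thesis by simp
qed

lemma mixed_cong:
  assumes "alt_form n \<Omega>" "\<And>i. i < n \<Longrightarrow> z i = z' i" "\<And>i. i < n \<Longrightarrow> v i = v' i" "\<And>i. i < n \<Longrightarrow> w i = w' i"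
  shows "mixed n \<Omega> z v w = mixed n \<Omega> z' v' w'"
  unfolding mixed_def
proof (rule sum.cong[OF refl])
  fix S assume S: "S \<in> Pow {..<n}"
  then have "(\<Prod>i\<in>S. z i) = (\<Prod>i\<in>S. z' i)" using assms(2) by (intro prod.cong) auto
  moreover have "\<Omega> (mix_args S v w) = \<Omega> (mix_args S v' w')"
    using assms by (intro alt_form_cong[OF assms(1)]) (auto simp: mix_args_def)
  ultimately show "(\<Prod>i\<in>S. z i) * \<Omega> (mix_args S v w) = (\<Prod>i\<in>S. z' i) * \<Omega> (mix_args S v' w')" by simp
qed

lemma continuous_on_mixed:
  assumes "\<And>i. i < n \<Longrightarrow> continuous_on D (\<lambda>s. z s i)" "\<And>v. continuous_on D (\<lambda>s. \<Omega> s v)"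
  shows "continuous_on D (\<lambda>s. mixed n (\<Omega> s) (z s) v w)"
  unfolding mixed_def using assms by (intro continuous_intros) auto

context symplectic begin

text \<open>
  One variable after the other is moved from 0 to a point of the closed lower half plane. As a
  function of \<open>z m\<close> the value is affine, say \<open>A + z m * B\<close>. By induction, applied to the rotated
  frames, \<open>cos \<theta> * A + sin \<theta> * B\<close> never vanishes, so \<open>Im (cnj A * B)\<close> is not zero. It remains so
  while the other variables are scaled to 0, where it is the orientation of the frame and hence
  positive. An affine function with \<open>Im (cnj A * B) > 0\<close> has its zero in the open upper half plane.
\<close>

theorem mixed_lower_half_plane_nonzero:
  assumes U: "\<Omega> \<in> U_plus n \<omega>" and fr: "frame e f" and z: "\<And>i. Im (z i) \<le> 0"
  shows "mixed n \<Omega> z e f \<noteq> 0"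
proof -
  have US: "\<Omega> \<in> U_set n \<omega>" and pos0: "orientation \<Omega> 0 e f > 0" if "frame e f" for e f
    using U_plus_iff[OF that] U by blast+
  note alt = U_alt_form[OF US[OF fr]]
  have "m \<le> n \<Longrightarrow> frame e f \<Longrightarrow> (\<And>i. Im (z i) \<le> 0) \<Longrightarrow> (\<And>i. m \<le> i \<Longrightarrow> z i = 0) \<Longrightarrow> mixed n \<Omega> z e f \<noteq> 0" for m e f z
  proof (induction m arbitrary: e f z)
    case 0
    then have "z = (\<lambda>_. 0)" by auto
    then show ?case using U_nonzero[OF US[OF 0(2)] 0(2)] by (simp add: mixed_zero)
  next
    case (Suc m)
    note fr = Suc.prems(2)
    have m: "m < n" using Suc.prems by simp
    \<comment> \<open>The parameter \<open>s\<close> scales the variables with index below \<open>m\<close>.\<close>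
    define A where "A s x = mixed_at n \<Omega> (\<lambda>i. of_real s * z i) e f m x" for s :: real and x
    have ne: "Im (cnj (A s (e m)) * A s (f m)) \<noteq> 0" if "s \<in> {0..1}" for s
    proof (rule Im_cnj_mult_nonzero)
      fix \<theta>
      define x where "x = cos \<theta> *\<^sub>R e m + sin \<theta> *\<^sub>R f m"
      define y where "y = - sin \<theta> *\<^sub>R e m + cos \<theta> *\<^sub>R f m"
      have "mixed n \<Omega> ((\<lambda>i. of_real s * z i)(m := 0)) (e(m := x)) (f(m := y)) \<noteq> 0"
      proof (rule Suc.IH)
        show "frame (e(m := x)) (f(m := y))" unfolding x_def y_def by (rule frame_rotate[OF fr m])
        show "Im (((\<lambda>i. of_real s * z i)(m := 0)) i) \<le> 0" for i
          using that Suc.prems(3)[of i] by (simp add: mult_nonneg_nonpos)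
        show "((\<lambda>i. of_real s * z i)(m := 0)) i = 0" if "m \<le> i" for i
          using that Suc.prems(4)[of i] by (cases "i = m") auto
      qed (use m in simp)
      also have "mixed n \<Omega> ((\<lambda>i. of_real s * z i)(m := 0)) (e(m := x)) (f(m := y)) = A s x"
        unfolding mixed_upd_0[OF m] A_def fun_upd_same by (rule mixed_at_cong) auto
      also have "A s x = of_real (cos \<theta>) * A s (e m) + of_real (sin \<theta>) * A s (f m)"
        unfolding A_def x_def using linear_mixed_at[OF alt m]
        by (simp add: linear_add linear_scale scaleR_conv_of_real)
      finally show "of_real (cos \<theta>) * A s (e m) + of_real (sin \<theta>) * A s (f m) \<noteq> 0" .
    qed
    have contA: "continuous_on {0..1} (\<lambda>s. A s x)" for x
      unfolding A_def mixed_at_def by (intro continuous_intros)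
    have A0: "A 0 x = \<Omega> (e(m := x))" for x
    proof -
      have "A 0 x = mixed n \<Omega> ((\<lambda>_. 0)(m := 0)) (e(m := x)) f"
        unfolding mixed_upd_0[OF m] A_def fun_upd_same by (rule mixed_at_cong) auto
      also have "(\<lambda>_. 0::complex)(m := 0) = (\<lambda>_. 0)" by auto
      finally show ?thesis by (simp only: mixed_zero)
    qed
    have "Im (cnj (A 1 (e m)) * A 1 (f m)) > 0"
    proof (rule continuous_nonzero_pos)
      show "continuous_on {0..1} (\<lambda>s. Im (cnj (A s (e m)) * A s (f m)))" by (intro continuous_intros contA)
      have "orientation \<Omega> m e f > 0" by (rule orientation_index[OF US[OF fr] m n_pos fr pos0[OF fr]])
      then show "Im (cnj (A 0 (e m)) * A 0 (f m)) > 0" by (simp add: A0 orientation_def)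
    qed (use ne in auto)
    moreover have "mixed n \<Omega> z e f = A 1 (e m) + z m * A 1 (f m)"
      by (simp add: mixed_eq_mixed_at[OF m] A_def)
    moreover have False if "a + w * b = 0" "Im w \<le> 0" "Im (cnj a * b) > 0" for a b w :: complex
    proof -
      have "a = - w * b" using that(1) by (simp add: eq_neg_iff_add_eq_0)
      then have "cnj a * b = - (cnj w * of_real ((cmod b)^2))"
        unfolding complex_norm_square by (simp add: mult_ac)
      then have "Im (cnj a * b) = Im w * (cmod b)^2" by simp
      then show False using that by (simp add: mult_nonpos_nonneg) (metis linorder_not_less mult_nonpos_nonneg zero_le_power2)
    qed
    ultimately show ?case using Suc.prems(3) by metis
  qed
  from this[of n e f "\<lambda>i. if i < n then z i else 0"] have "mixed n \<Omega> (\<lambda>i. if i < n then z i else 0) e f \<noteq> 0"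
    using fr z by auto
  moreover have "mixed n \<Omega> (\<lambda>i. if i < n then z i else 0) e f = mixed n \<Omega> z e f"
    by (rule mixed_cong[OF alt]) auto
  ultimately show ?thesis by simp
qed

end

section \<open>The flow to the holomorphic volume form\<close>


lemma sum_Pow_insert:
  assumes "finite I" "a \<notin> I"
  shows "(\<Sum>S\<in>Pow (insert a I). g S) = (\<Sum>S\<in>Pow I. g S + (g (insert a S) :: 'b::comm_monoid_add))"
proof -
  have "(\<Sum>S\<in>Pow (insert a I). g S) = (\<Sum>S\<in>Pow I. g S) + (\<Sum>S\<in>insert a ` Pow I. g S)"
    unfolding Pow_insert by (rule sum.union_disjoint) (use assms in auto)
  also have "(\<Sum>S\<in>insert a ` Pow I. g S) = (\<Sum>S\<in>Pow I. g (insert a S))"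
    by (subst sum.reindex) (use assms in \<open>auto simp: inj_on_def\<close>)
  finally show ?thesis by (simp add: sum.distrib)
qed

lemma sum_Pow_permute:
  assumes "\<sigma> permutes I"
  shows "(\<Sum>S\<in>Pow I. g (\<sigma> ` S)) = (\<Sum>S\<in>Pow I. g S)"
proof (rule sum.reindex_bij_betw)
  show "bij_betw (\<lambda>S. \<sigma> ` S) (Pow I) (Pow I)"
    using bij_betw_Pow[OF permutes_imp_bij[OF assms]] by simp
qed

lemma mix_args_permute: "inj \<sigma> \<Longrightarrow> mix_args (\<sigma> ` S) v w (\<sigma> i) = mix_args S (\<lambda>i. v (\<sigma> i)) (\<lambda>i. w (\<sigma> i)) i"
  by (auto simp: mix_args_def inj_eq)

lemma homotopic_with_canonI:
  assumes "continuous_on ({0..1::real} \<times> S) h" "h \<in> {0..1} \<times> S \<rightarrow> T"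
    and "\<And>x. x \<in> S \<Longrightarrow> h (0, x) = f x" "\<And>x. x \<in> S \<Longrightarrow> h (1, x) = g x"
  shows "homotopic_with_canon (\<lambda>_. True) S T f g"
proof -
  have "homotopic_with_canon (\<lambda>_. True) S T (\<lambda>x. h (0, x)) (\<lambda>x. h (1, x))"
    unfolding homotopic_with_def using assms(1,2) by (intro exI[of _ h]) (auto simp flip: subtopology_Times)
  then show ?thesis by (rule homotopic_with_eq) (use assms in auto)
qed

context polarized begin

text \<open>
  The pullback of the complexified form along \<open>1 + z J\<close>.
\<close>

definition shift :: "complex \<Rightarrow> ((nat \<Rightarrow> 'a) \<Rightarrow> complex) \<Rightarrow> (nat \<Rightarrow> 'a) \<Rightarrow> complex" where
  "shift z \<Omega> v = mixed n \<Omega> (\<lambda>_. z) v (\<lambda>i. J (v i))"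

lemma shift_sum: "shift z \<Omega> v = (\<Sum>S\<in>Pow {..<n}. z ^ card S * \<Omega> (mix_args S v (\<lambda>i. J (v i))))"
  by (simp add: shift_def mixed_def)

lemma shift_slot:
  assumes "m < n"
  shows "shift z \<Omega> (v(m := x)) =
    mixed_at n \<Omega> (\<lambda>_. z) v (\<lambda>i. J (v i)) m x + z * mixed_at n \<Omega> (\<lambda>_. z) v (\<lambda>i. J (v i)) m (J x)"
proof -
  have "mixed_at n \<Omega> (\<lambda>_. z) (v(m := x)) (\<lambda>i. J ((v(m := x)) i)) m y = mixed_at n \<Omega> (\<lambda>_. z) v (\<lambda>i. J (v i)) m y" for y
    by (rule mixed_at_cong) auto
  then show ?thesis by (simp add: shift_def mixed_eq_mixed_at[OF assms])
qed

text \<open>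
  A transposition of two equal arguments permutes the terms of the expansion and changes the sign of
  each.
\<close>

lemma alt_form_shift:
  assumes alt: "alt_form n \<Omega>"
  shows "alt_form n (shift z \<Omega>)"
  unfolding alt_form_def
proof (intro conjI allI impI)
  fix v w :: "nat \<Rightarrow> 'a" assume "\<forall>i<n. v i = w i"
  then show "shift z \<Omega> v = shift z \<Omega> w" unfolding shift_def by (intro mixed_cong[OF alt]) auto
next
  fix v :: "nat \<Rightarrow> 'a" and m assume m: "m < n"
  note lin = linear_mixed_at[OF alt m]
  show "linear (\<lambda>x. shift z \<Omega> (v(m := x)))"
    unfolding shift_slot[OF m] by (rule linearI) (simp_all add: linear_add[OF lin] linear_scale[OF lin] algebra_simps)
next
  fix v :: "nat \<Rightarrow> 'a" and i j assume ij: "i < n" "j < n" "i \<noteq> j \<and> v i = v j"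
  define \<tau> where "\<tau> = Transposition.transpose i j"
  have \<tau>: "\<tau> permutes {..<n}" using ij by (simp add: \<tau>_def permutes_swap_id)
  have vt: "(\<lambda>k. v (\<tau> k)) = v" using ij by (auto simp: \<tau>_def Transposition.transpose_def)
  have "shift z \<Omega> v = (\<Sum>S\<in>Pow {..<n}. z ^ card (\<tau> ` S) * \<Omega> (mix_args (\<tau> ` S) v (\<lambda>i. J (v i))))"
    unfolding shift_sum by (rule sum_Pow_permute[OF \<tau>, symmetric])
  also have "\<dots> = (\<Sum>S\<in>Pow {..<n}. z ^ card S * - \<Omega> (mix_args S v (\<lambda>i. J (v i))))"
  proof (rule sum.cong[OF refl])
    fix S :: "nat set"
    have inj: "inj \<tau>" using \<tau> by (rule permutes_inj)
    let ?u = "mix_args (\<tau> ` S) v (\<lambda>i. J (v i))"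
    have "\<Omega> (\<lambda>k. ?u (\<tau> k)) = real_of_int (sign \<tau>) *\<^sub>R \<Omega> ?u" by (rule alt_form_permute[OF alt \<tau>])
    moreover have "sign \<tau> = -1" using ij by (simp add: \<tau>_def sign_swap_id)
    moreover have "(\<lambda>k. ?u (\<tau> k)) = mix_args S (\<lambda>k. v (\<tau> k)) (\<lambda>k. J (v (\<tau> k)))"
      by (rule ext) (rule mix_args_permute[OF inj])
    moreover have "mix_args S (\<lambda>k. v (\<tau> k)) (\<lambda>k. J (v (\<tau> k))) = mix_args S v (\<lambda>k. J (v k))"
      using vt by metis
    ultimately have "\<Omega> ?u = - \<Omega> (mix_args S v (\<lambda>k. J (v k)))" by simp
    moreover have "card (\<tau> ` S) = card S" using inj by (intro card_image) (auto simp: inj_on_def inj_def)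
    ultimately show "z ^ card (\<tau> ` S) * \<Omega> ?u = z ^ card S * - \<Omega> (mix_args S v (\<lambda>i. J (v i)))" by simp
  qed
  also have "\<dots> = - shift z \<Omega> v" by (simp add: shift_sum sum_negf)
  finally show "shift z \<Omega> v = 0" by simp
qed

text \<open>
  The map \<open>1 + z J\<close> multiplies the complexified \<open>\<omega>\<close> by \<open>1 + z\<^sup>2\<close>, and pullback commutes with the wedge
  product. In the expansion, the subsets of \<open>{..<n+2}\<close> are moved by the permutations, and are then
  split by their intersection with the last two indices, which belong to \<open>\<omega>\<close>.
\<close>

lemma wedge2_shift:
  assumes alt: "alt_form n \<Omega>"
  shows "(1 + z^2) * wedge2 n \<omega> (shift z \<Omega>) v =
     (\<Sum>S\<in>Pow {..<n+2}. z ^ card S * wedge2 n \<omega> \<Omega> (mix_args S v (\<lambda>i. J (v i))))"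
proof -
  define X where "X u S = z ^ card S * \<Omega> (mix_args S u (\<lambda>i. J (u i))) *
     of_real (\<omega> (mix_args S u (\<lambda>i. J (u i)) n) (mix_args S u (\<lambda>i. J (u i)) (n+1)))" for u S
  have X: "(\<Sum>S\<in>Pow {..<n+2}. X u S) = (1 + z^2) * shift z \<Omega> u * of_real (\<omega> (u n) (u (n+1)))" for u
  proof -
    have I: "{..<n+2} = insert (n+1) (insert n {..<n})" by auto
    have "(\<Sum>S\<in>Pow {..<n+2}. X u S) =
      (\<Sum>S\<in>Pow {..<n}. (X u S + X u (insert (n+1) S)) + (X u (insert n S) + X u (insert (n+1) (insert n S))))"
      unfolding I by (simp add: sum_Pow_insert)
    also have "\<dots> = (\<Sum>S\<in>Pow {..<n}. (1 + z^2) * of_real (\<omega> (u n) (u (n+1))) * (z ^ card S * \<Omega> (mix_args S u (\<lambda>i. J (u i)))))"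
    proof (rule sum.cong[OF refl])
      fix S assume "S \<in> Pow {..<n}"
      then have S: "finite S" "n \<notin> S" "n + 1 \<notin> S" by (auto intro: finite_subset)
      have O: "\<Omega> (mix_args (insert (n+1) T) u w) = \<Omega> (mix_args T u w)" 
        "\<Omega> (mix_args (insert n T) u w) = \<Omega> (mix_args T u w)" for T w
        by (rule alt_form_cong[OF alt]; simp add: mix_args_def)+
      show "(X u S + X u (insert (n+1) S)) + (X u (insert n S) + X u (insert (n+1) (insert n S))) =
        (1 + z^2) * of_real (\<omega> (u n) (u (n+1))) * (z ^ card S * \<Omega> (mix_args S u (\<lambda>i. J (u i))))"
        using S unfolding X_def O
        by (simp add: mix_args_def form_J_left power2_eq_square algebra_simps)
    qed
    also have "\<dots> = (1 + z^2) * shift z \<Omega> u * of_real (\<omega> (u n) (u (n+1)))"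
      by (simp add: shift_sum sum_distrib_left sum_distrib_right mult_ac)
    finally show ?thesis .
  qed
  have "(\<Sum>S\<in>Pow {..<n+2}. z ^ card S * wedge2 n \<omega> \<Omega> (mix_args S v (\<lambda>i. J (v i)))) =
    (\<Sum>\<sigma> | \<sigma> permutes {..<n + 2}. \<Sum>S\<in>Pow {..<n+2}. of_int (sign \<sigma>) * (z ^ card S *
       \<Omega> (\<lambda>i. mix_args S v (\<lambda>i. J (v i)) (\<sigma> i)) *
       of_real (\<omega> (mix_args S v (\<lambda>i. J (v i)) (\<sigma> n)) (mix_args S v (\<lambda>i. J (v i)) (\<sigma> (n+1))))))"
    unfolding wedge2_def sum_distrib_left by (subst sum.swap) (simp add: mult_ac)
  also have "\<dots> = (\<Sum>\<sigma> | \<sigma> permutes {..<n + 2}. \<Sum>S\<in>Pow {..<n+2}. of_int (sign \<sigma>) * X (\<lambda>i. v (\<sigma> i)) S)"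
  proof (rule sum.cong[OF refl])
    fix \<sigma> assume "\<sigma> \<in> {\<sigma>. \<sigma> permutes {..<n + 2}}"
    then have \<sigma>: "\<sigma> permutes {..<n+2}" by simp
    have inj: "inj \<sigma>" using \<sigma> by (rule permutes_inj)
    have card: "card (\<sigma> ` S) = card S" for S using inj by (intro card_image) (auto simp: inj_on_def inj_def)
    show "(\<Sum>S\<in>Pow {..<n+2}. of_int (sign \<sigma>) * (z ^ card S *
       \<Omega> (\<lambda>i. mix_args S v (\<lambda>i. J (v i)) (\<sigma> i)) *
       of_real (\<omega> (mix_args S v (\<lambda>i. J (v i)) (\<sigma> n)) (mix_args S v (\<lambda>i. J (v i)) (\<sigma> (n+1)))))) =
       (\<Sum>S\<in>Pow {..<n+2}. of_int (sign \<sigma>) * X (\<lambda>i. v (\<sigma> i)) S)"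
      by (subst sum_Pow_permute[OF \<sigma>, symmetric]) (simp add: X_def mix_args_permute[OF inj] card)
  qed
  also have "\<dots> = (\<Sum>\<sigma> | \<sigma> permutes {..<n + 2}. (1 + z^2) * (of_int (sign \<sigma>) * shift z \<Omega> (\<lambda>i. v (\<sigma> i)) *
      of_real (\<omega> (v (\<sigma> n)) (v (\<sigma> (n+1))))))"
    by (intro sum.cong refl) (simp only: sum_distrib_left[symmetric] X, simp add: mult_ac)
  finally show ?thesis by (simp only: wedge2_def sum_distrib_left)
qed

text \<open>
  The pullback along \<open>(1 - \<i> \<kappa> J) / (1 + \<kappa>)\<close>. This is the identity for \<open>\<kappa> = 0\<close>, and for \<open>\<kappa> = 1\<close> the
  projection onto the eigenspace of \<open>J\<close> for the eigenvalue \<open>\<i>\<close>.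
\<close>

definition flow :: "real \<Rightarrow> ((nat \<Rightarrow> 'a) \<Rightarrow> complex) \<Rightarrow> (nat \<Rightarrow> 'a) \<Rightarrow> complex" where
  "flow \<kappa> \<Omega> v = of_real (1 / (1 + \<kappa>)) ^ n * shift (- \<i> * of_real \<kappa>) \<Omega> v"

lemma continuous_on_flow:
  assumes "\<And>v. continuous_on D (\<lambda>s. \<Omega> s v)" "continuous_on D \<kappa>" "\<And>s. s \<in> D \<Longrightarrow> \<kappa> s \<ge> 0"
  shows "continuous_on D (\<lambda>s. flow (\<kappa> s) (\<Omega> s) v)"
proof -
  have "1 + \<kappa> s \<noteq> 0" if "s \<in> D" for s using assms(3)[OF that] by simp
  then show ?thesis unfolding flow_def shift_def
    by (intro continuous_intros continuous_on_mixed assms) auto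
qed

lemma flow_0: "flow 0 \<Omega> = \<Omega>"
  by (simp add: fun_eq_iff flow_def shift_def mixed_zero)

text \<open>
  For \<open>\<kappa> < 1\<close> the complexified \<open>\<omega>\<close> is multiplied by a nonzero number; the limit case \<open>\<kappa> = 1\<close> follows by
  continuity.
\<close>

lemma flow_primitive:
  assumes W: "\<Omega> \<in> complex_primitive_forms n \<omega>" and \<kappa>: "\<kappa> \<in> {0..1}"
  shows "flow \<kappa> \<Omega> \<in> complex_primitive_forms n \<omega>"
proof -
  have alt: "alt_form n \<Omega>" and pr: "\<And>v. wedge2 n \<omega> \<Omega> v = 0" using W by (auto simp: complex_primitive_forms_iff)
  have 1: "wedge2 n \<omega> (flow \<kappa> \<Omega>) v = 0" if "\<kappa> \<in> {0..<1}" for \<kappa> v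
  proof -
    define z where "z = - \<i> * of_real \<kappa>"
    have "(1 + z^2) * wedge2 n \<omega> (shift z \<Omega>) v = 0" by (simp add: wedge2_shift[OF alt] pr)
    moreover have "1 + z^2 = of_real (1 - \<kappa>^2)" by (simp add: z_def power_mult_distrib)
    moreover have "\<kappa>^2 < 1" using that by (simp add: abs_square_less_1)
    then have "1 - \<kappa>^2 \<noteq> 0" by simp
    ultimately have "wedge2 n \<omega> (shift z \<Omega>) v = 0" by (metis mult_eq_0_iff of_real_eq_0_iff)
    then show ?thesis unfolding flow_def z_def[symmetric] wedge2_cmult by simp
  qed
  have cont: "continuous_on {0..1} (\<lambda>\<kappa>. wedge2 n \<omega> (flow \<kappa> \<Omega>) v)" for v
    unfolding wedge2_def by (intro continuous_intros continuous_on_flow) auto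
  have "wedge2 n \<omega> (flow \<kappa> \<Omega>) v = 0" for v
  proof -
    have "closure {0..<1::real} = {0..1}" by simp
    then show ?thesis
      using continuous_constant_on_closure[of "{0..<1}" "\<lambda>\<kappa>. wedge2 n \<omega> (flow \<kappa> \<Omega>) v" 0 \<kappa>] cont[of v] 1 \<kappa> by auto
  qed
  moreover have "alt_form n (flow \<kappa> \<Omega>)" unfolding flow_def[abs_def]
    by (intro alt_form_cmult alt_form_shift alt)
  ultimately show ?thesis by (simp add: complex_primitive_forms_iff)
qed

text \<open>
  On a unitary frame the flow evaluates \<open>\<Omega>\<close> at \<open>e k + z * J (e k)\<close> with \<open>z = - \<i> \<kappa>\<close> in the closed lower
  half plane. The orientation cannot change along the path.
\<close>

theorem flow_U_plus:
  assumes U: "\<Omega> \<in> U_plus n \<omega>" and \<kappa>: "\<kappa> \<in> {0..1}"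
  shows "flow \<kappa> \<Omega> \<in> U_plus n \<omega>"
proof -
  have W: "\<Omega> \<in> complex_primitive_forms n \<omega>" using U by (simp add: U_plus_def U_set_def)
  have U1: "flow \<kappa> \<Omega> \<in> U_set n \<omega>" if "\<kappa> \<in> {0..1}" for \<kappa>
    unfolding U_set_iff
  proof (intro conjI ballI)
    show "flow \<kappa> \<Omega> \<in> complex_primitive_forms n \<omega>" by (rule flow_primitive[OF W that])
    fix v assume "v \<in> unitary_frames"
    then have "frame v (\<lambda>i. J (v i))" by (intro unitary_frame) (simp add: unitary_frames_def)
    from mixed_lower_half_plane_nonzero[OF U this, of "\<lambda>_. - \<i> * of_real \<kappa>"]
    have "shift (- \<i> * of_real \<kappa>) \<Omega> v \<noteq> 0" using that by (simp add: shift_def)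
    moreover have "1 + \<kappa> \<noteq> 0" using that by auto
    ultimately show "flow \<kappa> \<Omega> v \<noteq> 0" unfolding flow_def by (simp del: of_real_divide)
  qed
  have "orientation (flow \<kappa> \<Omega>) 0 p q > 0"
  proof -
    define F where "F s = orientation (flow (s * \<kappa>) \<Omega>) 0 p q" for s
    have s: "s * \<kappa> \<in> {0..1}" if "s \<in> {0..1}" for s using that \<kappa> by (auto intro: mult_le_one)
    have "F 1 > 0"
    proof (rule continuous_nonzero_pos)
      show "continuous_on {0..1} F" unfolding F_def orientation_def
        using s by (intro continuous_intros continuous_on_flow) auto
      show "F s \<noteq> 0" if "s \<in> {0..1}" for s unfolding F_def
        by (rule orientation_nonzero[OF U1[OF s[OF that]] ref n_pos])
      show "F 0 > 0" using U U_plus_iff[OF ref] by (simp add: F_def flow_0)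
    qed
    then show ?thesis by (simp add: F_def)
  qed
  then show ?thesis using U1[OF \<kappa>] U_plus_iff[OF ref] by blast
qed

definition J_linear :: "((nat \<Rightarrow> 'a) \<Rightarrow> complex) \<Rightarrow> bool" where
  "J_linear \<Omega> \<longleftrightarrow> (\<forall>v x. \<forall>m<n. \<Omega> (v(m := J x)) = \<i> * \<Omega> (v(m := x)))"

lemma flow_1_J_linear:
  assumes alt: "alt_form n \<Omega>" shows "J_linear (flow 1 \<Omega>)"
  unfolding J_linear_def
proof (intro allI impI)
  fix v x m assume m: "m < n"
  define A where "A y = mixed_at n \<Omega> (\<lambda>_. - \<i>) v (\<lambda>i. J (v i)) m y" for y
  have "linear A" unfolding A_def[abs_def] by (rule linear_mixed_at[OF alt m])
  then have "A (- x) = - A x" by (rule linear_neg)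
  then show "flow 1 \<Omega> (v(m := J x)) = \<i> * flow 1 \<Omega> (v(m := x))"
    by (simp add: flow_def shift_slot[OF m] A_def algebra_simps)
qed

text \<open>
  A \<open>J\<close>-linear alternating form of top degree \<open>n\<close> on an \<open>n\<close>-dimensional complex space is determined
  by one value.
\<close>

lemma J_linear_zero:
  assumes alt: "alt_form n \<Omega>" and Jl: "J_linear \<Omega>" and v: "unitary n v" and 0: "\<Omega> v = 0"
  shows "\<Omega> w = 0"
proof (rule multilinear_span_induct[of n "\<lambda>w. \<Omega> w = 0" "v ` {..<n} \<union> (\<lambda>i. J (v i)) ` {..<n}"])
  show "\<Omega> w' = 0" if "\<And>i. i < n \<Longrightarrow> w i = w' i" "\<Omega> w = 0" for w w'
    using alt_form_cong[OF alt that(1)] that(2) by simp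
  show "subspace {x. \<Omega> (w(i := x)) = 0}" if "i < n" for w i
    by (rule linear_subspace_kernel[OF alt_form_linear[OF alt that]])
  show "w i \<in> span (v ` {..<n} \<union> (\<lambda>i. J (v i)) ` {..<n})" for i
    using frame_basis(2)[OF unitary_frame[OF v]] by simp
  fix w assume "\<And>i. i < n \<Longrightarrow> w i \<in> v ` {..<n} \<union> (\<lambda>i. J (v i)) ` {..<n}"
  then have "\<forall>i. \<exists>u. i < n \<longrightarrow> u \<in> v ` {..<n} \<and> (w i = u \<or> w i = J u)" by blast
  then obtain u where u: "\<And>i. i < n \<Longrightarrow> u i \<in> v ` {..<n} \<and> (w i = u i \<or> w i = J (u i))" by metis
  have "j \<le> n \<Longrightarrow> \<Omega> (\<lambda>k. if k < j then w k else u k) = 0" for j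
  proof (induction j)
    case 0
    obtain c :: real where "\<Omega> u = c *\<^sub>R \<Omega> v"
      using alt_form_change_of_basis[of n u v] u alt by (meson span_base)
    then show ?case using \<open>\<Omega> v = 0\<close> by simp
  next
    case (Suc j)
    define s where "s = (\<lambda>k. if k < j then w k else u k)"
    have "(\<lambda>k. if k < Suc j then w k else u k) = s(j := w j)" by (auto simp: s_def less_Suc_eq)
    moreover have "s(j := u j) = s" by (auto simp: s_def)
    moreover have "\<Omega> s = 0" using Suc by (simp add: s_def)
    moreover have "w j = u j \<or> w j = J (u j)" using u[of j] Suc.prems by simp
    moreover have "\<Omega> (s(j := J (u j))) = \<i> * \<Omega> (s(j := u j))" using Jl Suc.prems by (simp add: J_linear_def)
    ultimately show ?case by auto
  qed
  from this[of n] have "\<Omega> (\<lambda>k. if k < n then w k else u k) = 0" by simp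
  moreover have "\<Omega> (\<lambda>k. if k < n then w k else u k) = \<Omega> w" by (rule alt_form_cong[OF alt]) simp
  ultimately show "\<Omega> w = 0" by simp
qed

text \<open>
  The complex coordinates belonging to the reference frame.
\<close>

definition coord :: "nat \<Rightarrow> 'a \<Rightarrow> complex" where
  "coord k x = Complex (\<omega> x (q k)) (- \<omega> x (p k))"

text \<open>
  The holomorphic volume form \<open>dz\<^sub>1 \<and> \<dots> \<and> dz\<^sub>n\<close>, that is, the determinant of the coordinates.
\<close>

definition vol :: "(nat \<Rightarrow> 'a) \<Rightarrow> complex" where
  "vol v = (\<Sum>\<tau> | \<tau> permutes {..<n}. of_int (sign \<tau>) * (\<Prod>i<n. coord i (v (\<tau> i))))"

lemma coord_linear: "coord k (x + y) = coord k x + coord k y" "coord k (c *\<^sub>R x) = of_real c * coord k x"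
  by (simp_all add: coord_def complex_eq_iff)

lemma coord_J: "k < n \<Longrightarrow> coord k (J x) = \<i> * coord k x"
  by (simp add: coord_def complex_eq_iff form_J_left J_ref)

lemma coord_p: "i < n \<Longrightarrow> k < n \<Longrightarrow> coord i (p k) = (if i = k then 1 else 0)"
  by (auto simp: coord_def complex_eq_iff hyperbolicD[OF ref])

lemma vol_slot:
  assumes m: "m < n"
  shows "vol (v(m := x)) = (\<Sum>\<tau> | \<tau> permutes {..<n}. of_int (sign \<tau>) *
     (\<Prod>i\<in>{..<n} - {Hilbert_Choice.inv \<tau> m}. coord i (v (\<tau> i))) * coord (Hilbert_Choice.inv \<tau> m) x)"
  unfolding vol_def
proof (rule sum.cong[OF refl])
  fix \<tau> assume "\<tau> \<in> {\<tau>. \<tau> permutes {..<n}}"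
  then have \<tau>: "\<tau> permutes {..<n}" by simp
  have im: "Hilbert_Choice.inv \<tau> m < n" using permutes_in_image[OF permutes_inv[OF \<tau>], of m] m by simp
  have "(\<Prod>i<n. coord i ((v(m := x)) (\<tau> i))) =
     coord (Hilbert_Choice.inv \<tau> m) ((v(m := x)) (\<tau> (Hilbert_Choice.inv \<tau> m))) * (\<Prod>i\<in>{..<n} - {Hilbert_Choice.inv \<tau> m}. coord i ((v(m := x)) (\<tau> i)))"
    using im by (intro prod.remove) auto
  also have "\<tau> (Hilbert_Choice.inv \<tau> m) = m" using permutes_inverses(1)[OF \<tau>] .
  also have "(\<Prod>i\<in>{..<n} - {Hilbert_Choice.inv \<tau> m}. coord i ((v(m := x)) (\<tau> i))) = (\<Prod>i\<in>{..<n} - {Hilbert_Choice.inv \<tau> m}. coord i (v (\<tau> i)))"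
    using permutes_inverses(2)[OF \<tau>] by (intro prod.cong) auto
  finally show "of_int (sign \<tau>) * (\<Prod>i<n. coord i ((v(m := x)) (\<tau> i))) = of_int (sign \<tau>) *
     (\<Prod>i\<in>{..<n} - {Hilbert_Choice.inv \<tau> m}. coord i (v (\<tau> i))) * coord (Hilbert_Choice.inv \<tau> m) x" by simp
qed

lemma J_linear_vol: "J_linear vol"
  unfolding J_linear_def
proof (intro allI impI)
  fix v x m assume m: "m < n"
  have "Hilbert_Choice.inv \<tau> m < n" if "\<tau> permutes {..<n}" for \<tau>
    using permutes_in_image[OF permutes_inv[OF that], of m] m by simp
  then show "vol (v(m := J x)) = \<i> * vol (v(m := x))"
    unfolding vol_slot[OF m] sum_distrib_left by (intro sum.cong) (simp_all add: coord_J)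
qed

lemma alt_form_vol: "alt_form n vol"
  unfolding alt_form_def
proof (intro conjI allI impI)
  fix v w :: "nat \<Rightarrow> 'a" assume eq: "\<forall>i<n. v i = w i"
  have "\<tau> i < n" if "\<tau> permutes {..<n}" "i < n" for \<tau> i using permutes_in_image[OF that(1), of i] that(2) by simp
  then show "vol v = vol w" unfolding vol_def using eq
    by (intro sum.cong arg_cong2[where f = "(*)"] prod.cong) auto
next
  fix v :: "nat \<Rightarrow> 'a" and m assume m: "m < n"
  show "linear (\<lambda>x. vol (v(m := x)))"
    unfolding vol_slot[OF m]
    by (rule linearI) (simp_all add: coord_linear sum.distrib algebra_simps scaleR_conv_of_real sum_distrib_left)
next
  fix v :: "nat \<Rightarrow> 'a" and i j assume ij: "i < n" "j < n" "i \<noteq> j \<and> v i = v j"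
  define t where "t = Transposition.transpose i j"
  have t: "t permutes {..<n}" using ij by (simp add: t_def permutes_swap_id)
  have tt: "t \<circ> (t \<circ> \<tau>) = \<tau>" for \<tau> :: "nat \<Rightarrow> nat" by (simp add: t_def fun_eq_iff)
  have vt: "v (t k) = v k" for k using ij by (auto simp: t_def Transposition.transpose_def)
  have "vol v = (\<Sum>\<tau> | \<tau> permutes {..<n}. of_int (sign (t \<circ> \<tau>)) * (\<Prod>i<n. coord i (v ((t \<circ> \<tau>) i))))"
    unfolding vol_def
    by (rule sum.reindex_bij_witness[of _ "\<lambda>\<tau>. t \<circ> \<tau>" "\<lambda>\<tau>. t \<circ> \<tau>"])
       (use t in \<open>auto simp: permutes_compose tt\<close>)
  also have "\<dots> = (\<Sum>\<tau> | \<tau> permutes {..<n}. - (of_int (sign \<tau>) * (\<Prod>i<n. coord i (v (\<tau> i)))))"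
  proof (rule sum.cong[OF refl])
    fix \<tau> assume "\<tau> \<in> {\<tau>. \<tau> permutes {..<n}}"
    then have "permutation \<tau>" "permutation t" using t by (auto intro: permutes_imp_permutation)
    then have "sign (t \<circ> \<tau>) = - sign \<tau>" using ij by (simp add: sign_compose t_def sign_swap_id)
    then show "of_int (sign (t \<circ> \<tau>)) * (\<Prod>i<n. coord i (v ((t \<circ> \<tau>) i))) = - (of_int (sign \<tau>) * (\<Prod>i<n. coord i (v (\<tau> i))))"
      by (simp add: vt)
  qed
  also have "\<dots> = - vol v" by (simp add: vol_def sum_negf)
  finally show "vol v = 0" by simp
qed

lemma vol_ref: "vol p = 1"
proof -
  have "(\<Prod>i<n. coord i (p (\<tau> i))) = (if \<tau> = id then 1 else 0)" if \<tau>: "\<tau> permutes {..<n}" for \<tau>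
  proof (cases "\<tau> = id")
    case True then show ?thesis by (simp add: coord_p)
  next
    case False
    then obtain i where i: "\<tau> i \<noteq> i" by (auto simp: fun_eq_iff)
    then have "i < n" using \<tau> by (metis lessThan_iff permutes_def)
    moreover have "\<tau> i < n" using permutes_in_image[OF \<tau>, of i] calculation by simp
    ultimately have "coord i (p (\<tau> i)) = 0" using i by (simp add: coord_p)
    then show ?thesis using False \<open>i < n\<close> by (auto intro!: prod_zero)
  qed
  then have "vol p = (\<Sum>\<tau> | \<tau> permutes {..<n}. if \<tau> = id then 1 else 0)"
    unfolding vol_def by (intro sum.cong) (auto simp: sign_id)
  then show ?thesis by (simp add: finite_permutations permutes_id)
qed

text \<open>
  The coordinate \<open>k\<close> is evaluated on two of the vectors, and exchanging these two changes only the sign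
  of the permutation.
\<close>

lemma antisymmetrized_coord_vanish:
  assumes k: "k < n" and m: "m \<in> {n, n+1}" "m' \<in> {n, n+1}" "m \<noteq> m'"
  shows "(\<Sum>\<sigma> | \<sigma> permutes {..<n + 2}. of_int (sign \<sigma>) * (\<Prod>i<n. coord i (v (\<sigma> i))) *
     (coord k (v (\<sigma> m)) * h (v (\<sigma> m')))) = (0 :: complex)" (is "sum ?f _ = 0")
proof -
  define t where "t = Transposition.transpose k m"
  have t: "t permutes {..<n+2}" using k m by (auto simp: t_def permutes_swap_id)
  have km: "k \<noteq> m" "m \<notin> {..<n}" "t m' = m'" "t m = k" "t k = m" using k m by (auto simp: t_def Transposition.transpose_def)
  have "sum ?f {\<sigma>. \<sigma> permutes {..<n + 2}} = sum (\<lambda>\<sigma>. ?f (\<sigma> \<circ> t)) {\<sigma>. \<sigma> permutes {..<n + 2}}"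
    by (rule sum_permutations_compose_right[OF t])
  also have "\<dots> = sum (\<lambda>\<sigma>. - ?f \<sigma>) {\<sigma>. \<sigma> permutes {..<n + 2}}"
  proof (rule sum.cong[OF refl])
    fix \<sigma> assume "\<sigma> \<in> {\<sigma>. \<sigma> permutes {..<n + 2}}"
    then have "permutation \<sigma>" "permutation t" using t by (auto intro: permutes_imp_permutation)
    then have "sign (\<sigma> \<circ> t) = - sign \<sigma>" using km by (simp add: sign_compose t_def sign_swap_id)
    moreover have P: "(\<Prod>i<n. g i) = g k * (\<Prod>i\<in>{..<n} - {k}. g i)" for g :: "nat \<Rightarrow> complex"
      using k by (intro prod.remove) auto
    have "(\<Prod>i\<in>{..<n} - {k}. coord i (v (\<sigma> (t i)))) = (\<Prod>i\<in>{..<n} - {k}. coord i (v (\<sigma> i)))"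
      using km by (intro prod.cong) (auto simp: t_def Transposition.transpose_def)
    then have "(\<Prod>i<n. coord i (v (\<sigma> (t i)))) * coord k (v (\<sigma> (t m))) = (\<Prod>i<n. coord i (v (\<sigma> i))) * coord k (v (\<sigma> m))"
      using km by (simp add: P)
    ultimately show "?f (\<sigma> \<circ> t) = - ?f \<sigma>" using km by (simp add: algebra_simps)
  qed
  also have "\<dots> = - sum ?f {\<sigma>. \<sigma> permutes {..<n + 2}}" by (rule sum_negf)
  finally show ?thesis by simp
qed

text \<open>
  The form \<open>\<omega>\<close> is of type (1,1).
\<close>

lemma form_coord:
  "of_real (\<omega> x y) = (\<Sum>k<n. (coord k y * cnj (coord k x) - coord k x * cnj (coord k y)) / (2 * \<i>))"
proof -
  have "\<omega> x y = (\<Sum>k<n. \<omega> x (q k) * \<omega> (p k) y - \<omega> x (p k) * \<omega> (q k) y)"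
    by (subst frame_expansion[OF ref, of x]) simp
  also have "\<dots> = (\<Sum>k<n. Im (cnj (coord k x) * coord k y))"
    using form_skew[of y] by (intro sum.cong) (simp_all add: coord_def)
  finally have "of_real (\<omega> x y) = (\<Sum>k<n. of_real (Im (cnj (coord k x) * coord k y)) :: complex)" by simp
  also have "\<dots> = (\<Sum>k<n. (coord k y * cnj (coord k x) - coord k x * cnj (coord k y)) / (2 * \<i>))"
  proof (rule sum.cong[OF refl])
    fix k
    define t where "t = Im (cnj (coord k x) * coord k y)"
    have "coord k y * cnj (coord k x) - coord k x * cnj (coord k y) = of_real (2 * t) * \<i>"
      using complex_diff_cnj[of "coord k y * cnj (coord k x)"] by (simp add: t_def mult.commute)
    moreover have "complex_of_real t = of_real (2 * t) * \<i> / (2 * \<i>)" by (simp add: complex_eq_iff)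
    ultimately show "of_real (Im (cnj (coord k x) * coord k y)) =
        (coord k y * cnj (coord k x) - coord k x * cnj (coord k y)) / (2 * \<i>)" unfolding t_def[symmetric] by (simp only:)
  qed
  finally show ?thesis .
qed

text \<open>
  By type: \<open>\<omega>\<close> is a sum of products of a \<open>dz\<^sub>k\<close> with its conjugate, and \<open>dz\<^sub>k\<close> already occurs in the
  volume form.
\<close>

theorem vol_primitive: "vol \<in> complex_primitive_forms n \<omega>"
proof -
  have "wedge2 n \<omega> vol v = 0" for v
  proof -
    define g where "g \<sigma> = of_int (sign \<sigma>) * (\<Prod>i<n. coord i (v (\<sigma> i))) * of_real (\<omega> (v (\<sigma> n)) (v (\<sigma> (n+1))))" for \<sigma>
    have "(\<Sum>\<sigma> | \<sigma> permutes {..<n + 2}. g \<sigma>) = (\<Sum>\<sigma> | \<sigma> permutes {..<n + 2}. \<Sum>k<n. (1 / (2 * \<i>)) *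
       (of_int (sign \<sigma>) * (\<Prod>i<n. coord i (v (\<sigma> i))) * (coord k (v (\<sigma> (n+1))) * cnj (coord k (v (\<sigma> n)))) -
        of_int (sign \<sigma>) * (\<Prod>i<n. coord i (v (\<sigma> i))) * (coord k (v (\<sigma> n)) * cnj (coord k (v (\<sigma> (n+1)))))))"
      unfolding g_def form_coord sum_distrib_left by (intro sum.cong) (simp_all add: field_simps)
    also have "\<dots> = (\<Sum>k<n. (1 / (2 * \<i>)) *
       ((\<Sum>\<sigma> | \<sigma> permutes {..<n + 2}. of_int (sign \<sigma>) * (\<Prod>i<n. coord i (v (\<sigma> i))) * (coord k (v (\<sigma> (n+1))) * cnj (coord k (v (\<sigma> n))))) -
        (\<Sum>\<sigma> | \<sigma> permutes {..<n + 2}. of_int (sign \<sigma>) * (\<Prod>i<n. coord i (v (\<sigma> i))) * (coord k (v (\<sigma> n)) * cnj (coord k (v (\<sigma> (n+1))))))))"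
      by (subst sum.swap) (simp only: sum_distrib_left[symmetric] sum_subtractf)
    also have "\<dots> = 0"
      using antisymmetrized_coord_vanish[of _ "n+1" n v "\<lambda>x. cnj (coord _ x)"]
        antisymmetrized_coord_vanish[of _ n "n+1" v "\<lambda>x. cnj (coord _ x)"]
      by (intro sum.neutral) auto
    finally have g0: "(\<Sum>\<sigma> | \<sigma> permutes {..<n + 2}. g \<sigma>) = 0" .
    \<comment> \<open>The permutations in the determinant are absorbed into those of the wedge product.\<close>
    have "wedge2 n \<omega> vol v = (\<Sum>\<tau> | \<tau> permutes {..<n}. \<Sum>\<sigma> | \<sigma> permutes {..<n + 2}. of_int (sign \<sigma>) *
        (of_int (sign \<tau>) * (\<Prod>i<n. coord i (v (\<sigma> (\<tau> i))))) * of_real (\<omega> (v (\<sigma> n)) (v (\<sigma> (n+1)))))"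
      unfolding wedge2_def vol_def sum_distrib_left sum_distrib_right by (rule sum.swap)
    also have "\<dots> = (\<Sum>\<tau> | \<tau> permutes {..<n}. \<Sum>\<sigma> | \<sigma> permutes {..<n + 2}. g (\<sigma> \<circ> \<tau>))"
    proof (intro sum.cong refl)
      fix \<tau> \<sigma> assume "\<tau> \<in> {\<tau>. \<tau> permutes {..<n}}" "\<sigma> \<in> {\<sigma>. \<sigma> permutes {..<n + 2}}"
      then have \<tau>: "\<tau> permutes {..<n}" and \<sigma>: "\<sigma> permutes {..<n + 2}" by auto
      then have "permutation \<sigma>" "permutation \<tau>" by (auto intro: permutes_imp_permutation)
      moreover have "\<tau> n = n" "\<tau> (n+1) = n+1" using \<tau> by (auto intro: permutes_not_in)
      ultimately show "of_int (sign \<sigma>) *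
        (of_int (sign \<tau>) * (\<Prod>i<n. coord i (v (\<sigma> (\<tau> i))))) * of_real (\<omega> (v (\<sigma> n)) (v (\<sigma> (n+1)))) = g (\<sigma> \<circ> \<tau>)"
        by (simp add: g_def sign_compose)
    qed
    also have "\<dots> = (\<Sum>\<tau> | \<tau> permutes {..<n}. \<Sum>\<sigma> | \<sigma> permutes {..<n + 2}. g \<sigma>)"
    proof (rule sum.cong[OF refl])
      fix \<tau> assume "\<tau> \<in> {\<tau>. \<tau> permutes {..<n}}"
      then have "\<tau> permutes {..<n+2}" by (auto intro: permutes_subset)
      then show "(\<Sum>\<sigma> | \<sigma> permutes {..<n + 2}. g (\<sigma> \<circ> \<tau>)) = (\<Sum>\<sigma> | \<sigma> permutes {..<n + 2}. g \<sigma>)"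
        by (rule sum_permutations_compose_right[symmetric])
    qed
    finally show ?thesis by (simp only: g0 sum.neutral_const)
  qed
  then show ?thesis using alt_form_vol by (simp add: complex_primitive_forms_iff)
qed

lemma vol_U_plus:
  assumes "c \<noteq> 0" shows "(\<lambda>v. c * vol v) \<in> U_plus n \<omega>"
proof -
  have "vol v \<noteq> 0" if "v \<in> unitary_frames" for v
    using J_linear_zero[OF alt_form_vol J_linear_vol, of v p] vol_ref that by (auto simp: unitary_frames_def)
  then have U: "(\<lambda>v. c * vol v) \<in> U_set n \<omega>"
    using vol_primitive assms unfolding U_set_iff complex_primitive_forms_iff
    by (simp add: alt_form_cmult wedge2_cmult)
  have "vol (p(0 := q 0)) = \<i> * vol p"
    using J_linear_vol n_pos by (simp add: J_linear_def flip: J_ref(1))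
  then have "orientation (\<lambda>v. c * vol v) 0 p q = Im (cnj c * c * \<i>)"
    by (simp add: orientation_def vol_ref mult_ac)
  also have "cnj c * c = of_real ((cmod c)^2)" unfolding complex_norm_square by (simp add: mult_ac)
  finally have "orientation (\<lambda>v. c * vol v) 0 p q > 0" using assms by simp
  then show ?thesis using U U_plus_iff[OF ref] by blast
qed

text \<open>
  Both sides are \<open>J\<close>-linear and agree on the reference frame.
\<close>

lemma flow_1_eq:
  assumes "alt_form n \<Omega>" shows "flow 1 \<Omega> = (\<lambda>v. flow 1 \<Omega> p * vol v)"
proof
  fix w
  define \<Psi> where "\<Psi> v = flow 1 \<Omega> v - flow 1 \<Omega> p * vol v" for v
  have af: "alt_form n (flow 1 \<Omega>)" unfolding flow_def[abs_def] by (intro alt_form_cmult alt_form_shift assms)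
  have "alt_form n \<Psi>" unfolding \<Psi>_def[abs_def]
    by (rule alt_form_diff[OF af alt_form_cmult[OF alt_form_vol]])
  moreover have "J_linear \<Psi>" using flow_1_J_linear[OF assms] J_linear_vol
    by (simp add: J_linear_def \<Psi>_def algebra_simps)
  moreover have "\<Psi> p = 0" by (simp add: \<Psi>_def vol_ref)
  ultimately have "\<Psi> w = 0" using J_linear_zero[OF _ _ unitary_ref] by blast
  then show "flow 1 \<Omega> w = flow 1 \<Omega> p * vol w" by (simp add: \<Psi>_def)
qed

lemma flow_1_vol: "flow 1 (\<lambda>v. c * vol v) p = c"
proof -
  have J: "vol (mix_args S p (\<lambda>i. J (p i))) = \<i> ^ card S" if "S \<subseteq> {..<n}" for S
  proof -
    have "finite S" using that by (rule finite_subset) simp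
    then show ?thesis using that
    proof (induction S rule: finite_induct)
      case empty then show ?case by (simp add: mix_args_def[abs_def] vol_ref)
    next
      case (insert k S)
      let ?u = "mix_args S p (\<lambda>i. J (p i))"
      have "mix_args (insert k S) p (\<lambda>i. J (p i)) = ?u(k := J (p k))" "?u(k := p k) = ?u"
        using insert by (auto simp: mix_args_def fun_eq_iff)
      moreover have "vol (?u(k := J (p k))) = \<i> * vol (?u(k := p k))" using J_linear_vol insert by (simp add: J_linear_def)
      ultimately show ?case using insert by (simp del: fun_upd_apply)
    qed
  qed
  have "shift (- \<i>) (\<lambda>v. c * vol v) p = (\<Sum>S\<in>Pow {..<n}. c)"
    unfolding shift_sum using J by (intro sum.cong) (auto simp flip: power_mult_distrib)
  also have "\<dots> = 2 ^ n * c" by (simp add: card_Pow)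
  finally show ?thesis by (simp add: flow_def power_one_over divide_simps flip: power_mult_distrib)
qed

text \<open>
  The flow deforms \<open>U_plus\<close> inside itself to the nonzero multiples of the volume form, and a radial
  deformation takes these to the multiples of absolute value 1.
\<close>

theorem U_plus_homotopy_eqv_circle: "U_plus n \<omega> homotopy_eqv sphere (0::complex) 1"
proof -
  define r where "r \<Omega> = flow 1 \<Omega> p" for \<Omega>
  define \<iota> where "\<iota> c v = c * vol v" for c v
  have altU: "alt_form n \<Omega>" if "\<Omega> \<in> U_plus n \<omega>" for \<Omega>
    using that by (simp add: U_plus_def U_set_def complex_primitive_forms_iff)
  have r0: "r \<Omega> \<noteq> 0" if "\<Omega> \<in> U_plus n \<omega>" for \<Omega>
    using flow_U_plus[OF that, of 1] U_nonzero[OF _ ref] by (auto simp: r_def U_plus_def)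
  have \<iota>U: "\<iota> c \<in> U_plus n \<omega>" if "c \<noteq> 0" for c using vol_U_plus[OF that] by (simp add: \<iota>_def[abs_def])
  have ev: "continuous_on D (\<lambda>\<Omega>. \<Omega> v)" for D :: "((nat \<Rightarrow> 'a) \<Rightarrow> complex) set" and v
    by (rule continuous_on_subset[OF continuous_on_product_coordinates]) simp
  have cr: "continuous_on (U_plus n \<omega>) r" unfolding r_def
    by (rule continuous_on_flow) (auto intro: ev continuous_intros)
  have c\<iota>: "continuous_on D (\<lambda>s. \<iota> (f s))" if "continuous_on D f" for D :: "'z::topological_space set" and f
    unfolding \<iota>_def using that by (intro continuous_on_coordinatewise_then_product continuous_intros)
  have csgn: "continuous_on (U_plus n \<omega>) (\<lambda>\<Omega>. sgn (r \<Omega>))"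
    using cr r0 by (intro continuous_intros) auto
  define f where "f \<Omega> = sgn (r \<Omega>)" for \<Omega>
  have h1: "homotopic_with_canon (\<lambda>_. True) (U_plus n \<omega>) (U_plus n \<omega>) id (\<lambda>\<Omega>. \<iota> (r \<Omega>))"
  proof (rule homotopic_with_canonI[where h = "\<lambda>z. flow (fst z) (snd z)"])
    show "continuous_on ({0..1} \<times> U_plus n \<omega>) (\<lambda>z. flow (fst z) (snd z))"
    proof (rule continuous_on_coordinatewise_then_product, rule continuous_on_flow)
      show "continuous_on ({0..1} \<times> U_plus n \<omega>) (\<lambda>z. snd z v)" for v
        by (rule continuous_on_product_then_coordinatewise[OF continuous_on_snd[OF continuous_on_id]])
    qed (auto intro: continuous_intros)
    show "(\<lambda>z. flow (fst z) (snd z)) \<in> {0..1} \<times> U_plus n \<omega> \<rightarrow> U_plus n \<omega>"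
      using flow_U_plus by auto
    show "flow (fst (0, x)) (snd (0, x)) = id x" for x by (simp add: flow_0)
    show "flow (fst (1, x)) (snd (1, x)) = \<iota> (r x)" if "x \<in> U_plus n \<omega>" for x
      using flow_1_eq[OF altU[OF that]] by (simp add: \<iota>_def[abs_def] r_def)
  qed
  define sc where "sc z = (1 - fst z) + fst z / cmod (r (snd z))" for z :: "real \<times> ((nat \<Rightarrow> 'a) \<Rightarrow> complex)"
  have h2: "homotopic_with_canon (\<lambda>_. True) (U_plus n \<omega>) (U_plus n \<omega>) (\<lambda>\<Omega>. \<iota> (r \<Omega>)) (\<lambda>\<Omega>. \<iota> (f \<Omega>))"
  proof (rule homotopic_with_canonI[where h = "\<lambda>z. \<iota> (of_real (sc z) * r (snd z))"])
    show "continuous_on ({0..1::real} \<times> U_plus n \<omega>) (\<lambda>z. \<iota> (of_real (sc z) * r (snd z)))"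
    proof -
      have "continuous_on ({0..1::real} \<times> U_plus n \<omega>) (\<lambda>z. r (snd z))"
        by (rule continuous_on_compose2[OF cr continuous_on_snd[OF continuous_on_id]]) auto
      then show ?thesis unfolding sc_def using r0 by (intro c\<iota> continuous_intros) auto
    qed
    show "(\<lambda>z. \<iota> (of_real (sc z) * r (snd z))) \<in> {0..1::real} \<times> U_plus n \<omega> \<rightarrow> U_plus n \<omega>"
    proof
      fix z :: "real \<times> ((nat \<Rightarrow> 'a) \<Rightarrow> complex)" assume z: "z \<in> {0..1::real} \<times> U_plus n \<omega>"
      then have rz: "r (snd z) \<noteq> 0" using r0 by auto
      have "sc z > 0"
        using z rz unfolding sc_def by (cases "fst z = 1") (auto intro!: add_pos_nonneg)
      then show "\<iota> (of_real (sc z) * r (snd z)) \<in> U_plus n \<omega>"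
        using rz by (intro \<iota>U) (metis less_irrefl mult_eq_0_iff of_real_eq_0_iff)
    qed
  qed (simp_all add: sc_def f_def sgn_eq divide_inverse mult.commute)
  show ?thesis unfolding homotopy_equivalent_space_def
  proof (intro exI[of _ f] exI[of _ \<iota>] conjI)
    show "continuous_map (top_of_set (U_plus n \<omega>)) (top_of_set (sphere 0 1)) f"
      using csgn r0 by (auto simp: f_def norm_sgn)
    show "continuous_map (top_of_set (sphere 0 1)) (top_of_set (U_plus n \<omega>)) \<iota>"
      using c\<iota>[of "sphere 0 1" "\<lambda>c. c"] by (auto intro!: \<iota>U)
    show "homotopic_with (\<lambda>x. True) (top_of_set (U_plus n \<omega>)) (top_of_set (U_plus n \<omega>)) (\<iota> \<circ> f) id"
      using homotopic_with_symD[OF homotopic_with_trans[OF h1 h2]] by (simp add: o_def)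
    show "homotopic_with (\<lambda>x. True) (top_of_set (sphere 0 1)) (top_of_set (sphere 0 1)) (f \<circ> \<iota>) id"
    proof (rule homotopic_with_equal)
      show "continuous_map (top_of_set (sphere 0 1)) (top_of_set (sphere 0 1)) (f \<circ> \<iota>)"
        by (rule continuous_map_compose) fact+
      fix c :: complex assume "c \<in> topspace (top_of_set (sphere 0 1))"
      then show "(f \<circ> \<iota>) c = id c" by (simp add: f_def r_def \<iota>_def[abs_def] flow_1_vol sgn_eq)
    qed simp_all
  qed
qed

end

section \<open>Openness and the action of the symplectic group\<close>


text \<open>
  The projection along a compact factor is a closed map.
\<close>

lemma openin_forall_compact:
  fixes \<phi> :: "'x::topological_space \<Rightarrow> 'k::topological_space \<Rightarrow> 'c::topological_space"
  assumes K: "compact K" and cont: "continuous_on (W \<times> K) (\<lambda>z. \<phi> (fst z) (snd z))" and V: "open V"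
  shows "openin (top_of_set W) {x \<in> W. \<forall>k\<in>K. \<phi> x k \<in> V}"
proof -
  have "compact_space (top_of_set K)" using K by (simp add: compact_space_subtopology)
  then have cm: "closed_map (prod_topology (top_of_set W) (top_of_set K)) (top_of_set W) fst"
    by (rule Abstract_Topological_Spaces.closed_map_fst)
  have "closedin (top_of_set (W \<times> K)) ((W \<times> K) \<inter> (\<lambda>z. \<phi> (fst z) (snd z)) -` (- V))"
    using cont V by (intro continuous_closedin_preimage) auto
  then have "closedin (top_of_set W) (fst ` ((W \<times> K) \<inter> (\<lambda>z. \<phi> (fst z) (snd z)) -` (- V)))"
    using cm by (simp add: closed_map_def subtopology_Times)
  then have "openin (top_of_set W) (W - fst ` ((W \<times> K) \<inter> (\<lambda>z. \<phi> (fst z) (snd z)) -` (- V)))"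
    by (simp add: openin_diff)
  also have "W - fst ` ((W \<times> K) \<inter> (\<lambda>z. \<phi> (fst z) (snd z)) -` (- V)) = {x \<in> W. \<forall>k\<in>K. \<phi> x k \<in> V}"
    by force
  finally show ?thesis .
qed

lemma closedin_exists_compact:
  fixes D :: "('k::topological_space \<times> 'y::topological_space) set"
  assumes K: "compact K" and D: "closedin (top_of_set (K \<times> Y)) D"
  shows "closedin (top_of_set Y) (snd ` D)"
proof -
  have "compact_space (top_of_set K)" using K by (simp add: compact_space_subtopology)
  then have "closed_map (prod_topology (top_of_set K) (top_of_set Y)) (top_of_set Y) snd"
    by (rule Abstract_Topological_Spaces.closed_map_snd)
  then show ?thesis using D by (simp add: closed_map_def subtopology_Times)
qed

lemma closedin_top_of_set_Int:
  assumes "closedin (top_of_set S) T" "K \<subseteq> S"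
  shows "closedin (top_of_set K) (K \<inter> T)"
proof -
  obtain C where "closed C" "T = S \<inter> C" using assms(1) by (auto simp: closedin_closed)
  then have "K \<inter> T = K \<inter> C" using assms(2) by auto
  then show ?thesis using \<open>closed C\<close> by (auto simp: closedin_closed)
qed

lemma alt_form_scale:
  fixes c :: "nat \<Rightarrow> real"
  assumes alt: "alt_form n \<Omega>"
  shows "\<Omega> (\<lambda>i. c i *\<^sub>R v i) = (\<Prod>i<n. c i) *\<^sub>R \<Omega> v"
proof -
  have "j \<le> n \<Longrightarrow> \<Omega> (\<lambda>i. if i < j then c i *\<^sub>R v i else v i) = (\<Prod>i<j. c i) *\<^sub>R \<Omega> v" for j
  proof (induction j)
    case (Suc j)
    let ?u = "\<lambda>i. if i < j then c i *\<^sub>R v i else v i"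
    have "(\<lambda>i. if i < Suc j then c i *\<^sub>R v i else v i) = ?u(j := c j *\<^sub>R v j)" "?u(j := v j) = ?u"
      by (auto simp: less_Suc_eq)
    then show ?case using Suc linear_scale[OF alt_form_linear[OF alt, of j ?u], of "c j" "v j"]
      by (simp add: mult.commute)
  qed simp
  from this[of n] have "\<Omega> (\<lambda>i. if i < n then c i *\<^sub>R v i else v i) = (\<Prod>i<n. c i) *\<^sub>R \<Omega> v" by simp
  moreover have "\<Omega> (\<lambda>i. if i < n then c i *\<^sub>R v i else v i) = \<Omega> (\<lambda>i. c i *\<^sub>R v i)"
    by (rule alt_form_cong[OF alt]) simp
  ultimately show ?thesis by simp
qed

lemma linear_blinfun: "linear (blinfun_apply g)"
  using blinfun.bounded_linear_right bounded_linear.linear by blast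

lemma continuous_on_blinfun_eval: "continuous_on D (\<lambda>g. blinfun_apply g x)"
  by (intro blinfun.continuous_on continuous_on_id continuous_on_const)

context symplectic begin

lemma Sp_carrier: "g \<in> carrier (Sp \<omega>) \<longleftrightarrow> (\<forall>x y. \<omega> (blinfun_apply g x) (blinfun_apply g y) = \<omega> x y)"
  by (simp add: Sp_def)

lemma group_Sp: "group (Sp \<omega>)"
proof (rule groupI)
  show "\<exists>h\<in>carrier (Sp \<omega>). h \<otimes>\<^bsub>Sp \<omega>\<^esub> g = \<one>\<^bsub>Sp \<omega>\<^esub>" if "g \<in> carrier (Sp \<omega>)" for g
  proof -
    have sp: "\<omega> (blinfun_apply g x) (blinfun_apply g y) = \<omega> x y" for x y using that by (simp add: Sp_carrier)
    have inj: "inj (blinfun_apply g)"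
    proof (rule linear_injective_0[THEN iffD2, OF linear_blinfun], intro allI impI)
      fix x assume "blinfun_apply g x = 0"
      then have "\<omega> x y = 0" for y using sp[of x y] by simp
      then show "x = 0" by (rule form_nondegenerate)
    qed
    obtain h where h: "linear h" "\<And>x. h (blinfun_apply g x) = x" "\<And>x. blinfun_apply g (h x) = x"
      using linear_injective_isomorphism[OF linear_blinfun inj] by blast
    have app: "blinfun_apply (Blinfun h) = h"
      using h(1) by (intro bounded_linear_Blinfun_apply) (simp add: linear_conv_bounded_linear)
    have "Blinfun h \<in> carrier (Sp \<omega>)"
      unfolding Sp_carrier app using sp h(3) by metis
    moreover have "Blinfun h o\<^sub>L g = id_blinfun"
      by (rule blinfun_eqI) (simp add: app h(2))
    ultimately show ?thesis by (intro bexI[of _ "Blinfun h"]) (simp_all add: Sp_def)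
  qed
qed (auto simp: Sp_def intro!: blinfun_eqI)

abbreviation Sp_inv where "Sp_inv g \<equiv> inv\<^bsub>Sp \<omega>\<^esub> g"

lemma Sp_inv_carrier: "g \<in> carrier (Sp \<omega>) \<Longrightarrow> Sp_inv g \<in> carrier (Sp \<omega>)"
  by (rule group.inv_closed[OF group_Sp])

lemma Sp_inv_apply:
  assumes "g \<in> carrier (Sp \<omega>)"
  shows "blinfun_apply (Sp_inv g) (blinfun_apply g x) = x" "blinfun_apply g (blinfun_apply (Sp_inv g) x) = x"
proof -
  have "Sp_inv g \<otimes>\<^bsub>Sp \<omega>\<^esub> g = \<one>\<^bsub>Sp \<omega>\<^esub>" "g \<otimes>\<^bsub>Sp \<omega>\<^esub> Sp_inv g = \<one>\<^bsub>Sp \<omega>\<^esub>"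
    using group.l_inv[OF group_Sp assms] group.r_inv[OF group_Sp assms] by blast+
  moreover have "h \<otimes>\<^bsub>Sp \<omega>\<^esub> k = \<one>\<^bsub>Sp \<omega>\<^esub> \<Longrightarrow> blinfun_apply h (blinfun_apply k y) = y" for h k y
  proof -
    assume "h \<otimes>\<^bsub>Sp \<omega>\<^esub> k = \<one>\<^bsub>Sp \<omega>\<^esub>"
    then have "h o\<^sub>L k = id_blinfun" by (simp add: Sp_def)
    then have "blinfun_apply (h o\<^sub>L k) y = y" by simp
    then show ?thesis by simp
  qed
  ultimately show "blinfun_apply (Sp_inv g) (blinfun_apply g x) = x" "blinfun_apply g (blinfun_apply (Sp_inv g) x) = x"
    by blast+
qed

text \<open>
  The inverse is the adjoint for \<open>\<omega>\<close>, so its coefficients in a frame depend continuously on \<open>g\<close>.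
\<close>

lemma continuous_on_Sp_inv: "continuous_on (carrier (Sp \<omega>)) (\<lambda>g. blinfun_apply (Sp_inv g) x)"
proof -
  obtain p q where ref: "frame p q" using frame_exists by blast
  have "blinfun_apply (Sp_inv g) x = (\<Sum>k<n. \<omega> x (blinfun_apply g (q k)) *\<^sub>R p k - \<omega> x (blinfun_apply g (p k)) *\<^sub>R q k)"
    if g: "g \<in> carrier (Sp \<omega>)" for g
  proof -
    have "\<omega> (blinfun_apply (Sp_inv g) x) y = \<omega> x (blinfun_apply g y)" for y
      using Sp_inv_apply(2)[OF g, of x] g unfolding Sp_carrier by metis
    then show ?thesis by (subst frame_expansion[OF ref]) simp
  qed
  moreover have "continuous_on (carrier (Sp \<omega>)) (\<lambda>g. \<Sum>k<n. \<omega> x (blinfun_apply g (q k)) *\<^sub>R p k - \<omega> x (blinfun_apply g (p k)) *\<^sub>R q k)"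
    by (intro continuous_intros continuous_form continuous_on_blinfun_eval)
  ultimately show ?thesis by (simp cong: continuous_on_cong_simp)
qed

lemma closed_Sp: "closed (carrier (Sp \<omega>))"
proof -
  have "carrier (Sp \<omega>) = (\<Inter>x. \<Inter>y. {g. \<omega> (blinfun_apply g x) (blinfun_apply g y) = \<omega> x y})"
    by (auto simp: Sp_def)
  then show ?thesis
    by (auto intro!: closed_INT closed_Collect_eq continuous_form continuous_on_blinfun_eval)
qed

lemma compact_Sp_bounded: "compact {g \<in> carrier (Sp \<omega>). norm g \<le> R}"
proof -
  have "{g \<in> carrier (Sp \<omega>). norm g \<le> R} = carrier (Sp \<omega>) \<inter> cball 0 R" by (auto simp: dist_norm)
  then show ?thesis by (simp add: compact_eq_bounded_closed closed_Int closed_Sp bounded_Int)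
qed

end

context polarized begin

abbreviation W where "W \<equiv> complex_primitive_forms n \<omega>"

lemma W_alt_form: "\<Omega> \<in> W \<Longrightarrow> alt_form n \<Omega>"
  by (simp add: complex_primitive_forms_iff)

lemma continuous_on_form_value: "continuous_on D (\<lambda>\<Omega>::(nat \<Rightarrow> 'a) \<Rightarrow> complex. \<Omega> v)"
  by (rule continuous_on_subset[OF continuous_on_product_coordinates]) simp

lemma continuous_on_eval: "continuous_on (W \<times> K) (\<lambda>z. (fst z) (snd z))"
proof (rule continuous_on_alt_form_eval[of "W \<times> K" n fst snd])
  show "alt_form n (fst z)" if "z \<in> W \<times> K" for z :: "((nat \<Rightarrow> 'a) \<Rightarrow> complex) \<times> (nat \<Rightarrow> 'a)"
    using that W_alt_form by auto
  show "continuous_on (W \<times> K) (\<lambda>z. fst z v)" for v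
    by (rule continuous_on_product_then_coordinatewise[OF continuous_on_fst[OF continuous_on_id]])
  show "continuous_on (W \<times> K) (\<lambda>z. snd z i)" for i
    by (rule continuous_on_product_then_coordinatewise[OF continuous_on_snd[OF continuous_on_id]])
qed

text \<open>
  Nonvanishing on a compact set is an open condition.
\<close>

lemma openin_U_set: "openin (top_of_set W) (U_set n \<omega>)"
proof -
  have "openin (top_of_set W) {\<Omega> \<in> W. \<forall>v\<in>unitary_frames. \<Omega> v \<in> - {0}}"
    by (rule openin_forall_compact[OF compact_unitary_frames continuous_on_eval]) auto
  also have "{\<Omega> \<in> W. \<forall>v\<in>unitary_frames. \<Omega> v \<in> - {0}} = U_set n \<omega>" by (auto simp: U_set_iff)
  finally show ?thesis .
qed

theorem openin_U_plus: "openin (top_of_set W) (U_plus n \<omega>)"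
proof -
  have "continuous_on W (\<lambda>\<Omega>. orientation \<Omega> 0 p q)"
    unfolding orientation_def by (intro continuous_intros continuous_on_form_value)
  then have "openin (top_of_set W) (W \<inter> (\<lambda>\<Omega>. orientation \<Omega> 0 p q) -` {0<..})"
    by (rule continuous_openin_preimage_gen) simp
  then have "openin (top_of_set W) (U_set n \<omega> \<inter> (W \<inter> (\<lambda>\<Omega>. orientation \<Omega> 0 p q) -` {0<..}))"
    by (rule openin_Int[OF openin_U_set])
  also have "U_set n \<omega> \<inter> (W \<inter> (\<lambda>\<Omega>. orientation \<Omega> 0 p q) -` {0<..}) = U_plus n \<omega>"
    using U_plus_iff[OF ref] by (auto simp: U_set_def)
  finally show ?thesis .
qed

abbreviation X where "X \<equiv> U_plus n \<omega>"

lemma X_W: "\<Omega> \<in> X \<Longrightarrow> \<Omega> \<in> W" and X_U: "\<Omega> \<in> X \<Longrightarrow> \<Omega> \<in> U_set n \<omega>"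
  by (auto simp: U_plus_def U_set_def)

lemma pullback_U_plus:
  assumes \<Omega>: "\<Omega> \<in> X" and g: "g \<in> carrier (Sp \<omega>)"
  shows "pullback (blinfun_apply g) \<Omega> \<in> X"
proof -
  have sp: "\<omega> (blinfun_apply g x) (blinfun_apply g y) = \<omega> x y" for x y using g by (simp add: Sp_carrier)
  have fr: "frame (\<lambda>i. blinfun_apply g (e i)) (\<lambda>i. blinfun_apply g (f i))" if "frame e f" for e f
    using that by (simp add: hyperbolic_def sp)
  have "pullback (blinfun_apply g) \<Omega> \<in> U_set n \<omega>" unfolding U_set_iff
  proof (intro conjI ballI)
    show "pullback (blinfun_apply g) \<Omega> \<in> W"
      using complex_primitive_forms_pullback[of \<Omega> n \<omega> "blinfun_apply g"] X_W[OF \<Omega>] linear_blinfun[of g] sp by simp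
    fix v assume "v \<in> unitary_frames"
    then have "frame v (\<lambda>i. J (v i))" by (intro unitary_frame) (simp add: unitary_frames_def)
    from U_nonzero[OF X_U[OF \<Omega>] fr[OF this]] show "pullback (blinfun_apply g) \<Omega> v \<noteq> 0" unfolding pullback_def .
  qed
  moreover have "orientation (pullback (blinfun_apply g) \<Omega>) 0 p q > 0"
  proof -
    have "orientation \<Omega> 0 (\<lambda>i. blinfun_apply g (p i)) (\<lambda>i. blinfun_apply g (q i)) > 0"
      using \<Omega> U_plus_iff[OF fr[OF ref]] by blast
    moreover have "(\<lambda>i. blinfun_apply g ((p(0 := q 0)) i)) = (\<lambda>i. blinfun_apply g (p i))(0 := blinfun_apply g (q 0))" by auto
    ultimately show ?thesis by (simp add: orientation_def pullback_def)
  qed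
  ultimately show ?thesis using U_plus_iff[OF ref] by blast
qed

lemma Sp_action_apply: "\<Omega> \<in> X \<Longrightarrow> Sp_action n \<omega> g \<Omega> = pullback (blinfun_apply (Sp_inv g)) \<Omega>"
  by (simp add: Sp_action_def)

lemma Sp_action_eq_iff:
  assumes "g \<in> carrier (Sp \<omega>)" "\<Omega> \<in> X"
  shows "Sp_action n \<omega> g \<Omega> = \<Omega>' \<longleftrightarrow> \<Omega> = pullback (blinfun_apply g) \<Omega>'"
proof
  assume "Sp_action n \<omega> g \<Omega> = \<Omega>'"
  then have "\<Omega>' = pullback (blinfun_apply (Sp_inv g)) \<Omega>" by (simp add: Sp_action_apply[OF assms(2)])
  then show "\<Omega> = pullback (blinfun_apply g) \<Omega>'" by (simp add: pullback_def Sp_inv_apply[OF assms(1)])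
next
  assume eq: "\<Omega> = pullback (blinfun_apply g) \<Omega>'"
  have "pullback (blinfun_apply (Sp_inv g)) (pullback (blinfun_apply g) \<Omega>') = \<Omega>'"
    by (simp add: pullback_def Sp_inv_apply[OF assms(1)])
  then show "Sp_action n \<omega> g \<Omega> = \<Omega>'" using Sp_action_apply[OF assms(2)] eq by metis
qed

lemma Sp_action_closed: "g \<in> carrier (Sp \<omega>) \<Longrightarrow> \<Omega> \<in> X \<Longrightarrow> Sp_action n \<omega> g \<Omega> \<in> X"
  unfolding Sp_action_apply by (intro pullback_U_plus Sp_inv_carrier)

lemma group_action_Sp: "group_action (Sp \<omega>) X (Sp_action n \<omega>)"
proof -
  have bij: "Sp_action n \<omega> g \<in> Bij X" if g: "g \<in> carrier (Sp \<omega>)" for g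
    unfolding Bij_def
  proof (intro IntI CollectI)
    show "Sp_action n \<omega> g \<in> extensional X" by (simp add: Sp_action_def)
    show "bij_betw (Sp_action n \<omega> g) X X"
    proof (rule bij_betw_byWitness[where f' = "pullback (blinfun_apply g)"])
      show "\<forall>\<Omega>\<in>X. pullback (blinfun_apply g) (Sp_action n \<omega> g \<Omega>) = \<Omega>"
        using Sp_action_eq_iff[OF g, THEN iffD1, OF _ refl] by simp
      show "\<forall>\<Omega>\<in>X. Sp_action n \<omega> g (pullback (blinfun_apply g) \<Omega>) = \<Omega>"
        using Sp_action_eq_iff[OF g pullback_U_plus[OF _ g], THEN iffD2, OF _ refl] by simp
    qed (use Sp_action_closed[OF g] pullback_U_plus[OF _ g] in auto)
  qed
  have "Sp_action n \<omega> (g \<otimes>\<^bsub>Sp \<omega>\<^esub> h) = compose X (Sp_action n \<omega> g) (Sp_action n \<omega> h)"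
    if g: "g \<in> carrier (Sp \<omega>)" and h: "h \<in> carrier (Sp \<omega>)" for g h
  proof
    fix \<Omega>
    show "Sp_action n \<omega> (g \<otimes>\<^bsub>Sp \<omega>\<^esub> h) \<Omega> = compose X (Sp_action n \<omega> g) (Sp_action n \<omega> h) \<Omega>"
    proof (cases "\<Omega> \<in> X")
      case True
      have "Sp_inv (g \<otimes>\<^bsub>Sp \<omega>\<^esub> h) = Sp_inv h \<otimes>\<^bsub>Sp \<omega>\<^esub> Sp_inv g"
        by (rule group.inv_mult_group[OF group_Sp g h])
      then have "blinfun_apply (Sp_inv (g \<otimes>\<^bsub>Sp \<omega>\<^esub> h)) x = blinfun_apply (Sp_inv h) (blinfun_apply (Sp_inv g) x)" for x
        by (simp add: Sp_def)
      then show ?thesis using True Sp_action_closed[OF h True]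
        by (simp add: compose_def Sp_action_apply) (simp add: pullback_def)
    qed (simp add: Sp_action_def compose_def)
  qed
  then have "Sp_action n \<omega> \<in> hom (Sp \<omega>) (BijGroup X)"
    using bij by (auto simp: hom_def BijGroup_def)
  then show ?thesis
    unfolding group_action_def group_hom_def group_hom_axioms_def
    using group_Sp group_BijGroup by blast
qed

lemma continuous_on_Sp_action: "continuous_on (carrier (Sp \<omega>) \<times> X) (\<lambda>(g, \<Omega>). Sp_action n \<omega> g \<Omega>)"
proof -
  have "continuous_on (carrier (Sp \<omega>) \<times> X) (\<lambda>z. (snd z) (\<lambda>i. blinfun_apply (Sp_inv (fst z)) (v i)))" for v
  proof (rule continuous_on_alt_form_eval[of _ n snd])
    show "alt_form n (snd z)" if "z \<in> carrier (Sp \<omega>) \<times> X" for z using that W_alt_form X_W by auto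
    show "continuous_on (carrier (Sp \<omega>) \<times> X) (\<lambda>z. snd z v)" for v
      by (rule continuous_on_product_then_coordinatewise[OF continuous_on_snd[OF continuous_on_id]])
    show "continuous_on (carrier (Sp \<omega>) \<times> X) (\<lambda>z. blinfun_apply (Sp_inv (fst z)) (v i))" for i
      by (rule continuous_on_compose2[OF continuous_on_Sp_inv continuous_on_fst[OF continuous_on_id]]) auto
  qed
  then have "continuous_on (carrier (Sp \<omega>) \<times> X) (\<lambda>z. pullback (blinfun_apply (Sp_inv (fst z))) (snd z))"
    unfolding pullback_def by (rule continuous_on_coordinatewise_then_product)
  then show ?thesis by (rule continuous_on_eq) (auto simp: Sp_action_apply)
qed

text \<open>
  On the frame of singular vectors with singular values at least 1, \<open>g\<close> expands the volume by at least
  its largest singular value, that is, by its norm. So a form that is at least \<open>m\<close> on unitary frames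
  has a pullback whose value on this frame is at least \<open>m\<close> times that norm.
\<close>

lemma norm_Sp_bound:
  assumes g: "g \<in> carrier (Sp \<omega>)" and \<Omega>: "alt_form n \<Omega>"
    and m: "m > 0" "\<And>v. v \<in> unitary_frames \<Longrightarrow> cmod (\<Omega> v) \<ge> m"
    and M: "\<And>v. v \<in> unitary_frames \<Longrightarrow> cmod (pullback (blinfun_apply g) \<Omega> v) \<le> M"
    and C: "\<And>y. sqrt (G y y) \<le> C * norm y" "C \<ge> 0"
  shows "norm g \<le> norm_bound * (M / m) * C"
proof -
  have sp: "\<omega> (blinfun_apply g x) (blinfun_apply g y) = \<omega> x y" for x y using g by (simp add: Sp_carrier)
  obtain v \<mu> where v: "unitary n v" and \<mu>: "\<And>i. i < n \<Longrightarrow> \<mu> i \<ge> 1"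
    "\<And>i y. i < n \<Longrightarrow> G (blinfun_apply g (v i)) (blinfun_apply g y) = \<mu> i * G (v i) y"
    and top: "\<And>y. G (blinfun_apply g y) (blinfun_apply g y) \<le> \<mu> 0 * G y y"
    using singular_value_frame[OF linear_blinfun sp] by blast
  define c where "c i = sqrt (\<mu> i)" for i
  have c: "c i \<ge> 1" "c i * c i = \<mu> i" if "i < n" for i using \<mu>(1)[OF that] by (auto simp: c_def)
  define v' where "v' i = (if i < n then v i else 0)" for i
  define w where "w i = (if i < n then (1 / c i) *\<^sub>R blinfun_apply g (v i) else 0)" for i
  have v': "v' \<in> unitary_frames"
    using unitary_cong[OF v, of v'] by (auto simp: unitary_frames_def v'_def)
  have "unitary n w"
    unfolding unitary_def
  proof (intro allI impI)
    fix i j assume ij: "i < n" "j < n"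
    have "G (w i) (w j) = \<mu> i * G (v i) (v j) / (c i * c j)" using ij by (simp add: w_def \<mu>(2))
    also have "\<dots> = (if i = j then 1 else 0)" using v ij c[OF ij(1)] \<mu>(1)[OF ij(1)] by (auto simp: unitary_def)
    finally show "\<omega> (w i) (w j) = 0 \<and> G (w i) (w j) = (if i = j then 1 else 0)"
      using v ij by (simp add: w_def sp unitary_def)
  qed
  then have w: "w \<in> unitary_frames" by (simp add: unitary_frames_def w_def)
  have "pullback (blinfun_apply g) \<Omega> v' = \<Omega> (\<lambda>i. c i *\<^sub>R w i)"
    unfolding pullback_def
  proof (rule alt_form_cong[OF \<Omega>])
    fix i assume i: "i < n"
    then have "c i \<noteq> 0" using c(1)[OF i] by auto
    then show "blinfun_apply g (v' i) = c i *\<^sub>R w i" using i by (simp add: v'_def w_def)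
  qed
  also have "\<dots> = (\<Prod>i<n. c i) *\<^sub>R \<Omega> w" by (rule alt_form_scale[OF \<Omega>])
  finally have eq: "cmod (pullback (blinfun_apply g) \<Omega> v') = \<bar>\<Prod>i<n. c i\<bar> * cmod (\<Omega> w)" by simp
  have "(\<Prod>i<n. c i) = c 0 * (\<Prod>i\<in>{..<n} - {0}. c i)" using n_pos by (intro prod.remove) auto
  moreover have "(\<Prod>i\<in>{..<n} - {0}. c i) \<ge> 1" using c by (intro prod_ge_1) auto
  ultimately have "c 0 * 1 \<le> (\<Prod>i<n. c i)" using c(1)[OF n_pos] by (simp only:) (intro mult_left_mono, auto)
  then have c0: "c 0 \<le> \<bar>\<Prod>i<n. c i\<bar>" by simp
  have "c 0 * m \<le> \<bar>\<Prod>i<n. c i\<bar> * cmod (\<Omega> w)"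
    using c0 m(1) m(2)[OF w] by (intro mult_mono) auto
  also have "\<dots> \<le> M" using M[OF v'] eq by simp
  finally have cM: "c 0 \<le> M / m" using m(1) by (simp add: pos_le_divide_eq)
  have c0': "c 0 \<ge> 0" using c(1)[OF n_pos] by simp
  show ?thesis
  proof (rule norm_blinfun_bound)
    show "0 \<le> norm_bound * (M / m) * C" 
      using norm_bound_nonneg C(2) order.trans[OF c0' cM] by (intro mult_nonneg_nonneg)
    fix y
    have "norm (blinfun_apply g y) \<le> norm_bound * sqrt (G (blinfun_apply g y) (blinfun_apply g y))" by (rule norm_le_G)
    also have "\<dots> \<le> norm_bound * sqrt (\<mu> 0 * G y y)"
      using top norm_bound_nonneg by (intro mult_left_mono) auto
    also have "\<dots> = norm_bound * (c 0 * sqrt (G y y))" by (simp add: c_def real_sqrt_mult)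
    also have "\<dots> \<le> norm_bound * ((M / m) * (C * norm y))"
      using norm_bound_nonneg cM c0' C(1)[of y] G_nonneg[of y] by (intro mult_left_mono mult_mono) auto
    finally show "norm (blinfun_apply g y) \<le> norm_bound * (M / m) * C * norm y" by (simp add: mult.assoc)
  qed
qed

lemma G_norm_bound: "\<exists>C\<ge>0. \<forall>y. sqrt (G y y) \<le> C * norm y"
proof -
  have "bilinear G" by (simp add: bilinear_def linear_G_left linear_G_right)
  then obtain B where B: "B > 0" "\<And>x y. norm (G x y) \<le> B * norm x * norm y"
    using bilinear_bounded_pos by blast
  have "sqrt (G y y) \<le> sqrt B * norm y" for y
  proof -
    have "G y y \<le> B * (norm y)^2" using B(2)[of y y] by (simp add: power2_eq_square mult.assoc)
    then have "sqrt (G y y) \<le> sqrt (B * (norm y)^2)" by simp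
    then show ?thesis by (simp add: real_sqrt_mult)
  qed
  then show ?thesis using B(1) by (intro exI[of _ "sqrt B"]) auto
qed

text \<open>
  Near \<open>\<Omega>1\<close> the forms are bounded above on unitary frames, and near \<open>\<Omega>2\<close> they are bounded away from
  zero.
\<close>

theorem locally_bounded_return:
  assumes \<Omega>1: "\<Omega>1 \<in> X" and \<Omega>2: "\<Omega>2 \<in> X"
  shows "\<exists>N1 N2 R. openin (top_of_set X) N1 \<and> openin (top_of_set X) N2 \<and> \<Omega>1 \<in> N1 \<and> \<Omega>2 \<in> N2 \<and>
     (\<forall>g\<in>carrier (Sp \<omega>). \<forall>\<Omega>\<in>N1. Sp_action n \<omega> g \<Omega> \<in> N2 \<longrightarrow> norm g \<le> R)"
proof -
  obtain C where C: "C \<ge> 0" "\<And>y. sqrt (G y y) \<le> C * norm y" using G_norm_bound by blast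
  let ?K = unitary_frames
  have contK: "continuous_on ?K (\<lambda>v. cmod (\<Omega> v))" if "\<Omega> \<in> X" for \<Omega>
  proof -
    have "continuous_on ?K (\<lambda>v. (fst (\<Omega>, v)) (snd (\<Omega>, v)))"
      by (rule continuous_on_compose2[OF continuous_on_eval[of ?K]]) (use X_W[OF that] in \<open>auto intro!: continuous_intros\<close>)
    then show ?thesis by (intro continuous_on_norm) simp
  qed
  have contX: "continuous_on (X \<times> ?K) (\<lambda>z. cmod ((fst z) (snd z)))"
    by (intro continuous_on_norm continuous_on_subset[OF continuous_on_eval[of ?K]]) (use X_W in auto)
  have "(\<lambda>i. if i < n then p i else 0) \<in> ?K"
    using unitary_cong[OF unitary_ref, of "\<lambda>i. if i < n then p i else 0"] by (auto simp: unitary_frames_def)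
  then have ne: "?K \<noteq> {}" by blast
  obtain v1 where v1: "\<And>v. v \<in> ?K \<Longrightarrow> cmod (\<Omega>1 v) \<le> cmod (\<Omega>1 v1)"
    using continuous_attains_sup[OF compact_unitary_frames ne contK[OF \<Omega>1]] by blast
  obtain v2 where v2: "v2 \<in> ?K" "\<And>v. v \<in> ?K \<Longrightarrow> cmod (\<Omega>2 v2) \<le> cmod (\<Omega>2 v)"
    using continuous_attains_inf[OF compact_unitary_frames ne contK[OF \<Omega>2]] by blast
  define M where "M = cmod (\<Omega>1 v1) + 1"
  define m where "m = cmod (\<Omega>2 v2) / 2"
  have m: "m > 0" using v2(1) X_U[OF \<Omega>2] U_set_iff by (auto simp: m_def)
  define N1 where "N1 = {\<Omega> \<in> X. \<forall>v\<in>?K. cmod (\<Omega> v) \<in> {..<M}}"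
  define N2 where "N2 = {\<Omega> \<in> X. \<forall>v\<in>?K. cmod (\<Omega> v) \<in> {m<..}}"
  have "openin (top_of_set X) N1" "openin (top_of_set X) N2"
    unfolding N1_def N2_def by (rule openin_forall_compact[OF compact_unitary_frames contX]; simp)+
  moreover have "\<Omega>1 \<in> N1" using \<Omega>1 v1 by (force simp: N1_def M_def)
  moreover have "\<Omega>2 \<in> N2"
  proof -
    have "m < cmod (\<Omega>2 v)" if "v \<in> ?K" for v using v2(2)[OF that] m unfolding m_def by linarith
    then show ?thesis using \<Omega>2 by (simp add: N2_def)
  qed
  moreover have "norm g \<le> norm_bound * (M / m) * C"
    if g: "g \<in> carrier (Sp \<omega>)" and "\<Omega> \<in> N1" "Sp_action n \<omega> g \<Omega> \<in> N2" for g \<Omega>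
  proof (rule norm_Sp_bound[OF g _ m])
    let ?\<Omega>' = "Sp_action n \<omega> g \<Omega>"
    have X: "\<Omega> \<in> X" "?\<Omega>' \<in> X" using that by (auto simp: N1_def N2_def)
    then have "pullback (blinfun_apply g) ?\<Omega>' = \<Omega>" using Sp_action_eq_iff[OF g X(1), THEN iffD1, OF refl] by simp
    then show "cmod (pullback (blinfun_apply g) ?\<Omega>' v) \<le> M" if "v \<in> ?K" for v
      using \<open>\<Omega> \<in> N1\<close> that by (auto simp: N1_def)
    show "alt_form n ?\<Omega>'" using X W_alt_form X_W by blast
    show "m \<le> cmod (?\<Omega>' v)" if "v \<in> ?K" for v using \<open>?\<Omega>' \<in> N2\<close> that by (auto simp: N2_def)
  qed (use C in auto)
  ultimately show ?thesis by blast
qed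

text \<open>
  Written with the pullback along \<open>g\<close> in place of that along its inverse, the graph is cut out by
  equations between continuous functions.
\<close>

lemma closedin_action_graph:
  "closedin (top_of_set (carrier (Sp \<omega>) \<times> X \<times> X))
     {z \<in> carrier (Sp \<omega>) \<times> X \<times> X. Sp_action n \<omega> (fst z) (snd (snd z)) = fst (snd z)}"
proof -
  let ?S = "carrier (Sp \<omega>) \<times> X \<times> X"
  define h where "h v z = (snd (snd z)) v - (fst (snd z)) (\<lambda>i. blinfun_apply (fst z) (v i))"
    for v and z :: "('a \<Rightarrow>\<^sub>L 'a) \<times> ((nat \<Rightarrow> 'a) \<Rightarrow> complex) \<times> ((nat \<Rightarrow> 'a) \<Rightarrow> complex)"
  have cont: "continuous_on ?S (h v)" for v
    unfolding h_def
  proof (rule continuous_on_diff)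
    show "continuous_on ?S (\<lambda>z. snd (snd z) v)"
      by (rule continuous_on_product_then_coordinatewise[OF continuous_on_snd[OF continuous_on_snd[OF continuous_on_id]]])
    show "continuous_on ?S (\<lambda>z. (fst (snd z)) (\<lambda>i. blinfun_apply (fst z) (v i)))"
    proof (rule continuous_on_alt_form_eval[of _ n "\<lambda>z. fst (snd z)"])
      show "alt_form n (fst (snd z))" if "z \<in> ?S" for z using that W_alt_form X_W by auto
      show "continuous_on ?S (\<lambda>z. fst (snd z) v)" for v
        by (rule continuous_on_product_then_coordinatewise[OF continuous_on_fst[OF continuous_on_snd[OF continuous_on_id]]])
      show "continuous_on ?S (\<lambda>z. blinfun_apply (fst z) (v i))" for i
        by (intro blinfun.continuous_on continuous_on_fst continuous_on_id continuous_on_const)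
    qed
  qed
  have "{z \<in> ?S. Sp_action n \<omega> (fst z) (snd (snd z)) = fst (snd z)} = (\<Inter>v. {z \<in> ?S. h v z = 0})"
  proof (rule Set.set_eqI)
    fix z
    have "h v z = 0 \<longleftrightarrow> (snd (snd z)) v = pullback (blinfun_apply (fst z)) (fst (snd z)) v" for v
      by (simp add: h_def pullback_def)
    then have "(\<forall>v. h v z = 0) \<longleftrightarrow> snd (snd z) = pullback (blinfun_apply (fst z)) (fst (snd z))"
      by (simp add: fun_eq_iff)
    moreover have "Sp_action n \<omega> (fst z) (snd (snd z)) = fst (snd z) \<longleftrightarrow>
        snd (snd z) = pullback (blinfun_apply (fst z)) (fst (snd z))" if "z \<in> ?S"
      using that by (intro Sp_action_eq_iff) auto
    ultimately show "z \<in> {z \<in> ?S. Sp_action n \<omega> (fst z) (snd (snd z)) = fst (snd z)} \<longleftrightarrow>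
        z \<in> (\<Inter>v. {z \<in> ?S. h v z = 0})" by auto
  qed
  moreover have "closedin (top_of_set ?S) (\<Inter>v. {z \<in> ?S. h v z = 0})"
    by (rule closedin_INT) (auto intro: continuous_closedin_preimage_constant cont)
  ultimately show ?thesis by simp
qed

text \<open>
  Over a small open set of the target only a compact set of group elements occurs, and the projection
  along a compact factor is closed.
\<close>

theorem Sp_action_proper_map:
  "proper_map (top_of_set (carrier (Sp \<omega>) \<times> X)) (top_of_set (X \<times> X)) (\<lambda>(g, \<Omega>). (Sp_action n \<omega> g \<Omega>, \<Omega>))"
proof -
  let ?S = "carrier (Sp \<omega>)"
  let ?f = "\<lambda>(g, \<Omega>). (Sp_action n \<omega> g \<Omega>, \<Omega>)"
  let ?K = "\<lambda>R. {g \<in> ?S. norm g \<le> R}"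
  let ?gr = "{z \<in> ?S \<times> X \<times> X. Sp_action n \<omega> (fst z) (snd (snd z)) = fst (snd z)}"
  have closed: "closedin (top_of_set (X \<times> X)) (?f ` C)" if C: "closedin (top_of_set (?S \<times> X)) C" for C
  proof -
    have CS: "C \<subseteq> ?S \<times> X" using C closedin_imp_subset by blast
    have sub: "?f ` C \<subseteq> X \<times> X" using CS Sp_action_closed by auto
    have "openin (top_of_set (X \<times> X)) (X \<times> X - ?f ` C)"
    proof (subst openin_subopen, intro ballI)
      fix y assume y: "y \<in> X \<times> X - ?f ` C"
      obtain \<Omega>2 \<Omega>1 where y2: "y = (\<Omega>2, \<Omega>1)" by (cases y)
      obtain N1 N2 R where N: "openin (top_of_set X) N1" "openin (top_of_set X) N2" "\<Omega>1 \<in> N1" "\<Omega>2 \<in> N2"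
        and R: "\<And>g \<Omega>. g \<in> ?S \<Longrightarrow> \<Omega> \<in> N1 \<Longrightarrow> Sp_action n \<omega> g \<Omega> \<in> N2 \<Longrightarrow> norm g \<le> R"
      proof -
        have "\<Omega>1 \<in> X" "\<Omega>2 \<in> X" using y y2 by auto
        from locally_bounded_return[OF this] show thesis using that by blast
      qed
      define D where "D = {z \<in> ?K R \<times> X \<times> X. (fst z, snd (snd z)) \<in> C \<and> z \<in> ?gr}"
      have "closedin (top_of_set (?S \<times> X \<times> X)) ((?S \<times> X \<times> X) \<inter> (\<lambda>z. (fst z, snd (snd z))) -` C)"
        by (rule continuous_closedin_preimage_gen[OF _ _ C])
           (auto intro!: continuous_on_Pair continuous_on_fst continuous_on_snd continuous_on_id)
      then have "closedin (top_of_set (?S \<times> X \<times> X)) (((?S \<times> X \<times> X) \<inter> (\<lambda>z. (fst z, snd (snd z))) -` C) \<inter> ?gr)"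
        by (rule closedin_Int[OF _ closedin_action_graph])
      then have "closedin (top_of_set (?K R \<times> X \<times> X)) ((?K R \<times> X \<times> X) \<inter> (((?S \<times> X \<times> X) \<inter> (\<lambda>z. (fst z, snd (snd z))) -` C) \<inter> ?gr))"
        by (rule closedin_top_of_set_Int) auto
      also have "(?K R \<times> X \<times> X) \<inter> (((?S \<times> X \<times> X) \<inter> (\<lambda>z. (fst z, snd (snd z))) -` C) \<inter> ?gr) = D"
        by (auto simp: D_def)
      finally have "closedin (top_of_set (X \<times> X)) (snd ` D)"
        by (rule closedin_exists_compact[OF compact_Sp_bounded])
      then have o1: "openin (top_of_set (X \<times> X)) (X \<times> X - snd ` D)" by (simp add: openin_diff)
      have o2: "openin (top_of_set (X \<times> X)) (N2 \<times> N1)" using N by (simp add: openin_Times)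
      \<comment> \<open>Over the neighbourhood \<open>N2 \<times> N1\<close> of \<open>y\<close> the image of \<open>C\<close> is the projection of \<open>D\<close>.\<close>
      have Df: "snd ` D \<subseteq> ?f ` C"
      proof
        fix z assume "z \<in> snd ` D"
        then obtain g where "(g, z) \<in> D" by auto
        then have "(g, snd z) \<in> C" "Sp_action n \<omega> g (snd z) = fst z" by (auto simp: D_def)
        then show "z \<in> ?f ` C" by (intro image_eqI[of _ _ "(g, snd z)"]) auto
      qed
      have "y \<in> (X \<times> X - snd ` D) \<inter> (N2 \<times> N1)" using y y2 N Df by auto
      moreover have "(X \<times> X - snd ` D) \<inter> (N2 \<times> N1) \<subseteq> X \<times> X - ?f ` C"
      proof
        fix z assume z: "z \<in> (X \<times> X - snd ` D) \<inter> (N2 \<times> N1)"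
        have "z \<notin> ?f ` C"
        proof
          assume "z \<in> ?f ` C"
          then obtain g \<Omega> where g: "(g, \<Omega>) \<in> C" "z = (Sp_action n \<omega> g \<Omega>, \<Omega>)" by auto
          then have "g \<in> ?S" "\<Omega> \<in> X" using CS by auto
          then have "norm g \<le> R" using R[of g \<Omega>] z g by auto
          then have "(g, z) \<in> D" using g z \<open>g \<in> ?S\<close> by (auto simp: D_def)
          then show False using z by (metis DiffD2 IntD1 image_eqI snd_conv)
        qed
        then show "z \<in> X \<times> X - ?f ` C" using z by blast
      qed
      ultimately show "\<exists>T. openin (top_of_set (X \<times> X)) T \<and> y \<in> T \<and> T \<subseteq> X \<times> X - ?f ` C"
        using openin_Int[OF o1 o2] by blast
    qed
    then show ?thesis using sub by (simp add: closedin_def)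
  qed
  have fibre: "compactin (top_of_set (?S \<times> X)) {z \<in> ?S \<times> X. ?f z = y}" if "y \<in> X \<times> X" for y
  proof -
    obtain \<Omega>2 \<Omega>1 where y2: "y = (\<Omega>2, \<Omega>1)" by (cases y)
    then have X12: "\<Omega>1 \<in> X" "\<Omega>2 \<in> X" using that by auto
    obtain N1 N2 R where N: "\<Omega>1 \<in> N1" "\<Omega>2 \<in> N2"
      and R: "\<And>g \<Omega>. g \<in> ?S \<Longrightarrow> \<Omega> \<in> N1 \<Longrightarrow> Sp_action n \<omega> g \<Omega> \<in> N2 \<Longrightarrow> norm g \<le> R"
      using locally_bounded_return[OF X12] by blast
    have "closedin (top_of_set ?S) (?S \<inter> (\<lambda>g. (g, \<Omega>2, \<Omega>1)) -` ?gr)"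
      by (rule continuous_closedin_preimage_gen[OF _ _ closedin_action_graph]) (use X12 in \<open>auto intro!: continuous_intros\<close>)
    then have "closed (?S \<inter> (\<lambda>g. (g, \<Omega>2, \<Omega>1)) -` ?gr)" using closed_Sp closedin_closed_trans by blast
    then have "compact (?K R \<inter> (?S \<inter> (\<lambda>g. (g, \<Omega>2, \<Omega>1)) -` ?gr))"
      using compact_Sp_bounded by (rule compact_Int_closed[rotated])
    moreover have "?K R \<inter> (?S \<inter> (\<lambda>g. (g, \<Omega>2, \<Omega>1)) -` ?gr) = {g \<in> ?S. Sp_action n \<omega> g \<Omega>1 = \<Omega>2}"
      using R[OF _ N(1)] N(2) X12 by auto
    ultimately have "compact ((\<lambda>g. (g, \<Omega>1)) ` {g \<in> ?S. Sp_action n \<omega> g \<Omega>1 = \<Omega>2})"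
      by (intro compact_continuous_image) (auto intro!: continuous_intros)
    moreover have "(\<lambda>g. (g, \<Omega>1)) ` {g \<in> ?S. Sp_action n \<omega> g \<Omega>1 = \<Omega>2} = {z \<in> ?S \<times> X. ?f z = y}"
      using X12 y2 by auto
    ultimately show ?thesis by (simp add: compactin_subtopology)
  qed
  show ?thesis unfolding proper_map_def closed_map_def using closed fibre by simp
qed

theorem acts_properly_Sp: "acts_properly (Sp \<omega>) X (Sp_action n \<omega>)"
  unfolding acts_properly_def
  using group_action_Sp continuous_on_Sp_action Sp_action_proper_map by blast

end

section \<open>Semialgebraicity\<close>


lemma function_algebra_polynomial: "function_algebra {f. polynomial_function_on W f}"
  by standard (auto intro: polynomial_function_on.intros)

lemma semialgebraic_in_of_semialg:
  "semialg {f. polynomial_function_on W f} W S \<Longrightarrow> semialgebraic_in W S"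
  by (induction rule: semialg.induct) (auto intro: semialgebraic_in.intros)

context function_algebra begin

lemma sum_mem: "finite I \<Longrightarrow> (\<And>i. i \<in> I \<Longrightarrow> f i \<in> A) \<Longrightarrow> (\<lambda>x. \<Sum>i\<in>I. f i x) \<in> A"
  by (induction I rule: finite_induct) (auto intro: const add)

end

context polarized begin

definition basis_vec :: "nat \<Rightarrow> 'a" where
  "basis_vec = (SOME b. bij_betw b {..<2 * n} Basis)"

lemma basis_vec: "bij_betw basis_vec {..<2 * n} Basis"
proof -
  have "\<exists>b. bij_betw b {..<2 * n} (Basis :: 'a set)"
    using ex_bij_betw_nat_finite[of "Basis :: 'a set"] by (simp add: dim atLeast0LessThan)
  then show ?thesis unfolding basis_vec_def by (rule someI_ex)
qed

text \<open>
  Coordinates on the tuples of vectors: the entries of the vector with index \<open>i\<close> are numbered from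
  \<open>i * (2 * n)\<close> on.
\<close>

definition tuple :: "(nat \<Rightarrow> real) \<Rightarrow> nat \<Rightarrow> 'a" where
  "tuple x i = (if i < n then \<Sum>k<2 * n. x (i * (2 * n) + k) *\<^sub>R basis_vec k else 0)"

lemma tuple_surj:
  assumes "\<And>i. i \<ge> n \<Longrightarrow> v i = 0"
  shows "\<exists>x. tuple x = v"
proof
  define x where "x j = v (j div (2 * n)) \<bullet> basis_vec (j mod (2 * n))" for j
  show "tuple x = v"
  proof
    fix i
    show "tuple x i = v i"
    proof (cases "i < n")
      case True
      have "tuple x i = (\<Sum>k<2 * n. (v i \<bullet> basis_vec k) *\<^sub>R basis_vec k)"
        using True by (simp add: tuple_def x_def)
      also have "\<dots> = (\<Sum>b\<in>Basis. (v i \<bullet> b) *\<^sub>R b)"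
        by (rule sum.reindex_bij_betw[OF basis_vec])
      finally show ?thesis by (simp add: euclidean_representation)
    qed (use assms in \<open>simp add: tuple_def\<close>)
  qed
qed

abbreviation polys where "polys \<equiv> {f. polynomial_function_on W f}"
abbreviation params where "params \<equiv> poly_in (n * (2 * n)) polys"

lemma function_algebra_params: "function_algebra params"
  by (rule function_algebra.function_algebra_poly_in[OF function_algebra_polynomial])

lemma coordinate_params:
  assumes "i < n" "k < 2 * n" shows "(\<lambda>z. snd z (i * (2 * n) + k)) \<in> params"
proof (rule poly_in.var)
  have "i * (2 * n) + k < i * (2 * n) + 2 * n" using assms by simp
  also have "\<dots> = Suc i * (2 * n)" by simp
  also have "\<dots> \<le> n * (2 * n)" using assms by (intro mult_le_mono1) simp
  finally show "i * (2 * n) + k < n * (2 * n)" .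
qed

lemma bilinear_tuple_params:
  assumes B: "bilinear B" and ij: "i < n" "j < n"
  shows "(\<lambda>z. B (tuple (snd z) i) (tuple (snd z) j)) \<in> params"
proof -
  interpret function_algebra params by (rule function_algebra_params)
  have l: "linear (\<lambda>x. B x y)" and r: "linear (\<lambda>y. B x y)" for x y using B by (auto simp: bilinear_def)
  have "(\<lambda>z. B (tuple (snd z) i) (tuple (snd z) j)) = (\<lambda>z. \<Sum>k<2 * n. \<Sum>l<2 * n.
     snd z (i * (2 * n) + k) * (snd z (j * (2 * n) + l) * B (basis_vec k) (basis_vec l)))"
    using ij by (simp add: tuple_def linear_sum[OF l] linear_scale[OF l])
       (simp add: linear_sum[OF r] linear_scale[OF r] sum_distrib_left mult_ac)
  also have "\<dots> \<in> params"
    by (intro sum_mem mult coordinate_params ij const) auto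
  finally show ?thesis .
qed

text \<open>
  The value of a form on a tuple is polynomial in the coordinates of the tuple, with coefficients that
  are linear in the form. As for continuity, the arguments are expanded one at a time.
\<close>

lemma value_tuple_params:
  fixes h :: "complex \<Rightarrow> real"
  assumes h: "linear h"
  shows "\<exists>f\<in>params. \<forall>\<Omega>\<in>W. \<forall>x. f (\<Omega>, x) = h (\<Omega> (tuple x))"
proof -
  interpret function_algebra params by (rule function_algebra_params)
  have "j \<le> n \<Longrightarrow> \<exists>f\<in>params. \<forall>\<Omega>\<in>W. \<forall>x. f (\<Omega>, x) = h (\<Omega> (\<lambda>i. if i < j then tuple x i else \<phi> i))" for j \<phi>
  proof (induction j arbitrary: \<phi>)
    case 0
    have "linear_functional_on W (\<lambda>\<Omega>. h (\<Omega> \<phi>))"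
      unfolding linear_functional_on_def using linear_add[OF h] linear_scale[OF h]
      by (simp flip: scaleR_conv_of_real)
    then have "(\<lambda>z. h ((fst z) \<phi>)) \<in> params"
      by (intro poly_in.base[of "\<lambda>\<Omega>. h (\<Omega> \<phi>)"]) (auto intro: polynomial_function_on.linear)
    then show ?case by (intro bexI[of _ "\<lambda>z. h ((fst z) \<phi>)"]) auto
  next
    case (Suc j)
    then have j: "j < n" by simp
    have "\<forall>k. \<exists>f\<in>params. \<forall>\<Omega>\<in>W. \<forall>x. f (\<Omega>, x) = h (\<Omega> (\<lambda>i. if i < j then tuple x i else (\<phi>(j := basis_vec k)) i))"
      using Suc by auto
    then obtain f where f: "\<And>k. f k \<in> params"
      "\<And>k \<Omega> x. \<Omega> \<in> W \<Longrightarrow> f k (\<Omega>, x) = h (\<Omega> (\<lambda>i. if i < j then tuple x i else (\<phi>(j := basis_vec k)) i))"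
    proof -
      from \<open>\<forall>k. \<exists>f\<in>params. \<forall>\<Omega>\<in>W. \<forall>x. f (\<Omega>, x) = h (\<Omega> (\<lambda>i. if i < j then tuple x i else (\<phi>(j := basis_vec k)) i))\<close>
      obtain f where "\<forall>k. f k \<in> params \<and> (\<forall>\<Omega>\<in>W. \<forall>x. f k (\<Omega>, x) = h (\<Omega> (\<lambda>i. if i < j then tuple x i else (\<phi>(j := basis_vec k)) i)))"
        unfolding Bex_def by (rule choice[THEN exE])
      then show thesis using that[of f] by simp
    qed
    define F where "F z = (\<Sum>k<2 * n. snd z (j * (2 * n) + k) * f k z)" for z
    have "F \<in> params" unfolding F_def[abs_def]
      by (intro sum_mem mult coordinate_params j f) auto
    moreover have "F (\<Omega>, x) = h (\<Omega> (\<lambda>i. if i < Suc j then tuple x i else \<phi> i))" if "\<Omega> \<in> W" for \<Omega> x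
    proof -
      define u where "u = (\<lambda>i. if i < j then tuple x i else \<phi> i)"
      have 1: "(\<lambda>i. if i < j then tuple x i else (\<phi>(j := y)) i) = u(j := y)" for y by (auto simp: u_def)
      have 2: "(\<lambda>i. if i < Suc j then tuple x i else \<phi> i) = u(j := tuple x j)" by (auto simp: u_def less_Suc_eq)
      note lin = linear_compose[OF alt_form_linear[OF W_alt_form[OF that] j, of u] h, unfolded o_def]
      have "tuple x j = (\<Sum>k<2 * n. x (j * (2 * n) + k) *\<^sub>R basis_vec k)" using j by (simp add: tuple_def)
      then show ?thesis unfolding F_def 2
        by (simp only: f(2)[OF that] 1 fst_conv snd_conv linear_sum[OF lin] linear_scale[OF lin] real_scaleR_def)
    qed
    ultimately show ?case by blast
  qed
  from this[OF order_refl, of "\<lambda>_. 0"] obtain f where f: "f \<in> params"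
    "\<And>\<Omega> x. \<Omega> \<in> W \<Longrightarrow> f (\<Omega>, x) = h (\<Omega> (\<lambda>i. if i < n then tuple x i else 0))" by auto
  have "(\<lambda>i. if i < n then tuple x i else 0) = tuple x" for x by (auto simp: tuple_def)
  then show ?thesis using f by (intro bexI[of _ f]) auto
qed

text \<open>
  The complement consists of the forms that vanish on some unitary frame. This is the projection of
  a set given by polynomial equations in the form and the coordinates of the frame.
\<close>

lemma semialg_U_set: "semialg polys W (U_set n \<omega>)"
proof -
  interpret P: function_algebra params by (rule function_algebra_params)
  interpret Q: function_algebra polys by (rule function_algebra_polynomial)
  obtain fr where fr: "fr \<in> params" "\<And>\<Omega> x. \<Omega> \<in> W \<Longrightarrow> fr (\<Omega>, x) = Re (\<Omega> (tuple x))"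
    using value_tuple_params[of Re] by (auto simp: linear_iff)
  obtain fi where fi: "fi \<in> params" "\<And>\<Omega> x. \<Omega> \<in> W \<Longrightarrow> fi (\<Omega>, x) = Im (\<Omega> (tuple x))"
    using value_tuple_params[of Im] by (auto simp: linear_iff)
  have bil: "bilinear G" "bilinear \<omega>"
    by (simp_all add: bilinear_def linear_G_left linear_G_right linear_left linear_right)
  let ?WU = "W \<times> (UNIV :: (nat \<Rightarrow> real) set)"
  have pair: "semialg params ?WU {z \<in> ?WU. \<forall>ij\<in>{..<n} \<times> {..<n}. Q (fst ij) (snd ij) z}"
    if "\<And>i j. i < n \<Longrightarrow> j < n \<Longrightarrow> semialg params ?WU {z \<in> ?WU. Q i j z}" for Q
    by (rule P.semialg_finite_conj) (use that in auto)
  define S where "S = {z \<in> ?WU. \<forall>ij\<in>{..<n} \<times> {..<n}. \<omega> (tuple (snd z) (fst ij)) (tuple (snd z) (snd ij)) = 0} \<inter>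
     {z \<in> ?WU. \<forall>ij\<in>{..<n} \<times> {..<n}. G (tuple (snd z) (fst ij)) (tuple (snd z) (snd ij)) - (if fst ij = snd ij then 1 else 0) = 0} \<inter>
     ({z \<in> ?WU. fr z = 0} \<inter> {z \<in> ?WU. fi z = 0})"
  have S: "semialg params ?WU S" unfolding S_def
    by (intro semialg.inter pair P.semialg_zero P.diff bilinear_tuple_params bil P.const fr fi)
  have iff: "(\<exists>x. (\<Omega>, x) \<in> S) \<longleftrightarrow> (\<exists>v\<in>unitary_frames. \<Omega> v = 0)" if "\<Omega> \<in> W" for \<Omega>
  proof -
    have *: "(\<Omega>, x) \<in> S \<longleftrightarrow> tuple x \<in> unitary_frames \<and> \<Omega> (tuple x) = 0" for x
      using that fr(2) fi(2) by (auto simp: S_def unitary_frames_def unitary_def complex_eq_iff tuple_def)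
    show ?thesis
    proof
      assume "\<exists>v\<in>unitary_frames. \<Omega> v = 0"
      then obtain v where v: "v \<in> unitary_frames" "\<Omega> v = 0" by blast
      then obtain x where "tuple x = v" using tuple_surj[of v] by (auto simp: unitary_frames_def)
      then show "\<exists>x. (\<Omega>, x) \<in> S" using v * by blast
    qed (use * in blast)
  qed
  have "semialg polys W (W - {\<Omega> \<in> W. \<exists>x. (\<Omega>, x) \<in> S})"
    by (rule semialg.compl[OF Q.semialg_projection[OF S]])
  also have "W - {\<Omega> \<in> W. \<exists>x. (\<Omega>, x) \<in> S} = U_set n \<omega>"
  proof (rule Set.set_eqI)
    fix \<Omega>
    show "\<Omega> \<in> W - {\<Omega> \<in> W. \<exists>x. (\<Omega>, x) \<in> S} \<longleftrightarrow> \<Omega> \<in> U_set n \<omega>"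
      using iff[of \<Omega>] unfolding U_set_iff by blast
  qed
  finally show ?thesis .
qed

theorem semialgebraic_U_plus: "semialgebraic_in W (U_plus n \<omega>)"
proof -
  interpret Q: function_algebra polys by (rule function_algebra_polynomial)
  have "(\<lambda>\<Omega>. Re (\<Omega> v)) \<in> polys" "(\<lambda>\<Omega>. Im (\<Omega> v)) \<in> polys" for v
    by (auto intro!: polynomial_function_on.linear simp: linear_functional_on_def)
  then have "(\<lambda>\<Omega>. Re (\<Omega> p) * Im (\<Omega> (p(0 := q 0))) - Im (\<Omega> p) * Re (\<Omega> (p(0 := q 0)))) \<in> polys"
    by (intro Q.diff Q.mult)
  moreover have "(\<lambda>\<Omega>. Re (\<Omega> p) * Im (\<Omega> (p(0 := q 0))) - Im (\<Omega> p) * Re (\<Omega> (p(0 := q 0)))) = (\<lambda>\<Omega>. orientation \<Omega> 0 p q)"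
    by (simp add: orientation_def fun_eq_iff)
  ultimately have "semialg polys W (U_set n \<omega> \<inter> {\<Omega> \<in> W. orientation \<Omega> 0 p q > 0})"
    by (intro semialg.inter semialg_U_set semialg.pos) simp
  also have "U_set n \<omega> \<inter> {\<Omega> \<in> W. orientation \<Omega> 0 p q > 0} = U_plus n \<omega>"
    using U_plus_iff[OF ref] by (auto simp: U_set_def)
  finally show ?thesis by (rule semialgebraic_in_of_semialg)
qed

end

section \<open>The geometry of the set of positive forms\<close>

theorem theorem1p1:
  fixes \<omega> :: "'a::euclidean_space \<Rightarrow> 'a \<Rightarrow> real" and n :: nat
  assumes "symplectic_form \<omega>" and "DIM('a) = 2 * n" and "n > 0"
  shows "openin (top_of_set (complex_primitive_forms n \<omega>)) (U_plus n \<omega>) \<and>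
         semialgebraic_in (complex_primitive_forms n \<omega>) (U_plus n \<omega>) \<and>
         U_plus n \<omega> homotopy_eqv sphere (0::complex) 1 \<and>
         acts_properly (Sp \<omega>) (U_plus n \<omega>) (Sp_action n \<omega>)"
proof -
  interpret symplectic \<omega> n using assms by unfold_locales
  obtain p q where "frame p q" using frame_exists by blast
  then interpret polarized \<omega> n p q by unfold_locales
  show ?thesis
    using openin_U_plus semialgebraic_U_plus U_plus_homotopy_eqv_circle acts_properly_Sp by blast
qed

end
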